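(* Let $f:\mathbb{R}^{n+1}\to\mathbb{R}$ be a $C^2$ function without critical points which is a subsolution of the $1$-harmonic equation with constant $1$-tension field, i.e. $\operatorname{div}\left(\frac{\nabla f}{|\nabla f|}\right)=c$ on $\mathbb{R}^{n+1}$ for some constant $c\ge 0$. Then every level hypersurface $\{x: f(x)=\lambda\}$ of $f$ is calibrated, and hence is area-minimizing over $\mathbb{R}$.
   Context: For a $C^2$ function $f$ without critical points, $\operatorname{div}(\nabla f/|\nabla f|)$ is called the $1$-tension field of $f$, and the $1$-harmonic equation is $\operatorname{div}(\nabla f/|\nabla f|)=0$. A calibration is a closed differential form with comass $1$, i.e. its supremum over unit simple vectors at each point is $1$. An oriented hypersurface is calibrated if there is a calibration on the ambient space whose restriction to the hypersurface is its volume form. A level hypersurface is regarded as the $n$-dimensional current of integration over it, oriented as the boundary of $\{f\ge\lambda\}$. A $k$-dimensional locally rectifiable current $T$ in $\mathbb{R}^{n+1}$ is (absolutely) area-minimizing over $\mathbb{R}$ if for all compact $K$, $\mathbf{M}(\phi_KT)\le\mathbf{M}(\phi_KT+S)$ for all compactly supported $k$-dimensional real flat chains $S$ (in the sense of Federer) with $\partial S=0$; here $\mathbf{M}$ is mass and $\phi_KT$ is the restriction of $T$ to $K$. *)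

theory Defs
  imports "HOL-Analysis.Analysis"
begin

text \<open>Intended for open \<open>U\<close> only, since the derivatives are full derivatives at the points of \<open>U\<close>.\<close>

fun C_diff :: "nat \<Rightarrow> 'a::euclidean_space set \<Rightarrow> ('a \<Rightarrow> 'b::real_normed_vector) \<Rightarrow> bool" where
  "C_diff 0 U f \<longleftrightarrow> continuous_on U f"
| "C_diff (Suc k) U f \<longleftrightarrow> (\<forall>x\<in>U. f differentiable (at x)) \<and>
     (\<forall>v. C_diff k U (\<lambda>x. frechet_derivative f (at x) v))"

definition gradient :: "('a::euclidean_space \<Rightarrow> real) \<Rightarrow> 'a \<Rightarrow> 'a" where
  "gradient f x = (THE D. GDERIV f x :> D)"

definition divergence :: "('a::euclidean_space \<Rightarrow> 'a) \<Rightarrow> 'a \<Rightarrow> real" where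
  "divergence X x = (\<Sum>b\<in>Basis. frechet_derivative X (at x) b \<bullet> b)"

definition unit_gradient :: "('a::euclidean_space \<Rightarrow> real) \<Rightarrow> 'a \<Rightarrow> 'a" where
  "unit_gradient f x = gradient f x /\<^sub>R norm (gradient f x)"

definition one_tension :: "('a::euclidean_space \<Rightarrow> real) \<Rightarrow> 'a \<Rightarrow> real" where
  "one_tension f = divergence (unit_gradient f)"

text \<open>
  A \<open>k\<close>-covector is an alternating \<open>k\<close>-linear function of \<open>v 0, \<dots>, v (k - 1)\<close>; its argument is a
  sequence of vectors of which only the first \<open>k\<close> matter. Keeping \<open>k\<close> a natural number instead of
  a type allows forms of degrees \<open>k - 1\<close>, \<open>k\<close>, \<open>k + 1\<close> in the same statement.
\<close>

type_synonym 'a covec = "(nat \<Rightarrow> 'a) \<Rightarrow> real"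
type_synonym 'a form = "'a \<Rightarrow> 'a covec"

definition k_covector :: "nat \<Rightarrow> 'a::euclidean_space covec \<Rightarrow> bool" where
  "k_covector k \<alpha> \<longleftrightarrow>
     (\<forall>v w. (\<forall>i<k. v i = w i) \<longrightarrow> \<alpha> v = \<alpha> w) \<and>
     (\<forall>v. \<forall>i<k. linear (\<lambda>x. \<alpha> (v(i := x)))) \<and>
     (\<forall>v. \<forall>i<k. \<forall>j<k. i \<noteq> j \<and> v i = v j \<longrightarrow> \<alpha> v = 0)"

definition orthonormal_frame :: "nat \<Rightarrow> (nat \<Rightarrow> 'a::euclidean_space) \<Rightarrow> bool" where
  "orthonormal_frame k v \<longleftrightarrow> (\<forall>i<k. \<forall>j<k. v i \<bullet> v j = (if i = j then 1 else 0))"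

text \<open>
  For \<open>k \<ge> 1\<close>, the unit simple \<open>k\<close>-vectors are exactly the products \<open>v 0 \<and> \<dots> \<and> v (k - 1)\<close> of
  orthonormal frames. For \<open>k = 0\<close> they are \<open>\<plusminus>1\<close>, hence the absolute value. The definition is used
  only for \<open>k \<le> DIM('a)\<close>, where frames exist.
\<close>

definition comass :: "nat \<Rightarrow> 'a::euclidean_space covec \<Rightarrow> real" where
  "comass k \<alpha> = (SUP v\<in>{v. orthonormal_frame k v}. \<bar>\<alpha> v\<bar>)"

definition C_form :: "nat \<Rightarrow> nat \<Rightarrow> 'a::euclidean_space form \<Rightarrow> bool" where
  "C_form m k \<omega> \<longleftrightarrow> (\<forall>x. k_covector k (\<omega> x)) \<and> (\<forall>v. C_diff m UNIV (\<lambda>x. \<omega> x v))"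

text \<open>\<open>(d\<omega>)\<^sub>x(v\<^sub>0,\<dots>,v\<^sub>k) = \<Sum>\<^sub>i (-1)\<^sup>i D\<^sub>v\<^sub>i \<omega>(v\<^sub>0,\<dots>,v\<^sub>i\<^sub>-\<^sub>1,v\<^sub>i\<^sub>+\<^sub>1,\<dots>,v\<^sub>k)\<close> for constant vectors \<open>v\<^sub>i\<close>.\<close>

definition ext_deriv :: "nat \<Rightarrow> 'a::euclidean_space form \<Rightarrow> 'a form" where
  "ext_deriv k \<omega> x v =
     (\<Sum>i\<le>k. (- 1) ^ i *
        frechet_derivative (\<lambda>y. \<omega> y (\<lambda>j. if j < i then v j else v (Suc j))) (at x) (v i))"

definition calibration :: "nat \<Rightarrow> 'a::euclidean_space form \<Rightarrow> bool" where
  "calibration k \<omega> \<longleftrightarrow> C_form 1 k \<omega> \<and> (\<forall>x v. ext_deriv k \<omega> x v = 0) \<and> (\<forall>x. comass k (\<omega> x) = 1)"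

text \<open>
  The bijection \<open>ix\<close> of the index type with \<open>{..<CARD('n)}\<close> orders the coordinates
  and thereby orients the space: the frame \<open>v (ix i) = axis i 1\<close> has volume \<open>1\<close>.
\<close>

definition volume_form :: "('n \<Rightarrow> nat) \<Rightarrow> (real ^ 'n) covec" where
  "volume_form ix v = det (\<chi> i. v (ix i))"

text \<open>
  An oriented hypersurface is a set \<open>M\<close> with a unit normal field \<open>N\<close>; the tangent space at \<open>x\<close> is
  the orthogonal complement of \<open>N x\<close>, and a tangent frame \<open>v\<close> is positive if \<open>N x, v 0, v 1, \<dots>\<close> is.
  Thus for the outward normal of a domain it is the boundary orientation of Stokes' theorem.
\<close>

definition hypersurface_volume_form ::
    "('n \<Rightarrow> nat) \<Rightarrow> (real ^ 'n \<Rightarrow> real ^ 'n) \<Rightarrow> (real ^ 'n) form" where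
  "hypersurface_volume_form ix N x v = volume_form ix (case_nat (N x) v)"

definition calibrated ::
    "('n \<Rightarrow> nat) \<Rightarrow> nat \<Rightarrow> (real ^ 'n) set \<Rightarrow> (real ^ 'n \<Rightarrow> real ^ 'n) \<Rightarrow> bool" where
  "calibrated ix n M N \<longleftrightarrow>
     (\<exists>\<omega>. calibration n \<omega> \<and>
        (\<forall>x\<in>M. \<forall>v. (\<forall>i<n. v i \<bullet> N x = 0) \<longrightarrow> \<omega> x v = hypersurface_volume_form ix N x v))"

definition level_hypersurface :: "('a \<Rightarrow> real) \<Rightarrow> real \<Rightarrow> 'a set" where
  "level_hypersurface f l = {x. f x = l}"

text \<open>The unit normal pointing out of \<open>{x. f x \<ge> l}\<close>.\<close>

definition level_normal :: "('a::euclidean_space \<Rightarrow> real) \<Rightarrow> 'a \<Rightarrow> 'a" where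
  "level_normal f x = - unit_gradient f x"

text \<open>
  A choice of positive orthonormal tangent frame. Its product, the orienting \<open>n\<close>-vector,
  does not depend on the choice.
\<close>

definition positive_frame ::
    "('n \<Rightarrow> nat) \<Rightarrow> nat \<Rightarrow> (real ^ 'n \<Rightarrow> real ^ 'n) \<Rightarrow> real ^ 'n \<Rightarrow> nat \<Rightarrow> real ^ 'n" where
  "positive_frame ix n N x =
     (SOME v. orthonormal_frame n v \<and> (\<forall>i<n. v i \<bullet> N x = 0) \<and> hypersurface_volume_form ix N x v > 0)"

text \<open>
  The normalisation is the one for which \<open>k\<close>-dimensional Hausdorff measure is \<open>k\<close>-dimensional
  area. Empty covering sets count \<open>0\<close> also for \<open>k = 0\<close>, where \<open>0 ^ 0 = 1\<close>.
\<close>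

definition hausdorff_weight :: "nat \<Rightarrow> 'a::euclidean_space set \<Rightarrow> ennreal" where
  "hausdorff_weight k C =
     (if C = {} then 0 else ennreal (unit_ball_vol (real k) * (diameter C / 2) ^ k))"

definition hausdorff_content :: "nat \<Rightarrow> real \<Rightarrow> 'a::euclidean_space set \<Rightarrow> ennreal" where
  "hausdorff_content k \<delta> A =
     (INF C\<in>{C :: nat \<Rightarrow> 'a set. A \<subseteq> (\<Union>i. C i) \<and> (\<forall>i. bounded (C i) \<and> diameter (C i) \<le> \<delta>)}.
        \<Sum>i. hausdorff_weight k (C i))"

definition hausdorff_outer :: "nat \<Rightarrow> 'a::euclidean_space set \<Rightarrow> ennreal" where
  "hausdorff_outer k A = (SUP \<delta>\<in>{0<..}. hausdorff_content k \<delta> A)"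

text \<open>
  As a metric outer measure, \<^const>\<open>hausdorff_outer\<close> is countably additive on the Borel sets, so
  that \<^const>\<open>measure_of\<close> yields its restriction to them.
\<close>

definition hausdorff_measure :: "nat \<Rightarrow> 'a::euclidean_space measure" where
  "hausdorff_measure k = measure_of UNIV (sets borel) (hausdorff_outer k)"

text \<open>
  A functional is evaluated on test forms only; its values elsewhere are irrelevant.
  Continuity for the usual topology of test forms need not be required separately:
  it follows from finite mass for normal currents, hence for flat chains, which are
  limits of normal currents in the flat norm.
\<close>

type_synonym 'a functional = "'a form \<Rightarrow> real"

definition test_form :: "nat \<Rightarrow> 'a::euclidean_space form \<Rightarrow> bool" where
  "test_form k \<phi> \<longleftrightarrow> (\<forall>m. C_form m k \<phi>) \<and> (\<exists>K. compact K \<and> (\<forall>x. x \<notin> K \<longrightarrow> \<phi> x = (\<lambda>_. 0)))"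

definition linear_functional :: "nat \<Rightarrow> 'a::euclidean_space functional \<Rightarrow> bool" where
  "linear_functional k T \<longleftrightarrow>
     (\<forall>\<phi> \<psi> a b. test_form k \<phi> \<longrightarrow> test_form k \<psi> \<longrightarrow>
        T (\<lambda>x v. a * \<phi> x v + b * \<psi> x v) = a * T \<phi> + b * T \<psi>)"

definition mass :: "nat \<Rightarrow> 'a::euclidean_space functional \<Rightarrow> ereal" where
  "mass k T = (SUP \<phi>\<in>{\<phi>. test_form k \<phi> \<and> (\<forall>x. comass k (\<phi> x) \<le> 1)}. ereal (T \<phi>))"

text \<open>The degree \<open>k\<close> is that of the argument of the boundary, so \<open>T\<close> has degree \<open>Suc k\<close>.\<close>

definition boundary :: "nat \<Rightarrow> 'a::euclidean_space functional \<Rightarrow> 'a functional" where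
  "boundary k T \<phi> = T (ext_deriv k \<phi>)"

definition supported_in :: "nat \<Rightarrow> 'a::euclidean_space set \<Rightarrow> 'a functional \<Rightarrow> bool" where
  "supported_in k K T \<longleftrightarrow>
     (\<forall>\<phi>. test_form k \<phi> \<and> closure {x. \<phi> x \<noteq> (\<lambda>_. 0)} \<inter> K = {} \<longrightarrow> T \<phi> = 0)"

text \<open>The boundary of a current of dimension \<open>0\<close> is \<open>0\<close>.\<close>

definition normal_current :: "nat \<Rightarrow> 'a::euclidean_space functional \<Rightarrow> bool" where
  "normal_current k T \<longleftrightarrow> linear_functional k T \<and> mass k T < \<infinity> \<and>
     (k > 0 \<longrightarrow> mass (k - 1) (boundary (k - 1) T) < \<infinity>)"

definition is_cycle :: "nat \<Rightarrow> 'a::euclidean_space functional \<Rightarrow> bool" where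
  "is_cycle k T \<longleftrightarrow> (k > 0 \<longrightarrow> (\<forall>\<phi>. test_form (k - 1) \<phi> \<longrightarrow> boundary (k - 1) T \<phi> = 0))"

text \<open>
  Dual of Federer's flat seminorm \<open>sup\<^sub>x\<^sub>\<in>\<^sub>K max (comass \<phi>(x)) (comass d\<phi>(x))\<close> of test forms.
\<close>

definition flat_norm :: "nat \<Rightarrow> 'a::euclidean_space set \<Rightarrow> 'a functional \<Rightarrow> ereal" where
  "flat_norm k K T =
     (SUP \<phi>\<in>{\<phi>. test_form k \<phi> \<and>
                (\<forall>x\<in>K. comass k (\<phi> x) \<le> 1 \<and> comass (Suc k) (ext_deriv k \<phi> x) \<le> 1)}. ereal (T \<phi>))"

text \<open>
  Compactly supported real flat chains, following Federer: for some compact \<open>K\<close>, the functional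
  lies in the flat-norm closure of the normal currents supported in \<open>K\<close>.
\<close>

definition real_flat_chain :: "nat \<Rightarrow> 'a::euclidean_space functional \<Rightarrow> bool" where
  "real_flat_chain k S \<longleftrightarrow> linear_functional k S \<and>
     (\<exists>K. compact K \<and>
        (\<forall>\<epsilon>>0. \<exists>R. normal_current k R \<and> supported_in k K R \<and>
           flat_norm k K (\<lambda>\<phi>. S \<phi> - R \<phi>) < ereal \<epsilon>))"

text \<open>
  \<open>M\<close> is a \<open>k\<close>-dimensional embedded \<open>C\<^sup>1\<close> submanifold, described by local defining functions, with
  tangent spaces \<open>TM\<close>.
\<close>

definition submanifold :: "nat \<Rightarrow> 'a::euclidean_space set \<Rightarrow> ('a \<Rightarrow> 'a set) \<Rightarrow> bool" where
  "submanifold k M TM \<longleftrightarrow>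
     (\<forall>x\<in>M. \<exists>U V. \<exists>g :: 'a \<Rightarrow> 'a.
        open U \<and> x \<in> U \<and> subspace V \<and> dim V + k = DIM('a) \<and>
        C_diff 1 U g \<and> g ` U \<subseteq> V \<and> M \<inter> U = {y \<in> U. g y = 0} \<and>
        (\<forall>y\<in>M \<inter> U. range (frechet_derivative g (at y)) = V \<and>
                    TM y = {v. frechet_derivative g (at y) v = 0}))"

text \<open>
  Integration over the carrier \<open>W\<close> with multiplicity \<open>\<theta>\<close>, oriented by
  \<open>\<tau> x 0 \<and> \<dots> \<and> \<tau> x (k - 1)\<close>.
\<close>

definition integration_current ::
    "nat \<Rightarrow> 'a::euclidean_space set \<Rightarrow> ('a \<Rightarrow> nat) \<Rightarrow> ('a \<Rightarrow> nat \<Rightarrow> 'a) \<Rightarrow> 'a functional" where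
  "integration_current k W \<theta> \<tau> \<phi> =
     set_lebesgue_integral (hausdorff_measure k) W (\<lambda>x. real (\<theta> x) * \<phi> x (\<tau> x))"

text \<open>
  The data \<open>(W, \<theta>, \<tau>)\<close> represent a locally rectifiable current: the mass is locally finite, and
  almost all of \<open>W\<close> is covered by countably many \<open>C\<^sup>1\<close> submanifolds, whose tangent spaces are
  oriented by \<open>\<tau>\<close>. Measurability of the \<open>k\<close>-vector given by \<open>\<tau>\<close> is expressed by pairing it with
  constant covectors, as the frame itself is not determined by the \<open>k\<close>-vector.
\<close>

definition locally_rectifiable ::
    "nat \<Rightarrow> 'a::euclidean_space set \<Rightarrow> ('a \<Rightarrow> nat) \<Rightarrow> ('a \<Rightarrow> nat \<Rightarrow> 'a) \<Rightarrow> bool" where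
  "locally_rectifiable k W \<theta> \<tau> \<longleftrightarrow>
     W \<in> sets borel \<and>
     \<theta> \<in> measurable borel (count_space UNIV) \<and> (\<forall>x\<in>W. \<theta> x > 0) \<and>
     (\<forall>x\<in>W. orthonormal_frame k (\<tau> x)) \<and>
     (\<forall>\<alpha>. k_covector k \<alpha> \<longrightarrow> (\<lambda>x. indicator W x * \<alpha> (\<tau> x)) \<in> borel_measurable borel) \<and>
     (\<forall>K. compact K \<longrightarrow>
        (\<integral>\<^sup>+x. of_nat (\<theta> x) * indicator (W \<inter> K) x \<partial>hausdorff_measure k) < \<infinity>) \<and>
     (\<exists>(M :: nat \<Rightarrow> 'a set) TM.
        (\<forall>j. submanifold k (M j) (TM j)) \<and>
        (AE x in hausdorff_measure k. x \<in> W \<longrightarrow>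
           (\<exists>j. x \<in> M j) \<and> (\<forall>j. x \<in> M j \<longrightarrow> span (\<tau> x ` {..<k}) = TM j x)))"

text \<open>
  The restriction of the current represented by \<open>(W, \<theta>, \<tau>)\<close> to \<open>K\<close> is the one represented by
  \<open>(W \<inter> K, \<theta>, \<tau>)\<close>.
\<close>

definition area_minimizing_over_R ::
    "nat \<Rightarrow> 'a::euclidean_space set \<Rightarrow> ('a \<Rightarrow> nat) \<Rightarrow> ('a \<Rightarrow> nat \<Rightarrow> 'a) \<Rightarrow> bool" where
  "area_minimizing_over_R k W \<theta> \<tau> \<longleftrightarrow> locally_rectifiable k W \<theta> \<tau> \<and>
     (\<forall>K S. compact K \<longrightarrow> real_flat_chain k S \<longrightarrow> is_cycle k S \<longrightarrow>
        mass k (integration_current k (W \<inter> K) \<theta> \<tau>)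
          \<le> mass k (\<lambda>\<phi>. integration_current k (W \<inter> K) \<theta> \<tau> \<phi> + S \<phi>))"

end

theory Submission
  imports Defs
begin

text \<open>
  A unit vector field on Euclidean space has divergence of average at most of the order of \<open>1/R\<close> on
  a ball of radius \<open>R\<close>, so the constant \<open>c\<close> is \<open>0\<close>. Hence the contraction \<open>\<omega>\<close> of the volume form with
  the unit normal \<open>N\<close> of the level sets is closed, as \<open>d\<omega>\<close> is \<open>div N\<close> times the volume form; by Hadamard's
  inequality it is a calibration.

  Now let \<open>T\<close> be the restriction of a level set to \<open>K\<close> and \<open>S\<close> a flat cycle. Since \<open>\<omega>\<close> is only
  \<open>C\<^sup>1\<close>, mollify it: \<open>\<omega>\<^sub>\<epsilon>\<close> is smooth, closed and of comass at most \<open>1\<close>, hence \<open>\<omega>\<^sub>\<epsilon> = d\<eta>\<close>. With a cutoff \<open>\<kappa>\<close>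
  equal to \<open>1\<close> near \<open>K\<close> and the support of \<open>S\<close>, the test forms \<open>\<kappa>\<omega>\<^sub>\<epsilon>\<close> and \<open>d(\<kappa>\<eta>)\<close> agree near this support,
  so \<open>S(\<kappa>\<omega>\<^sub>\<epsilon>) = \<partial>S(\<kappa>\<eta>) = 0\<close>, and the mass of \<open>T + S\<close> is at least \<open>T(\<kappa>\<omega>\<^sub>\<epsilon>) = T(\<omega>\<^sub>\<epsilon>)\<close>, which tends to
  \<open>T(\<omega>)\<close>, the mass of \<open>T\<close>.
\<close>

subsection \<open>Alternating covectors\<close>

text \<open>\<open>positive_frame\<close> is an arbitrary choice at each point, so nothing is known
  about how it depends on the point. Measurability and limits are rescued by
  \<open>covector_on_frame\<close>: the value of an n-covector on such a frame is an explicit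
  expression in the normal alone. This formula and the identity for \<open>d\<close> of the
  contracted volume form have one source, that (n + 1)-covectors in dimension n + 1 form a line.
  Mollification acts on the coefficients of a form for constant vectors. So it commutes with
  \<open>ext_deriv\<close> and, being an average, keeps the bound 1 on each orthonormal frame. That
  a flat chain ignores forms vanishing near \<open>K\<close> follows by scaling: all multiples of
  such a form have flat seminorm 0 on \<open>K\<close>, while the chain differs from a current
  supported in \<open>K\<close> by a functional of finite flat norm. The two masses are compared
  through the Hausdorff measure of the part of the level set in \<open>K\<close>: it bounds the mass
  of T from above and is the limit of the values of T on the mollified forms. This measure has to be
  finite, which is why level sets are shown to be local Lipschitz graphs.\<close>

definition omit :: "nat \<Rightarrow> (nat \<Rightarrow> 'a) \<Rightarrow> nat \<Rightarrow> 'a" where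
  "omit i v = (\<lambda>j. if j < i then v j else v (Suc j))"

lemma k_covector_cong:
  "k_covector k \<alpha> \<Longrightarrow> (\<And>i. i < k \<Longrightarrow> v i = w i) \<Longrightarrow> \<alpha> v = \<alpha> w"
  unfolding k_covector_def by blast

lemma k_covector_linear: "k_covector k \<alpha> \<Longrightarrow> i < k \<Longrightarrow> linear (\<lambda>x. \<alpha> (v(i := x)))"
  unfolding k_covector_def by blast

lemma k_covector_alternating:
  "k_covector k \<alpha> \<Longrightarrow> i < k \<Longrightarrow> j < k \<Longrightarrow> i \<noteq> j \<Longrightarrow> v i = v j \<Longrightarrow> \<alpha> v = 0"
  unfolding k_covector_def by blast

lemma k_covector_lincomb:
  assumes "k_covector k \<alpha>" "k_covector k \<beta>"
  shows "k_covector k (\<lambda>v. a * \<alpha> v + b * \<beta> v)"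
  unfolding k_covector_def
proof (intro conjI allI impI)
  show "a * \<alpha> v + b * \<beta> v = a * \<alpha> w + b * \<beta> w" if "\<forall>i<k. v i = w i" for v w
    using k_covector_cong[OF assms(1), of v w] k_covector_cong[OF assms(2), of v w] that by auto
  show "linear (\<lambda>x. a * \<alpha> (v(i := x)) + b * \<beta> (v(i := x)))" if "i < k" for v i
    using linear_compose_add[OF linear_compose_scale_right[OF k_covector_linear[OF assms(1) that, of v], of a]
        linear_compose_scale_right[OF k_covector_linear[OF assms(2) that, of v], of b]]
    by simp
  show "a * \<alpha> v + b * \<beta> v = 0" if "i < k" "j < k" "i \<noteq> j \<and> v i = v j" for v i j
    using k_covector_alternating[OF assms(1), of i j v] k_covector_alternating[OF assms(2), of i j v] that
    by auto
qed

lemma k_covector_scale: "k_covector k \<alpha> \<Longrightarrow> k_covector k (\<lambda>v. a * \<alpha> v)"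
  using k_covector_lincomb[of k \<alpha> \<alpha> a 0] by simp

text \<open>Polarization: the value with \<open>v i + v j\<close> in both slots is 0 and expands
  into the two mixed terms. Alternation is assumed for the pair \<open>i\<close>, \<open>j\<close>
  only, because \<open>k_covector_adjacentI\<close> applies this when just neighbouring slots are
  known to alternate.\<close>

lemma alternating_swap_sign:
  fixes \<alpha> :: "'a::euclidean_space covec"
  assumes lin: "\<And>v i. i < k \<Longrightarrow> linear (\<lambda>x. \<alpha> (v(i := x)))"
    and alt: "\<And>v. v i = v j \<Longrightarrow> \<alpha> v = 0"
    and ij: "i < k" "j < k" "i \<noteq> j"
  shows "\<alpha> (v(i := v j, j := v i)) = - \<alpha> v"
proof -
  define A where "A x y = \<alpha> (v(i := x, j := y))" for x y
  have l1: "linear (A x)" for x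
    using lin[OF ij(2), of "v(i := x)"] by (simp add: A_def[abs_def])
  have l2: "linear (\<lambda>x. A x y)" for y
    using lin[OF ij(1), of "v(j := y)"] ij(3) by (simp add: A_def[abs_def] fun_upd_twist)
  have z: "A x x = 0" for x
    using alt[of "v(i := x, j := x)"] ij(3) by (simp add: A_def)
  have "0 = A (v i + v j) (v i + v j)"
    by (simp add: z)
  also have "\<dots> = A (v i) (v j) + A (v j) (v i)"
    by (simp only: linear_add[OF l1] linear_add[OF l2]) (simp add: z)
  finally show ?thesis
    by (simp add: A_def)
qed

lemma k_covector_swap:
  assumes "k_covector k \<alpha>" "i < k" "j < k" "i \<noteq> j"
  shows "\<alpha> (v(i := v j, j := v i)) = - \<alpha> v"
  by (rule alternating_swap_sign[OF k_covector_linear[OF assms(1)] k_covector_alternating[OF assms]])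
     (use assms in auto)

text \<open>Equal entries that are further apart are brought together: swapping the right one with
  its left neighbour changes only the sign and shortens the distance by one.\<close>

lemma k_covector_adjacentI:
  fixes \<alpha> :: "'a::euclidean_space covec"
  assumes cong: "\<And>v w. (\<And>i. i < k \<Longrightarrow> v i = w i) \<Longrightarrow> \<alpha> v = \<alpha> w"
    and lin: "\<And>v i. i < k \<Longrightarrow> linear (\<lambda>x. \<alpha> (v(i := x)))"
    and adj: "\<And>v i. Suc i < k \<Longrightarrow> v i = v (Suc i) \<Longrightarrow> \<alpha> v = 0"
  shows "k_covector k \<alpha>"
proof -
  have gap: "\<alpha> v = 0" if "Suc (p + d) < k" "v p = v (Suc (p + d))" for p d v
    using that
  proof (induction d arbitrary: v)
    case 0
    then show ?case using adj[of p v] by simp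
  next
    case (Suc d)
    let ?q = "Suc (p + d)"
    let ?w = "v(?q := v (Suc ?q), Suc ?q := v ?q)"
    have "\<alpha> ?w = - \<alpha> v"
      by (rule alternating_swap_sign[OF lin adj]) (use Suc.prems in auto)
    moreover have "\<alpha> ?w = 0"
      by (rule Suc.IH) (use Suc.prems in auto)
    ultimately show ?case by simp
  qed
  have alt: "\<alpha> v = 0" if "i < k" "j < k" "i < j" "v i = v j" for v i j
  proof -
    obtain d where "j = Suc (i + d)"
      using less_imp_Suc_add[OF \<open>i < j\<close>] by auto
    then show ?thesis using gap that by auto
  qed
  show ?thesis
    unfolding k_covector_def
    using cong lin alt by (metis linorder_neqE_nat)
qed

lemma omit_upd_same: "omit i (v(i := x)) = omit i v"
  by (auto simp: omit_def)

lemma omit_upd_less: "l < i \<Longrightarrow> omit i (v(l := x)) = (omit i v)(l := x)"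
  by (auto simp: omit_def fun_eq_iff)

lemma omit_upd_greater: "i < l \<Longrightarrow> omit i (v(l := x)) = (omit i v)(l - 1 := x)"
  by (auto simp: omit_def fun_eq_iff)

text \<open>If the entries \<open>p\<close> and \<open>p + 1\<close> agree, every other term still
  contains both of them and vanishes, while these two terms omit equal vectors and cancel by sign.
  This covers exterior derivatives (\<open>B\<close> a directional derivative) as well as the wedge
  product of a 1-covector with a k-covector.\<close>

lemma k_covector_antisymmetrize:
  fixes B :: "'a::euclidean_space \<Rightarrow> 'a covec"
  assumes lin: "\<And>v. linear (\<lambda>u. B u v)" and cov: "\<And>u. k_covector k (B u)"
  shows "k_covector (Suc k) (\<lambda>v. \<Sum>i\<le>k. (-1) ^ i * B (v i) (omit i v))"
proof (rule k_covector_adjacentI)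
  fix v w :: "nat \<Rightarrow> 'a"
  assume "\<And>i. i < Suc k \<Longrightarrow> v i = w i"
  moreover from this have "B u (omit i v) = B u (omit i w)" if "i \<le> k" for u i
    using that by (intro k_covector_cong[OF cov]) (auto simp: omit_def)
  ultimately show "(\<Sum>i\<le>k. (-1) ^ i * B (v i) (omit i v)) = (\<Sum>i\<le>k. (-1) ^ i * B (w i) (omit i w))"
    by (intro sum.cong) auto
next
  fix v :: "nat \<Rightarrow> 'a" and l assume l: "l < Suc k"
  have "linear (\<lambda>x. (-1) ^ i * B ((v(l := x)) i) (omit i (v(l := x))))" if "i \<le> k" for i
  proof -
    consider "i = l" | "l < i" | "i < l" by linarith
    then have "linear (\<lambda>x. B ((v(l := x)) i) (omit i (v(l := x))))"
    proof cases
      case 1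
      then show ?thesis using lin by (simp add: omit_upd_same)
    next
      case 2
      then show ?thesis
        using k_covector_linear[OF cov, of l] that by (simp add: omit_upd_less)
    next
      case 3
      then show ?thesis
        using k_covector_linear[OF cov, of "l - 1"] l by (simp add: omit_upd_greater)
    qed
    from linear_compose_scale_right[OF this, of "(-1) ^ i"] show ?thesis by simp
  qed
  then show "linear (\<lambda>x. \<Sum>i\<le>k. (-1) ^ i * B ((v(l := x)) i) (omit i (v(l := x))))"
    by (intro linear_compose_sum) auto
next
  fix v :: "nat \<Rightarrow> 'a" and p assume p: "Suc p < Suc k" "v p = v (Suc p)"
  have eq: "omit p v = omit (Suc p) v"
    using p(2) by (auto simp: omit_def fun_eq_iff less_Suc_eq)
  have "(-1) ^ i * B (v i) (omit i v) = 0" if "i \<le> k" "i \<noteq> p" "i \<noteq> Suc p" for i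
  proof -
    \<comment> \<open>Deleting an entry before \<open>p\<close> shifts the equal pair down by one
      position; deleting one after it leaves the pair in place.\<close>
    have "\<exists>a b. a < k \<and> b < k \<and> a \<noteq> b \<and> omit i v a = omit i v b"
    proof (cases "i < p")
      case True
      then show ?thesis
        using p by (intro exI[of _ "p - 1"] exI[of _ p]) (auto simp: omit_def)
    next
      case False
      then show ?thesis
        using p that by (intro exI[of _ p] exI[of _ "Suc p"]) (auto simp: omit_def)
    qed
    then show ?thesis
      using k_covector_alternating[OF cov] by (metis mult_zero_right)
  qed
  then have "(\<Sum>i\<le>k. (-1) ^ i * B (v i) (omit i v)) = (\<Sum>i\<in>{p, Suc p}. (-1) ^ i * B (v i) (omit i v))"
    using p by (intro sum.mono_neutral_right) auto
  then show "(\<Sum>i\<le>k. (-1) ^ i * B (v i) (omit i v)) = 0"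
    using p eq by simp
qed

text \<open>One transposition of neighbours per step: after swapping the entries \<open>i\<close>
  and \<open>i + 1\<close>, the vector to be moved stands at position \<open>i\<close>, and the sign
  has changed once.\<close>

lemma k_covector_move_to_front:
  assumes "k_covector k \<alpha>" "i < k"
  shows "\<alpha> (case_nat (v i) (omit i v)) = (-1) ^ i * \<alpha> v"
  using assms(2)
proof (induction i arbitrary: v)
  case 0
  have "case_nat (v 0) (omit 0 v) = v"
    by (auto simp: omit_def fun_eq_iff split: nat.split)
  then show ?case by simp
next
  case (Suc i)
  define w where "w = v(i := v (Suc i), Suc i := v i)"
  have "omit i w = omit (Suc i) v"
    by (auto simp: w_def omit_def fun_eq_iff less_Suc_eq)
  then have "\<alpha> (case_nat (v (Suc i)) (omit (Suc i) v)) = (-1) ^ i * \<alpha> w"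
    using Suc.IH[of w] Suc.prems by (metis Suc_lessD fun_upd_apply n_not_Suc_n w_def)
  also have "\<alpha> w = - \<alpha> v"
    using Suc.prems unfolding w_def by (intro k_covector_swap[OF assms(1)]) auto
  finally show ?case by simp
qed

lemma k_covector_interior:
  assumes "k_covector (Suc k) \<alpha>"
  shows "k_covector k (\<lambda>v. \<alpha> (case_nat u v))"
  unfolding k_covector_def
proof (intro conjI allI impI)
  have upd: "case_nat u (v(i := x)) = (case_nat u v)(Suc i := x)" for v i x
    by (auto simp: fun_eq_iff split: nat.split)
  show "\<alpha> (case_nat u v) = \<alpha> (case_nat u w)" if "\<forall>i<k. v i = w i" for v w
    by (rule k_covector_cong[OF assms]) (use that in \<open>auto split: nat.split\<close>)
  show "linear (\<lambda>x. \<alpha> (case_nat u (v(i := x))))" if "i < k" for v i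
    unfolding upd by (rule k_covector_linear[OF assms]) (use that in simp)
  show "\<alpha> (case_nat u v) = 0" if "i < k" "j < k" "i \<noteq> j \<and> v i = v j" for v i j
    by (rule k_covector_alternating[OF assms, of "Suc i" "Suc j"]) (use that in auto)
qed

lemma k_covector_linear_first:
  assumes "k_covector (Suc k) \<alpha>"
  shows "linear (\<lambda>u. \<alpha> (case_nat u v))"
proof -
  have "(case_nat 0 v)(0 := x) = case_nat x v" for x
    by (auto simp: fun_eq_iff split: nat.split)
  then show ?thesis
    using k_covector_linear[OF assms, of 0 "case_nat 0 v"] by simp
qed

lemma k_covector_eq_0_on_Basis:
  fixes \<alpha> :: "'a::euclidean_space covec"
  assumes cov: "k_covector k \<alpha>" and basis: "\<And>v. (\<And>i. i < k \<Longrightarrow> v i \<in> Basis) \<Longrightarrow> \<alpha> v = 0"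
  shows "\<alpha> v = 0"
proof -
  \<comment> \<open>\<open>m\<close> counts the leading slots that may hold arbitrary vectors. Each
    induction step expands the last of them in the basis.\<close>
  have "\<alpha> v = 0" if "m \<le> k" "\<And>i. m \<le> i \<Longrightarrow> i < k \<Longrightarrow> v i \<in> Basis" for m v
    using that
  proof (induction m arbitrary: v)
    case 0
    then show ?case using basis by auto
  next
    case (Suc m)
    define L where "L x = \<alpha> (v(m := x))" for x
    have l: "linear L"
      using k_covector_linear[OF cov, of m v] Suc.prems by (simp add: L_def[abs_def])
    have "\<alpha> v = L (\<Sum>b\<in>Basis. (v m \<bullet> b) *\<^sub>R b)"
      by (simp add: euclidean_representation L_def)
    also have "\<dots> = (\<Sum>b\<in>Basis. (v m \<bullet> b) * L b)"
      by (simp add: linear_sum[OF l] linear_scale[OF l])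
    also have "\<dots> = 0"
    proof (rule sum.neutral, safe)
      fix b :: 'a assume "b \<in> Basis"
      then have "L b = 0"
        using Suc.prems unfolding L_def by (intro Suc.IH) auto
      then show "(v m \<bullet> b) * L b = 0" by simp
    qed
    finally show ?case .
  qed
  from this[of k v] show ?thesis by simp
qed

text \<open>By multilinearity only tuples of basis vectors matter. Those with a repetition give 0;
  the others are permutations of \<open>e\<close>, reached by transpositions that change only the
  sign.\<close>

lemma top_covector_eq_0:
  fixes \<alpha> :: "'a::euclidean_space covec"
  assumes cov: "k_covector k \<alpha>" and e: "bij_betw e {..<k} (Basis :: 'a set)" and "\<alpha> e = 0"
  shows "\<alpha> v = 0"
proof (rule k_covector_eq_0_on_Basis[OF cov])
  fix v :: "nat \<Rightarrow> 'a" assume v: "\<And>i. i < k \<Longrightarrow> v i \<in> Basis"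
  show "\<alpha> v = 0"
  proof (cases "inj_on v {..<k}")
    case False
    then show ?thesis
      using k_covector_alternating[OF cov] unfolding inj_on_def by blast
  next
    case True
    have fin: "finite {..<k}" by simp
    have c: "card (Basis :: 'a set) = k"
      using bij_betw_same_card[OF e] by simp
    have "v ` {..<k} = Basis"
      using v True c by (intro card_subset_eq) (auto simp: card_image)
    then have bv: "bij_betw v {..<k} Basis"
      using True by (simp add: bij_betw_def)
    \<comment> \<open>The identity beyond \<open>k\<close> makes \<open>p\<close> a permutation of
      all naturals in the sense of \<open>permutes\<close>; the covector sees only the entries below
      \<open>k\<close>.\<close>
    define p where "p i = (if i < k then inv_into {..<k} e (v i) else i)" for i
    have "bij_betw (\<lambda>i. inv_into {..<k} e (v i)) {..<k} {..<k}"
      using bij_betw_trans[OF bv bij_betw_inv_into[OF e]] by (simp add: o_def)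
    then have "bij_betw p {..<k} {..<k}"
      by (rule bij_betw_cong[THEN iffD1, rotated]) (simp add: p_def)
    then have perm: "p permutes {..<k}"
      by (rule bij_imp_permutes) (simp add: p_def)
    have vp: "v i = e (p i)" if "i < k" for i
      using bij_betw_inv_into_right[OF e v[OF that]] that by (simp add: p_def)
    have "\<alpha> (e \<circ> p) = 0"
      using fin perm
    proof (induction p rule: permutes_rev_induct)
      case id
      then show ?case using assms(3) by simp
    next
      case (swap a b p)
      have "e \<circ> (p \<circ> Transposition.transpose a b) = (e \<circ> p)(a := (e \<circ> p) b, b := (e \<circ> p) a)"
        by (auto simp: fun_eq_iff Transposition.transpose_def)
      then show ?case
        using k_covector_swap[OF cov, of a b "e \<circ> p"] swap by (metis lessThan_iff minus_zero)
    qed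
    moreover have "\<alpha> v = \<alpha> (e \<circ> p)"
      by (rule k_covector_cong[OF cov]) (simp add: vp)
    ultimately show ?thesis by simp
  qed
qed

text \<open>The difference of the two sides is a covector that vanishes on \<open>e\<close>.\<close>

lemma top_covector_unique:
  fixes \<alpha> :: "'a::euclidean_space covec"
  assumes "k_covector k \<alpha>" "k_covector k \<beta>" "bij_betw e {..<k} (Basis :: 'a set)" "\<beta> e = 1"
  shows "\<alpha> v = \<alpha> e * \<beta> v"
  using top_covector_eq_0[OF k_covector_lincomb[OF assms(1,2), of 1 "- \<alpha> e"] assms(3), of v] assms(4)
  by simp

subsection \<open>Calculus of smooth functions\<close>

abbreviation D :: "('a::euclidean_space \<Rightarrow> real) \<Rightarrow> 'a \<Rightarrow> 'a \<Rightarrow> real" where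
  "D f x v \<equiv> frechet_derivative f (at x) v"

lemma C_diff_SucI:
  fixes f :: "'a::euclidean_space \<Rightarrow> real"
  assumes "\<And>x. (f has_derivative f' x) (at x)" "\<And>v. C_diff k UNIV (\<lambda>x. f' x v)"
  shows "C_diff (Suc k) UNIV f"
  using assms(2) frechet_derivative_at[OF assms(1)]
  by (auto intro: differentiableI[OF assms(1)])

lemma C_diff_Suc_has_derivative:
  fixes f :: "'a::euclidean_space \<Rightarrow> real"
  assumes "C_diff (Suc k) UNIV f"
  shows "(f has_derivative D f x) (at x)"
  using assms by (simp add: frechet_derivative_works)

lemma C_diff_Suc_derivative:
  fixes f :: "'a::euclidean_space \<Rightarrow> real"
  assumes "C_diff (Suc k) UNIV f"
  shows "C_diff k UNIV (\<lambda>x. D f x v)"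
  using assms by simp

declare C_diff.simps(2) [simp del]

lemma C_diff_Suc_imp:
  fixes f :: "'a::euclidean_space \<Rightarrow> real"
  assumes "C_diff (Suc k) UNIV f"
  shows "C_diff k UNIV f"
  using assms
proof (induction k arbitrary: f)
  case 0
  then show ?case
    using has_derivative_continuous[OF C_diff_Suc_has_derivative[OF 0]]
    by (auto simp: continuous_on_eq_continuous_at)
next
  case (Suc k)
  show ?case
    by (rule C_diff_SucI[OF C_diff_Suc_has_derivative[OF Suc.prems]])
       (rule Suc.IH[OF C_diff_Suc_derivative[OF Suc.prems]])
qed

lemma C_diff_le:
  fixes f :: "'a::euclidean_space \<Rightarrow> real"
  assumes "C_diff k UNIV f" "j \<le> k"
  shows "C_diff j UNIV f"
  using assms(2,1) by (induction rule: dec_induct) (auto dest: C_diff_Suc_imp)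

lemma C_diff_continuous:
  fixes f :: "'a::euclidean_space \<Rightarrow> real"
  shows "C_diff k UNIV f \<Longrightarrow> continuous_on UNIV f"
  using C_diff_le[of k f 0] by simp

lemma C_diff_const: "C_diff k UNIV (\<lambda>x::'a::euclidean_space. c :: real)"
  by (induction k arbitrary: c) (auto intro: C_diff_SucI[where f' = "\<lambda>x v. 0"])

lemma C_diff_add:
  fixes f g :: "'a::euclidean_space \<Rightarrow> real"
  assumes "C_diff k UNIV f" "C_diff k UNIV g"
  shows "C_diff k UNIV (\<lambda>x. f x + g x)"
  using assms
proof (induction k arbitrary: f g)
  case 0
  then show ?case by (auto intro: continuous_intros)
next
  case (Suc k)
  show ?case
    by (rule C_diff_SucI[OF has_derivative_add[OF Suc.prems[THEN C_diff_Suc_has_derivative]]])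
       (rule Suc.IH[OF Suc.prems[THEN C_diff_Suc_derivative]])
qed

lemma C_diff_mult:
  fixes f g :: "'a::euclidean_space \<Rightarrow> real"
  assumes "C_diff k UNIV f" "C_diff k UNIV g"
  shows "C_diff k UNIV (\<lambda>x. f x * g x)"
  using assms
proof (induction k arbitrary: f g)
  case 0
  then show ?case by (auto intro: continuous_intros)
next
  case (Suc k)
  show ?case
    by (rule C_diff_SucI[OF has_derivative_mult[OF Suc.prems[THEN C_diff_Suc_has_derivative]]])
       (intro C_diff_add Suc.IH Suc.prems[THEN C_diff_Suc_derivative] Suc.prems[THEN C_diff_Suc_imp])
qed

lemma C_diff_sum:
  fixes f :: "'i \<Rightarrow> 'a::euclidean_space \<Rightarrow> real"
  assumes "\<And>i. i \<in> I \<Longrightarrow> C_diff k UNIV (f i)"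
  shows "C_diff k UNIV (\<lambda>x. \<Sum>i\<in>I. f i x)"
  using assms by (induction I rule: infinite_finite_induct) (auto intro: C_diff_const C_diff_add)

lemma C_diff_inner: "C_diff k UNIV (\<lambda>x::'a::euclidean_space. x \<bullet> b)"
proof (cases k)
  case 0
  then show ?thesis by (auto intro: continuous_intros)
next
  case (Suc j)
  have "((\<lambda>x. x \<bullet> b) has_derivative (\<lambda>v. v \<bullet> b)) (at x)" for x :: 'a
    by (auto intro!: derivative_eq_intros)
  then show ?thesis
    unfolding Suc by (rule C_diff_SucI) (rule C_diff_const)
qed

lemma C_diff_1I:
  fixes f :: "'a::euclidean_space \<Rightarrow> real"
  assumes "\<And>x. (f has_derivative f' x) (at x)" "\<And>v. continuous_on UNIV (\<lambda>x. f' x v)"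
  shows "C_diff 1 UNIV f"
  using C_diff_SucI[of f f' 0] assms by simp

lemma D_eqI: "(f has_derivative f') (at x) \<Longrightarrow> D f x v = f' v"
  using frechet_derivative_at by metis

lemma gradient_eqI:
  assumes "(f has_derivative (\<lambda>v. v \<bullet> g)) (at x)"
  shows "gradient f x = g"
  unfolding gradient_def
proof (rule the_equality)
  show "GDERIV f x :> g" using assms by (simp add: gderiv_def)
  show "d = g" if "GDERIV f x :> d" for d
  proof -
    have "(\<lambda>v. v \<bullet> d) = (\<lambda>v. v \<bullet> g)"
      using that assms has_derivative_unique unfolding gderiv_def by blast
    then have "v \<bullet> d = v \<bullet> g" for v by metis
    then show ?thesis by (metis vector_eq_ldot)
  qed
qed

lemma gradient_eq_sum:
  fixes f :: "'a::euclidean_space \<Rightarrow> real"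
  assumes "f differentiable (at x)"
  shows "gradient f x = (\<Sum>b\<in>Basis. D f x b *\<^sub>R b)" and "D f x v = gradient f x \<bullet> v"
proof -
  have "D f x v = v \<bullet> (\<Sum>b\<in>Basis. D f x b *\<^sub>R b)" for v
  proof -
    note l = linear_frechet_derivative[OF assms]
    have "(\<Sum>b\<in>Basis. (v \<bullet> b) * D f x b) = (\<Sum>b\<in>Basis. D f x ((v \<bullet> b) *\<^sub>R b))"
      by (simp add: linear_scale[OF l])
    also have "\<dots> = D f x (\<Sum>b\<in>Basis. (v \<bullet> b) *\<^sub>R b)"
      by (rule linear_sum[OF l, symmetric])
    also have "\<dots> = D f x v"
      by (simp only: euclidean_representation)
    finally show ?thesis
      by (simp add: inner_sum_right mult.commute[of "D f x _"])
  qed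
  then have *: "D f x = (\<lambda>v. v \<bullet> (\<Sum>b\<in>Basis. D f x b *\<^sub>R b))"
    by (rule ext)
  have "(f has_derivative D f x) (at x)"
    using assms by (simp add: frechet_derivative_works)
  then have "(f has_derivative (\<lambda>v. v \<bullet> (\<Sum>b\<in>Basis. D f x b *\<^sub>R b))) (at x)"
    using * by (rule back_subst[where P = "\<lambda>d. (f has_derivative d) (at x)"])
  then show grad: "gradient f x = (\<Sum>b\<in>Basis. D f x b *\<^sub>R b)"
    by (rule gradient_eqI)
  show "D f x v = gradient f x \<bullet> v"
    using fun_cong[OF *, of v] unfolding grad by (simp only: inner_commute)
qed

lemma C_diff_gradient:
  fixes f :: "'a::euclidean_space \<Rightarrow> real"
  assumes "C_diff (Suc k) UNIV f"
  shows "(f has_derivative (\<lambda>v. gradient f x \<bullet> v)) (at x)"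
    and "continuous_on UNIV (gradient f)"
    and "D f x v = gradient f x \<bullet> v"
proof -
  have d: "f differentiable (at x)" for x
    using C_diff_Suc_has_derivative[OF assms] differentiableI by blast
  have eq: "D f x v = gradient f x \<bullet> v" for v
    by (rule gradient_eq_sum(2)[OF d])
  then show "D f x v = gradient f x \<bullet> v" .
  show "(f has_derivative (\<lambda>v. gradient f x \<bullet> v)) (at x)"
    using C_diff_Suc_has_derivative[OF assms, of x] ext[of "D f x", OF eq] by simp
  show "continuous_on UNIV (gradient f)"
    unfolding gradient_eq_sum(1)[OF d, abs_def]
    using C_diff_continuous[OF C_diff_Suc_derivative[OF assms]] by (intro continuous_intros) auto
qed

definition smooth :: "('a::euclidean_space \<Rightarrow> real) \<Rightarrow> bool" where
  "smooth f \<longleftrightarrow> (\<forall>k. C_diff k UNIV f)"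

lemma smooth_C_diff: "smooth f \<Longrightarrow> C_diff k UNIV f"
  by (simp add: smooth_def)

lemma smooth_derivative: "smooth f \<Longrightarrow> smooth (\<lambda>x. D f x v)"
  unfolding smooth_def using C_diff_Suc_derivative by blast

lemma smooth_has_derivative: "smooth f \<Longrightarrow> (f has_derivative D f x) (at x)"
  unfolding smooth_def using C_diff_Suc_has_derivative by blast

lemma smooth_continuous: "smooth f \<Longrightarrow> continuous_on UNIV f"
  using C_diff_continuous smooth_C_diff by blast

text \<open>For \<open>p = 1\<close> this is the classical function exp(-1/t), flat at 0, from which
  smooth bumps are made; the polynomial makes room for its derivatives.\<close>

definition exp_family :: "real poly \<Rightarrow> real \<Rightarrow> real" where
  "exp_family p t = (if t > 0 then poly p (1 / t) * exp (- (1 / t)) else 0)"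

lemma poly_exp_tendsto_0: "((\<lambda>u. poly p u * exp (- u)) \<longlongrightarrow> 0) (at_top :: real filter)"
proof -
  have "((\<lambda>u. \<Sum>i\<le>degree p. coeff p i * (u ^ i / exp u)) \<longlongrightarrow> (\<Sum>i\<le>degree p. coeff p i * 0)) at_top"
    by (intro tendsto_intros tendsto_power_div_exp_0)
  then show ?thesis
    by (simp add: poly_altdef sum_distrib_right exp_minus divide_inverse mult.assoc)
qed

text \<open>The functions \<open>p(1/t) exp(-1/t)\<close>, extended by \<open>0\<close>, are closed under differentiation.\<close>

lemma exp_family_has_derivative:
  "(exp_family p has_real_derivative exp_family (monom 1 2 * (p - pderiv p)) t) (at t)"
proof -
  consider "t > 0" | "t < 0" | "t = 0" by linarith
  then show ?thesis
  proof cases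
    case 1
    \<comment> \<open>With u = 1/t one has d/dt = - u^2 d/du, which turns p(u) exp(-u) into u^2
      (p(u) - p'(u)) exp(-u).\<close>
    have "((\<lambda>t. poly p (1 / t) * exp (- (1 / t))) has_real_derivative
        exp_family (monom 1 2 * (p - pderiv p)) t) (at t)"
      using 1 by (auto intro!: derivative_eq_intros DERIV_chain2[OF poly_DERIV]
          simp: exp_family_def poly_monom power2_eq_square field_simps)
    then show ?thesis
      by (rule has_field_derivative_transform_within_open[of _ _ _ "{0<..}"])
         (use 1 in \<open>auto simp: exp_family_def\<close>)
  next
    case 2
    have "((\<lambda>t::real. 0) has_real_derivative 0) (at t)" by simp
    then have "(exp_family p has_real_derivative 0) (at t)"
      by (rule has_field_derivative_transform_within_open[of _ _ _ "{..<0}"])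
         (use 2 in \<open>auto simp: exp_family_def\<close>)
    then show ?thesis using 2 by (simp add: exp_family_def)
  next
    case 3
    have "((\<lambda>h. exp_family p h / h) \<longlongrightarrow> 0) (at_right 0)"
    proof -
      \<comment> \<open>The difference quotient at 0 is u p(u) exp(-u) with u = 1/h, and
        \<open>pCons 0 p\<close> is the polynomial u p(u).\<close>
      have "((\<lambda>h. poly (pCons 0 p) (inverse h) * exp (- inverse h)) \<longlongrightarrow> 0) (at_right (0::real))"
        by (rule filterlim_compose[OF poly_exp_tendsto_0 filterlim_inverse_at_top_right])
      then show ?thesis
        by (rule Lim_transform_eventually)
           (auto simp: eventually_at_filter exp_family_def field_simps)
    qed
    moreover have "((\<lambda>h. exp_family p h / h) \<longlongrightarrow> 0) (at_left 0)"
      by (rule tendsto_eventually) (auto simp: eventually_at_filter exp_family_def)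
    ultimately have "((\<lambda>h. exp_family p h / h) \<longlongrightarrow> 0) (at 0)"
      by (simp add: filterlim_split_at)
    then show ?thesis
      using 3 by (simp add: has_field_derivative_iff exp_family_def)
  qed
qed

text \<open>The induction on the order keeps \<open>p\<close> arbitrary, since the chain rule
  replaces it by another polynomial.\<close>

lemma smooth_exp_family_compose:
  fixes g :: "'a::euclidean_space \<Rightarrow> real"
  assumes g: "smooth g"
  shows "smooth (\<lambda>x. exp_family p (g x))"
  unfolding smooth_def
proof
  show "C_diff k UNIV (\<lambda>x. exp_family p (g x))" for k
  proof (induction k arbitrary: p)
    case 0
    have "continuous_on UNIV (exp_family p)"
      using exp_family_has_derivative DERIV_isCont continuous_at_imp_continuous_on by blast
    then show ?case
      using continuous_on_compose2[OF _ smooth_continuous[OF g]] by auto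
  next
    case (Suc k)
    let ?q = "monom 1 2 * (p - pderiv p)"
    have "((\<lambda>x. exp_family p (g x)) has_derivative (\<lambda>v. D g x v * exp_family ?q (g x))) (at x)" for x
      using has_derivative_compose[OF smooth_has_derivative[OF g]
          exp_family_has_derivative[unfolded has_field_derivative_def]]
      by (simp add: mult.commute)
    then show ?case
      by (rule C_diff_SucI) (intro C_diff_mult Suc.IH smooth_C_diff[OF smooth_derivative[OF g]])
  qed
qed

lemma smooth_bump_exists:
  assumes e: "e > 0"
  obtains \<rho> :: "'a::euclidean_space \<Rightarrow> real"
  where "smooth \<rho>" "\<And>x. \<rho> x \<ge> 0" "\<And>x. norm x \<ge> e \<Longrightarrow> \<rho> x = 0" "\<rho> 0 > 0" "\<And>x. \<rho> (- x) = \<rho> x"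
proof
  \<comment> \<open>This is e^2 - |x|^2, spelled out as a polynomial in the coordinates so that the
    closure rules for \<open>C_diff\<close> apply. It is positive exactly on the open ball of radius
    \<open>e\<close>.\<close>
  let ?g = "\<lambda>x::'a. e\<^sup>2 + (-1) * (\<Sum>b\<in>Basis. (x \<bullet> b) * (x \<bullet> b))"
  let ?\<rho> = "\<lambda>x. exp_family 1 (?g x)"
  have g: "?g x = e\<^sup>2 - (norm x)\<^sup>2" for x
    by (simp add: power2_norm_eq_inner euclidean_inner[of x x])
  have "smooth ?g"
    unfolding smooth_def by (intro allI C_diff_add C_diff_mult C_diff_sum C_diff_const C_diff_inner)
  then show "smooth ?\<rho>" by (rule smooth_exp_family_compose)
  show "?\<rho> x \<ge> 0" for x by (simp add: exp_family_def)
  show "?\<rho> x = 0" if "norm x \<ge> e" for x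
  proof -
    have "\<not> 0 < e\<^sup>2 - (norm x)\<^sup>2"
      using power_mono[OF that, of 2] e by linarith
    then show ?thesis unfolding g exp_family_def by (simp only: if_False)
  qed
  show "?\<rho> 0 > 0" using e by (simp add: exp_family_def)
  show "?\<rho> (- x) = ?\<rho> x" for x unfolding g by simp
qed

subsection \<open>Mollification\<close>

text \<open>Differentiation under the integral sign with the derivative represented by a vector
  \<open>G\<close>, so that its continuity is that of a vector field. Inside, \<open>G\<close>
  becomes a bounded linear functional, and evaluation at \<open>v\<close> commutes with the
  integral. Translations, convolutions and the cone construction all rest on this form.\<close>

lemma leibniz_gradient:
  fixes F :: "'a::euclidean_space \<Rightarrow> 'b::euclidean_space \<Rightarrow> real" and G :: "'a \<Rightarrow> 'b \<Rightarrow> 'a"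
  assumes deriv: "\<And>x t. ((\<lambda>x. F x t) has_derivative (\<lambda>v. G x t \<bullet> v)) (at x)"
    and cont: "continuous_on UNIV (\<lambda>(x, t). G x t)"
    and int: "\<And>x. F x integrable_on cbox a b"
  shows "((\<lambda>x. integral (cbox a b) (F x)) has_derivative
           (\<lambda>v. integral (cbox a b) (\<lambda>t. G x0 t \<bullet> v))) (at x0)"
proof -
  have cG: "continuous_on UNIV (\<lambda>t. G x0 t)"
    using continuous_on_compose2[OF cont, of UNIV "\<lambda>t. (x0, t)"] by (simp add: continuous_on_Pair)
  have "((\<lambda>x. integral (cbox a b) (F x)) has_derivative
      integral (cbox a b) (\<lambda>t. blinfun_inner_left (G x0 t))) (at x0)"
  proof (rule leibniz_rule[where U = UNIV and fx = "\<lambda>x t. blinfun_inner_left (G x t)", simplified])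
    show "((\<lambda>x. F x t) has_derivative (\<lambda>y. y \<bullet> G x t)) (at x)" for x t
      using deriv by (simp add: inner_commute)
    show "F x integrable_on cbox a b" for x
      by (rule int)
    have "continuous_on (UNIV \<times> cbox a b) (\<lambda>(x, t). G x t)"
      by (rule continuous_on_subset[OF cont]) auto
    then show "continuous_on (UNIV \<times> cbox a b) (\<lambda>(x, t). blinfun_inner_left (G x t))"
      unfolding case_prod_beta
      by (rule bounded_linear.continuous_on[OF bounded_linear_blinfun_inner_left])
  qed
  moreover have "blinfun_apply (integral (cbox a b) (\<lambda>t. blinfun_inner_left (G x0 t))) =
      (\<lambda>v. integral (cbox a b) (\<lambda>t. G x0 t \<bullet> v))"
  proof
    fix v
    have "(\<lambda>t. blinfun_inner_left (G x0 t)) integrable_on cbox a b"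
      by (rule integrable_continuous, rule bounded_linear.continuous_on[OF bounded_linear_blinfun_inner_left])
         (rule continuous_on_subset[OF cG], simp)
    then show "blinfun_apply (integral (cbox a b) (\<lambda>t. blinfun_inner_left (G x0 t))) v =
        integral (cbox a b) (\<lambda>t. G x0 t \<bullet> v)"
      by (simp add: blinfun_apply_integral inner_commute)
  qed
  ultimately show ?thesis
    by simp
qed

section \<open>Integrals of compactly supported functions\<close>

lemma integral_compact_support:
  fixes u :: "'a::euclidean_space \<Rightarrow> real"
  assumes "continuous_on UNIV u" "\<And>x. x \<notin> cbox a b \<Longrightarrow> u x = 0"
  shows "u integrable_on UNIV" "integral UNIV u = integral (cbox a b) u"
proof -
  have "u integrable_on cbox a b"
    using assms(1) by (intro integrable_continuous continuous_on_subset[OF assms(1)]) auto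
  then have "(u has_integral integral (cbox a b) u) UNIV"
    using has_integral_on_superset[of u _ "cbox a b" UNIV] assms(2) by (auto simp: integrable_integral)
  then show "u integrable_on UNIV" "integral UNIV u = integral (cbox a b) u"
    by blast+
qed

text \<open>Supports are described by norms, but \<open>leibniz_gradient\<close> integrates over
  boxes; this box contains the closed ball of radius \<open>r\<close>.\<close>

definition ball_box :: "real \<Rightarrow> 'a::euclidean_space set" where
  "ball_box r = cbox (- (r *\<^sub>R One)) (r *\<^sub>R One)"

lemma in_ball_box: "norm x \<le> r \<Longrightarrow> x \<in> ball_box r"
  unfolding ball_box_def mem_box
  by (auto intro: order_trans[OF Basis_le_norm] simp: abs_le_iff[symmetric])
     (meson Basis_le_norm abs_le_D2 minus_le_iff order_trans, meson Basis_le_norm abs_le_D1 order_trans)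

lemma integral_ball_support:
  fixes u :: "'a::euclidean_space \<Rightarrow> real"
  assumes "continuous_on UNIV u" "\<And>x. norm x > r \<Longrightarrow> u x = 0"
  shows "u integrable_on UNIV" "integral UNIV u = integral (ball_box r) u"
proof -
  have "u x = 0" if "x \<notin> ball_box r" for x
    using in_ball_box[of x r] that assms(2)[of x] by force
  then show "u integrable_on UNIV" "integral UNIV u = integral (ball_box r) u"
    using integral_compact_support[OF assms(1)] unfolding ball_box_def by blast+
qed

lemma integral_translation:
  fixes u :: "'a::euclidean_space \<Rightarrow> real"
  assumes "continuous_on UNIV u" "\<And>x. norm x > r \<Longrightarrow> u x = 0"
  shows "integral UNIV (\<lambda>x. u (x + c)) = integral UNIV u"
proof -
  define R where "R = r + norm c"
  have z: "u (x + c) = 0" if "norm x > R" for x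
  proof (rule assms(2))
    show "r < norm (x + c)"
      using that norm_triangle_ineq4[of "x + c" c] by (simp add: R_def)
  qed
  have "integral UNIV (\<lambda>x. u (x + c)) = integral (ball_box R) (\<lambda>x. u (x + c))"
    by (rule integral_ball_support(2))
       (use z in \<open>auto intro!: continuous_intros continuous_on_compose2[OF assms(1)]\<close>)
  also have "\<dots> = integral (cbox (- (R *\<^sub>R One) + c) (R *\<^sub>R One + c)) u"
    unfolding ball_box_def using integral_shift_cbox_plus[of _ _ u c]
    by (simp add: o_def add.commute)
  also have "\<dots> = integral UNIV u"
  proof (rule integral_compact_support(2)[OF assms(1), symmetric])
    fix x assume x: "x \<notin> cbox (- (R *\<^sub>R One) + c) (R *\<^sub>R One + c)"
    have "x - c \<notin> ball_box R"
      using x unfolding ball_box_def mem_box by (force simp: inner_diff_left inner_add_left)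
    then have "norm (x - c) > R"
      using in_ball_box[of "x - c" R] by linarith
    then show "u x = 0" using z[of "x - c"] by simp
  qed
  finally show ?thesis .
qed

lemma D_eq_0_outside:
  fixes u :: "'a::euclidean_space \<Rightarrow> real"
  assumes "\<And>x. norm x > r \<Longrightarrow> u x = 0" "norm x > r"
  shows "D u x w = 0"
proof -
  have "(u has_derivative (\<lambda>v. 0)) (at x)"
    by (rule has_derivative_transform_within_open[OF has_derivative_const, of "- cball 0 r"])
       (use assms in auto)
  then show ?thesis by (rule D_eqI)
qed

text \<open>The integral of the translate \<open>u (x + s *\<^sub>R w)\<close> does not depend on
  \<open>s\<close>; its derivative at \<open>s = 0\<close>, taken under the integral sign, is the
  integral in question. With \<open>R = r + norm w\<close> all translates with |s| < 1 are supported
  in one box.\<close>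

lemma integral_derivative_compact_support:
  fixes u :: "'a::euclidean_space \<Rightarrow> real"
  assumes u: "C_diff 1 UNIV u" and supp: "\<And>x. norm x > r \<Longrightarrow> u x = 0"
  shows "integral UNIV (\<lambda>x. D u x w) = 0"
proof -
  have u': "C_diff (Suc 0) UNIV u" using u by simp
  have cont: "continuous_on UNIV u" by (rule C_diff_continuous[OF u])
  define R where "R = r + norm w"
  let ?B = "ball_box R :: 'a set"
  have "((\<lambda>s. integral ?B (\<lambda>x. u (x + s *\<^sub>R w))) has_derivative
      (\<lambda>v. integral ?B (\<lambda>x. (gradient u (x + 0 *\<^sub>R w) \<bullet> w) \<bullet> v))) (at (0::real))"
    unfolding ball_box_def
  proof (rule leibniz_gradient)
    fix s :: real and x :: 'a
    have "((\<lambda>s. x + s *\<^sub>R w) has_derivative (\<lambda>v. v *\<^sub>R w)) (at s)"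
      by (auto intro!: derivative_eq_intros)
    from has_derivative_compose[OF this C_diff_gradient(1)[OF u']]
    show "((\<lambda>s. u (x + s *\<^sub>R w)) has_derivative (\<lambda>v. (gradient u (x + s *\<^sub>R w) \<bullet> w) \<bullet> v)) (at s)"
      by (simp add: mult.commute)
  next
    show "continuous_on UNIV (\<lambda>(s, x). gradient u (x + s *\<^sub>R w) \<bullet> w)"
      unfolding case_prod_beta
      by (intro continuous_intros continuous_on_compose2[OF C_diff_gradient(2)[OF u']]) auto
  next
    show "(\<lambda>x. u (x + s *\<^sub>R w)) integrable_on cbox (- (R *\<^sub>R One)) (R *\<^sub>R One)" for s
      by (intro integrable_continuous continuous_intros continuous_on_compose2[OF cont]) auto
  qed
  moreover have "((\<lambda>s. integral ?B (\<lambda>x. u (x + s *\<^sub>R w))) has_derivative (\<lambda>v. 0)) (at (0::real))"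
  proof (rule has_derivative_transform_within_open[OF has_derivative_const, of "ball 0 1"])
    fix s :: real assume s: "s \<in> ball 0 1"
    have "integral UNIV (\<lambda>x. u (x + s *\<^sub>R w)) = integral ?B (\<lambda>x. u (x + s *\<^sub>R w))"
    proof (rule integral_ball_support)
      show "continuous_on UNIV (\<lambda>x. u (x + s *\<^sub>R w))"
        by (intro continuous_intros continuous_on_compose2[OF cont]) auto
      show "u (x + s *\<^sub>R w) = 0" if "norm x > R" for x
      proof (rule supp)
        have "norm (s *\<^sub>R w) \<le> norm w"
          using s by (simp add: mult_left_le_one_le)
        then show "r < norm (x + s *\<^sub>R w)"
          using that norm_triangle_ineq4[of "x + s *\<^sub>R w" "s *\<^sub>R w"] by (simp add: R_def)
      qed
    qed
    then show "integral UNIV u = integral ?B (\<lambda>x. u (x + s *\<^sub>R w))"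
      using integral_translation[OF cont supp] by metis
  qed auto
  ultimately have "(\<lambda>v::real. integral ?B (\<lambda>x. (gradient u (x + 0 *\<^sub>R w) \<bullet> w) \<bullet> v)) = (\<lambda>v. 0)"
    by (rule has_derivative_unique)
  from fun_cong[OF this, of 1] have "integral ?B (\<lambda>x. D u x w) = 0"
    by (simp add: C_diff_gradient(3)[OF u'])
  moreover have "integral UNIV (\<lambda>x. D u x w) = integral ?B (\<lambda>x. D u x w)"
  proof (rule integral_ball_support(2))
    show "continuous_on UNIV (\<lambda>x. D u x w)"
      using C_diff_continuous[OF C_diff_Suc_derivative[OF u']] .
    show "D u x w = 0" if "norm x > R" for x
      using that norm_ge_zero[of w] unfolding R_def by (intro D_eq_0_outside[of r u, OF supp]) linarith+
  qed
  ultimately show ?thesis by simp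
qed

text \<open>The normalisation is stated for y |-> \<rho>(x - y), the form in which it enters
  \<open>convolve\<close>. For an even bump it reduces to translation invariance of the
  integral.\<close>

definition mollifier :: "real \<Rightarrow> ('a::euclidean_space \<Rightarrow> real) \<Rightarrow> bool" where
  "mollifier e \<rho> \<longleftrightarrow> smooth \<rho> \<and> (\<forall>x. \<rho> x \<ge> 0) \<and> (\<forall>x. norm x > e \<longrightarrow> \<rho> x = 0) \<and>
     (\<forall>x. integral UNIV (\<lambda>y. \<rho> (x - y)) = 1)"

lemma integral_bump_pos:
  fixes \<rho> :: "'a::euclidean_space \<Rightarrow> real"
  assumes "continuous_on UNIV \<rho>" "\<And>x. \<rho> x \<ge> 0" "\<And>x. norm x > e \<Longrightarrow> \<rho> x = 0" "\<rho> 0 > 0" "e > 0"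
  shows "integral UNIV \<rho> > 0"
proof -
  have c: "continuous_on (ball_box e) \<rho>"
    by (rule continuous_on_subset[OF assms(1)]) simp
  have "integral (ball_box e) \<rho> \<noteq> 0"
  proof -
    have "box (- (e *\<^sub>R One)) (e *\<^sub>R One) \<noteq> ({} :: 'a set)"
      using assms(5) by (simp add: box_ne_empty)
    moreover have "(0::'a) \<in> ball_box e"
      using assms(5) by (intro in_ball_box) simp
    ultimately show ?thesis
      using integral_cbox_eq_0_iff[OF c[unfolded ball_box_def]] assms(2,4)
      unfolding ball_box_def by (metis less_irrefl)
  qed
  moreover have "integral (ball_box e) \<rho> \<ge> 0"
    by (rule integral_nonneg) (use c assms(2) in \<open>auto simp: ball_box_def intro: integrable_continuous\<close>)
  ultimately show ?thesis
    using integral_ball_support(2)[OF assms(1,3)] by simp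
qed

lemma mollifier_exists:
  assumes e: "e > 0"
  obtains \<rho> :: "'a::euclidean_space \<Rightarrow> real" where "mollifier e \<rho>"
proof -
  obtain b :: "'a \<Rightarrow> real" where b: "smooth b" "\<And>x. b x \<ge> 0" "\<And>x. norm x \<ge> e \<Longrightarrow> b x = 0"
    "b 0 > 0" "\<And>x. b (- x) = b x"
    using smooth_bump_exists[OF e] by metis
  have cb: "continuous_on UNIV b" by (rule smooth_continuous[OF b(1)])
  define I where "I = integral UNIV b"
  have "I > 0"
    unfolding I_def by (rule integral_bump_pos[OF cb b(2) _ b(4) e]) (simp add: b(3))
  have "mollifier e (\<lambda>x. (1 / I) * b x)"
    unfolding mollifier_def
  proof (intro conjI allI impI)
    show "smooth (\<lambda>x. (1 / I) * b x)"
      using b(1) unfolding smooth_def by (intro allI C_diff_mult C_diff_const) auto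
    show "(1 / I) * b x \<ge> 0" for x using b(2) \<open>I > 0\<close> by simp
    show "norm x > e \<Longrightarrow> (1 / I) * b x = 0" for x using b(3) by simp
    have "b (x - y) = b (y + - x)" for x y
      using b(5)[of "x - y"] by simp
    then have "integral UNIV (\<lambda>y. b (x - y)) = I" for x
      using integral_translation[OF cb, of e "- x"] b(3) by (simp add: I_def)
    then show "integral UNIV (\<lambda>y. (1 / I) * b (x - y)) = 1" for x
      using \<open>I > 0\<close> by simp
  qed
  then show ?thesis by (rule that)
qed

definition convolve :: "('a::euclidean_space \<Rightarrow> real) \<Rightarrow> ('a \<Rightarrow> real) \<Rightarrow> 'a \<Rightarrow> real" where
  "convolve \<rho> g x = integral UNIV (\<lambda>y. \<rho> (x - y) * g y)"

text \<open>The compact support of the integrand comes from \<rho> alone, as \<open>g\<close> is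
  merely continuous on the whole space. One box serves all \<open>x\<close> with
  \<open>norm x + e \<le> R\<close>, so that the integral can be differentiated in
  \<open>x\<close>.\<close>

lemma convolve_box:
  fixes \<rho> :: "'a::euclidean_space \<Rightarrow> real"
  assumes "continuous_on UNIV \<rho>" "\<And>x. norm x > e \<Longrightarrow> \<rho> x = 0" "continuous_on UNIV g" "norm x + e \<le> R"
  shows "(\<lambda>y. \<rho> (x - y) * g y) integrable_on UNIV"
    and "convolve \<rho> g x = integral (ball_box R) (\<lambda>y. \<rho> (x - y) * g y)"
proof -
  have c: "continuous_on UNIV (\<lambda>y. \<rho> (x - y) * g y)"
    by (intro continuous_intros assms(3) continuous_on_compose2[OF assms(1)]) auto
  have z: "\<rho> (x - y) * g y = 0" if "norm y > R" for y
  proof -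
    have "norm (x - y) > e"
      using that assms(4) norm_triangle_ineq2[of y x] by (simp add: norm_minus_commute)
    then show ?thesis using assms(2) by simp
  qed
  show "(\<lambda>y. \<rho> (x - y) * g y) integrable_on UNIV"
    "convolve \<rho> g x = integral (ball_box R) (\<lambda>y. \<rho> (x - y) * g y)"
    unfolding convolve_def using integral_ball_support[OF c z] by blast+
qed

lemma convolve_has_derivative:
  fixes \<rho> :: "'a::euclidean_space \<Rightarrow> real"
  assumes \<rho>: "smooth \<rho>" "\<And>x. norm x > e \<Longrightarrow> \<rho> x = 0" and g: "continuous_on UNIV g"
  shows "(convolve \<rho> g has_derivative (\<lambda>v. convolve (\<lambda>z. D \<rho> z v) g x)) (at x)"
proof -
  \<comment> \<open>The summand 1 leaves room to vary the point within \<open>ball x 1\<close> over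
    the same box.\<close>
  define R where "R = norm x + 1 + e"
  have c\<rho>: "continuous_on UNIV \<rho>" by (rule smooth_continuous[OF \<rho>(1)])
  have \<rho>1: "C_diff (Suc 0) UNIV \<rho>" by (rule smooth_C_diff[OF \<rho>(1)])
  have "((\<lambda>x. integral (ball_box R) (\<lambda>y. \<rho> (x - y) * g y)) has_derivative
      (\<lambda>v. integral (ball_box R) (\<lambda>y. (g y *\<^sub>R gradient \<rho> (x - y)) \<bullet> v))) (at x)"
    unfolding ball_box_def
  proof (rule leibniz_gradient)
    fix x y :: 'a
    have "((\<lambda>x. x - y) has_derivative (\<lambda>v. v)) (at x)"
      by (auto intro!: derivative_eq_intros)
    from has_derivative_mult_left[OF has_derivative_compose[OF this C_diff_gradient(1)[OF \<rho>1]], of "g y"]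
    show "((\<lambda>x. \<rho> (x - y) * g y) has_derivative (\<lambda>v. (g y *\<^sub>R gradient \<rho> (x - y)) \<bullet> v)) (at x)"
      by (simp add: mult.commute)
  next
    show "continuous_on UNIV (\<lambda>(x, y). g y *\<^sub>R gradient \<rho> (x - y))"
      unfolding case_prod_beta
      by (intro continuous_intros continuous_on_compose2[OF C_diff_gradient(2)[OF \<rho>1]]
          continuous_on_compose2[OF g]) auto
  next
    show "(\<lambda>y. \<rho> (x - y) * g y) integrable_on cbox (- (R *\<^sub>R One)) (R *\<^sub>R One)" for x
      by (intro integrable_continuous continuous_intros continuous_on_compose2[OF c\<rho>]
          continuous_on_subset[OF g]) auto
  qed
  moreover have "integral (ball_box R) (\<lambda>y. (g y *\<^sub>R gradient \<rho> (x - y)) \<bullet> v) = convolve (\<lambda>z. D \<rho> z v) g x" for v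
  proof -
    have "convolve (\<lambda>z. D \<rho> z v) g x = integral (ball_box R) (\<lambda>y. D \<rho> (x - y) v * g y)"
      by (rule convolve_box(2)[OF smooth_continuous[OF smooth_derivative[OF \<rho>(1)]] D_eq_0_outside[OF \<rho>(2)] g])
         (auto simp: R_def)
    then show ?thesis by (simp add: C_diff_gradient(3)[OF \<rho>1] mult.commute)
  qed
  ultimately have "((\<lambda>x. integral (ball_box R) (\<lambda>y. \<rho> (x - y) * g y)) has_derivative
      (\<lambda>v. convolve (\<lambda>z. D \<rho> z v) g x)) (at x)"
    by simp
  then show ?thesis
  proof (rule has_derivative_transform_within_open[of _ _ _ _ "ball x 1"])
    fix z assume "z \<in> ball x 1"
    then have "norm z + e \<le> R"
      using norm_triangle_ineq2[of z x] by (simp add: R_def dist_norm norm_minus_commute)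
    from convolve_box(2)[OF c\<rho> \<rho>(2) g this]
    show "integral (ball_box R) (\<lambda>y. \<rho> (z - y) * g y) = convolve \<rho> g z" by simp
  qed auto
qed

lemma smooth_convolve:
  fixes \<rho> :: "'a::euclidean_space \<Rightarrow> real"
  assumes "smooth \<rho>" "\<And>x. norm x > e \<Longrightarrow> \<rho> x = 0" and g: "continuous_on UNIV g"
  shows "smooth (convolve \<rho> g)"
proof -
  have "C_diff k UNIV (convolve \<rho> g)" for k
    using assms(1,2)
  proof (induction k arbitrary: \<rho>)
    case 0
    show ?case
      using has_derivative_continuous[OF convolve_has_derivative[OF 0 g]]
      by (auto simp: continuous_on_eq_continuous_at)
  next
    case (Suc k)
    have "D \<rho> z v = 0" if "norm z > e" for z v
      by (rule D_eq_0_outside[OF Suc.prems(2) that])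
    then have ih: "C_diff k UNIV (convolve (\<lambda>z. D \<rho> z v) g)" for v
      by (intro Suc.IH[OF smooth_derivative[OF Suc.prems(1)]])
    show ?case
      by (rule C_diff_SucI[OF convolve_has_derivative[of \<rho> e, OF Suc.prems g] ih])
  qed
  then show ?thesis by (simp add: smooth_def)
qed

text \<open>Integration by parts: the derivative in y of \<rho>(x - y) g(y) along \<open>v\<close>
  has integral 0, and it is the difference of the integrands of the two ways of differentiating the
  convolution.\<close>

lemma D_convolve:
  fixes \<rho> :: "'a::euclidean_space \<Rightarrow> real"
  assumes \<rho>: "smooth \<rho>" "\<And>x. norm x > e \<Longrightarrow> \<rho> x = 0" and g: "C_diff 1 UNIV g"
  shows "D (convolve \<rho> g) x v = convolve \<rho> (\<lambda>y. D g y v) x"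
proof -
  have g': "C_diff (Suc 0) UNIV g" using g by simp
  have cg: "continuous_on UNIV g" "continuous_on UNIV (\<lambda>y. D g y v)"
    using C_diff_continuous[OF g] C_diff_continuous[OF C_diff_Suc_derivative[OF g']] .
  let ?u = "\<lambda>y. \<rho> (x - y) * g y"
  have deriv: "(?u has_derivative (\<lambda>w. \<rho> (x - y) * D g y w + D \<rho> (x - y) (- w) * g y)) (at y)" for y
  proof -
    have "((\<lambda>y. x - y) has_derivative (\<lambda>w. - w)) (at y)"
      by (auto intro!: derivative_eq_intros)
    from has_derivative_mult[OF has_derivative_compose[OF this smooth_has_derivative[OF \<rho>(1)]]
        C_diff_Suc_has_derivative[OF g']]
    show ?thesis by simp
  qed
  have neg: "D \<rho> z (- w) = - D \<rho> z w" for z w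
    using has_derivative_linear[OF smooth_has_derivative[OF \<rho>(1)]] by (rule linear_neg)
  have "C_diff 1 UNIV ?u"
  proof (rule C_diff_1I[OF deriv])
    show "continuous_on UNIV (\<lambda>y. \<rho> (x - y) * D g y w + D \<rho> (x - y) (- w) * g y)" for w
      by (intro continuous_intros cg C_diff_continuous[OF C_diff_Suc_derivative[OF g']]
          continuous_on_compose2[OF smooth_continuous[OF \<rho>(1)]]
          continuous_on_compose2[OF smooth_continuous[OF smooth_derivative[OF \<rho>(1)]]]) auto
  qed
  moreover have "?u y = 0" if "norm y > norm x + e" for y
  proof -
    have "norm (x - y) > e"
      using that norm_triangle_ineq2[of y x] by (simp add: norm_minus_commute)
    then show ?thesis using \<rho>(2) by simp
  qed
  ultimately have "integral UNIV (\<lambda>y. D ?u y v) = 0"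
    by (rule integral_derivative_compact_support)
  then have zero: "integral UNIV (\<lambda>y. \<rho> (x - y) * D g y v - D \<rho> (x - y) v * g y) = 0"
    by (simp add: D_eqI[OF deriv] neg)
  have "(\<lambda>y. \<rho> (x - y) * D g y v) integrable_on UNIV"
    by (rule convolve_box(1)[OF smooth_continuous[OF \<rho>(1)] \<rho>(2) cg(2) order_refl])
  moreover have "D \<rho> z v = 0" if "norm z > e" for z
    by (rule D_eq_0_outside[OF \<rho>(2) that])
  then have "(\<lambda>y. D \<rho> (x - y) v * g y) integrable_on UNIV"
    by (rule convolve_box(1)[OF smooth_continuous[OF smooth_derivative[OF \<rho>(1)]] _ cg(1) order_refl])
  ultimately have "integral UNIV (\<lambda>y. \<rho> (x - y) * D g y v - D \<rho> (x - y) v * g y) =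
      convolve \<rho> (\<lambda>y. D g y v) x - convolve (\<lambda>z. D \<rho> z v) g x"
    unfolding convolve_def by (rule integral_diff)
  with zero show ?thesis
    by (simp add: D_eqI[OF convolve_has_derivative[OF \<rho> cg(1)]])
qed

lemma mollifierD:
  assumes "mollifier e \<rho>"
  shows "smooth \<rho>" "\<rho> x \<ge> 0" "norm x > e \<Longrightarrow> \<rho> x = 0" "integral UNIV (\<lambda>y. \<rho> (x - y)) = 1"
  using assms unfolding mollifier_def by auto

lemma convolve_integrable:
  assumes m: "mollifier e \<rho>" and g: "continuous_on UNIV g"
  shows "(\<lambda>y. \<rho> (x - y) * g y) integrable_on UNIV"
  by (rule convolve_box(1)[OF smooth_continuous[OF mollifierD(1)[OF m]] mollifierD(3)[OF m] g order_refl])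

lemma convolve_mono:
  assumes "mollifier e \<rho>" "continuous_on UNIV g" "continuous_on UNIV h"
    and "\<And>y. norm (x - y) \<le> e \<Longrightarrow> g y \<le> h y"
  shows "convolve \<rho> g x \<le> convolve \<rho> h x"
  unfolding convolve_def
proof (rule integral_le)
  fix y
  show "\<rho> (x - y) * g y \<le> \<rho> (x - y) * h y"
    using assms(4)[of y] mollifierD(2,3)[OF assms(1), of "x - y"]
    by (cases "norm (x - y) \<le> e") (auto intro: mult_left_mono)
qed (intro convolve_integrable[OF assms(1)] assms(2,3))+

lemma convolve_const: "mollifier e \<rho> \<Longrightarrow> convolve \<rho> (\<lambda>_. c) x = c"
  using mollifierD(4)[of e \<rho> x] by (simp add: convolve_def)

lemma convolve_bounds:
  assumes "mollifier e \<rho>" "continuous_on UNIV g" "\<And>y. norm (x - y) \<le> e \<Longrightarrow> a \<le> g y \<and> g y \<le> b"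
  shows "a \<le> convolve \<rho> g x" "convolve \<rho> g x \<le> b"
  using convolve_mono[OF assms(1) continuous_on_const assms(2), of x a]
    convolve_mono[OF assms(1,2) continuous_on_const, of x b] assms(3)
  by (auto simp: convolve_const[OF assms(1)])

text \<open>A mollification at scale 1 of a piecewise linear function that is 1 up to radius r + 1
  and 0 from radius r + 2 on. The mollifier costs a margin of 1 on both sides, whence r + 3.\<close>

lemma cutoff_exists:
  obtains \<kappa> :: "'a::euclidean_space \<Rightarrow> real"
  where "smooth \<kappa>" "\<And>x. 0 \<le> \<kappa> x \<and> \<kappa> x \<le> 1" "\<And>x. norm x \<le> r \<Longrightarrow> \<kappa> x = 1" "\<And>x. norm x \<ge> r + 3 \<Longrightarrow> \<kappa> x = 0"
proof -
  obtain \<rho> :: "'a \<Rightarrow> real" where \<rho>: "mollifier 1 \<rho>"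
    using mollifier_exists[of 1] by auto
  define g :: "'a \<Rightarrow> real" where "g x = max 0 (min 1 (r + 2 - norm x))" for x
  have g: "continuous_on UNIV g"
    unfolding g_def by (intro continuous_intros)
  show ?thesis
  proof
    show "smooth (convolve \<rho> g)"
      by (rule smooth_convolve[OF mollifierD(1,3)[OF \<rho>] g])
    show "0 \<le> convolve \<rho> g x \<and> convolve \<rho> g x \<le> 1" for x
      using convolve_bounds[OF \<rho> g, of x 0 1] by (auto simp: g_def)
    show "convolve \<rho> g x = 1" if "norm x \<le> r" for x
    proof (rule antisym)
      have "g y = 1" if "norm (x - y) \<le> 1" for y
        using that \<open>norm x \<le> r\<close> norm_triangle_sub[of y x] by (simp add: g_def norm_minus_commute)
      then show "convolve \<rho> g x \<le> 1" "1 \<le> convolve \<rho> g x"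
        using convolve_bounds[OF \<rho> g, of x 1 1] by auto
    qed
    show "convolve \<rho> g x = 0" if "norm x \<ge> r + 3" for x
    proof (rule antisym)
      have "g y = 0" if "norm (x - y) \<le> 1" for y
        using that \<open>norm x \<ge> r + 3\<close> norm_triangle_sub[of x y] by (simp add: g_def)
      then show "convolve \<rho> g x \<le> 0" "0 \<le> convolve \<rho> g x"
        using convolve_bounds[OF \<rho> g, of x 0 0] by auto
    qed
  qed
qed

subsection \<open>The volume form\<close>

lemma orthonormal_frame_case_nat:
  assumes "orthonormal_frame k v" "norm N = 1" "\<And>i. i < k \<Longrightarrow> v i \<bullet> N = 0"
  shows "orthonormal_frame (Suc k) (case_nat N v)"
  using assms unfolding orthonormal_frame_def
  by (auto split: nat.split simp: inner_commute norm_eq_1)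

lemma orthonormal_frame_span_finite:
  assumes "orthonormal_frame k v"
  shows "inj_on v {..<k}" "pairwise orthogonal (v ` {..<k})" "0 \<notin> v ` {..<k}" "independent (v ` {..<k})"
proof -
  show "inj_on v {..<k}"
    using assms unfolding orthonormal_frame_def inj_on_def
    by (metis lessThan_iff zero_neq_one)
  show 1: "pairwise orthogonal (v ` {..<k})"
    using assms unfolding orthonormal_frame_def pairwise_def orthogonal_def by auto
  show 2: "0 \<notin> v ` {..<k}"
    using assms unfolding orthonormal_frame_def by force
  show "independent (v ` {..<k})"
    by (rule pairwise_orthogonal_independent[OF 1 2])
qed

locale coordinate_order =
  fixes ix :: "'n::finite \<Rightarrow> nat" and n :: nat
  assumes bij_ix: "bij_betw ix UNIV {..n}"
begin

abbreviation vol :: "(real ^ 'n) covec" where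
  "vol \<equiv> volume_form ix"

abbreviation hvol :: "real ^ 'n \<Rightarrow> (real ^ 'n) covec" where
  "hvol N v \<equiv> vol (case_nat N v)"

definition ax :: "nat \<Rightarrow> real ^ 'n" where
  "ax j = axis (inv ix j) 1"

lemma card_coordinates: "CARD('n) = Suc n"
  using bij_betw_same_card[OF bij_ix] by simp

lemma inj_ix: "ix i = ix j \<longleftrightarrow> i = j"
  using bij_ix unfolding bij_betw_def inj_on_def by auto

lemma ix_le: "ix i \<le> n"
  using bij_ix unfolding bij_betw_def by auto

lemma inv_ix: "inv ix (ix i) = i"
  by (simp add: inj_def inj_ix inv_f_f)

lemma ix_surj: "j \<le> n \<Longrightarrow> \<exists>i. j = ix i"
  using bij_ix unfolding bij_betw_def by blast

lemma ax_ix: "ax (ix i) = axis i 1"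
  by (simp add: ax_def inv_ix)

lemma bij_betw_ax: "bij_betw ax {..<Suc n} Basis"
proof -
  have "bij_betw (\<lambda>i::'n. axis i (1::real)) UNIV Basis"
    unfolding bij_betw_def by (auto simp: inj_on_def axis_eq_axis Basis_vec_def)
  then have "bij_betw ((\<lambda>i. axis i (1::real)) \<circ> inv ix) {..n} Basis"
    by (rule bij_betw_trans[OF bij_betw_inv_into[OF bij_ix]])
  then show ?thesis
    by (simp add: lessThan_Suc_atMost ax_def[abs_def] o_def)
qed

lemma vol_covector: "k_covector (Suc n) vol"
  unfolding k_covector_def
proof (intro conjI allI impI)
  show "vol v = vol w" if "\<forall>i<Suc n. v i = w i" for v w
    unfolding volume_form_def
    by (rule arg_cong[where f = det]) (use that ix_le in \<open>simp add: vec_eq_iff le_imp_less_Suc\<close>)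
next
  fix v :: "nat \<Rightarrow> real ^ 'n" and j assume "j < Suc n"
  then obtain k where k: "j = ix k"
    using ix_surj[of j] by auto
  have eq: "vol (v(j := x)) = det (\<chi> i. if i = k then x else v (ix i))" for x
    unfolding volume_form_def
    by (rule arg_cong[where f = det]) (simp add: vec_eq_iff k inj_ix)
  have scale: "r *\<^sub>R b = r *s b" for r and b :: "real ^ 'n"
    by (simp add: vec_eq_iff)
  show "linear (\<lambda>x. vol (v(j := x)))"
    unfolding eq
  proof (rule linearI)
    show "det (\<chi> i. if i = k then x + y else v (ix i)) =
        det (\<chi> i. if i = k then x else v (ix i)) + det (\<chi> i. if i = k then y else v (ix i))" for x y
      by (rule det_row_add)
    show "det (\<chi> i. if i = k then r *\<^sub>R x else v (ix i)) =
        r *\<^sub>R det (\<chi> i. if i = k then x else v (ix i))" for r x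
      unfolding scale real_scaleR_def by (rule det_row_mul)
  qed
next
  fix v :: "nat \<Rightarrow> real ^ 'n" and i j assume "i < Suc n" "j < Suc n" and e: "i \<noteq> j \<and> v i = v j"
  then obtain k l where k: "i = ix k" "j = ix l"
    using ix_surj[of i] ix_surj[of j] by auto
  show "vol v = 0"
    unfolding volume_form_def
    by (rule det_identical_rows[of k l]) (use e k in \<open>auto simp: row_def\<close>)
qed

lemma vol_ax: "vol ax = 1"
proof -
  have "(\<chi> i. ax (ix i)) = (mat 1 :: real ^ 'n ^ 'n)"
    by (simp add: ax_ix vec_eq_iff axis_def mat_def eq_commute)
  then show ?thesis
    by (simp add: volume_form_def)
qed

lemma top_covector_eq:
  "k_covector (Suc n) \<alpha> \<Longrightarrow> \<alpha> v = \<alpha> ax * vol v"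
  by (rule top_covector_unique[OF _ vol_covector bij_betw_ax vol_ax])

lemma hvol_covector: "k_covector n (hvol N)"
  by (rule k_covector_interior[OF vol_covector])

lemma hvol_linear: "linear (\<lambda>N. hvol N v)"
  by (rule k_covector_linear_first[OF vol_covector])

lemma vol_orthonormal:
  assumes "orthonormal_frame (Suc n) w"
  shows "\<bar>vol w\<bar> = 1"
proof -
  have "orthogonal_matrix (\<chi> i. w (ix i))"
    unfolding orthogonal_matrix_orthonormal_rows
    using assms ix_le unfolding orthonormal_frame_def
    by (auto simp: row_def norm_eq_1 orthogonal_def less_Suc_eq_le inj_ix)
  from det_orthogonal_matrix[OF this] show ?thesis
    unfolding volume_form_def by auto
qed

lemma unit_normal_exists:
  assumes v: "orthonormal_frame n v"
  obtains N where "norm N = 1" "\<And>i. i < n \<Longrightarrow> v i \<bullet> N = 0" "hvol N v = 1"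
proof -
  have "dim (v ` {..<n}) \<le> card (v ` {..<n})"
    by (rule dim_le_card') simp
  also have "\<dots> \<le> n"
    using card_image_le[of "{..<n}" v] by simp
  finally have "dim (v ` {..<n}) < DIM(real ^ 'n)"
    by (simp add: card_coordinates)
  then obtain a where a: "a \<noteq> 0" "\<And>y. y \<in> span (v ` {..<n}) \<Longrightarrow> orthogonal a y"
    using orthogonal_to_subspace_exists by blast
  define N where "N = a /\<^sub>R norm a"
  have N: "norm N = 1" "\<And>i. i < n \<Longrightarrow> v i \<bullet> N = 0"
    using a by (auto simp: N_def orthogonal_def inner_commute[of _ a] span_base)
  have "\<bar>hvol N v\<bar> = 1"
    by (rule vol_orthonormal[OF orthonormal_frame_case_nat[OF v N]])
  then consider "hvol N v = 1" | "hvol (- N) v = 1"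
    using linear_neg[OF hvol_linear, of N v] by (auto simp: abs_if split: if_splits)
  then show ?thesis
    by cases (use that[of N] that[of "- N"] N in auto)
qed

text \<open>Hadamard's inequality in the form needed here. The projection \<open>p\<close> of
  \<open>u\<close> to the span of the frame contributes nothing, as it repeats vectors of
  \<open>v\<close>. The orthogonal rest \<open>w\<close> is at most as long as \<open>u\<close> and,
  once normalised, completes \<open>v\<close> to an orthonormal frame of volume 1 or -1.\<close>

lemma hvol_le_norm:
  assumes v: "orthonormal_frame n v"
  shows "\<bar>hvol u v\<bar> \<le> norm u"
proof -
  define p where "p = (\<Sum>i<n. (u \<bullet> v i) *\<^sub>R v i)"
  define w where "w = u - p"
  have wv: "v i \<bullet> w = 0" if "i < n" for i
  proof -
    have "v i \<bullet> p = (\<Sum>j<n. if j = i then u \<bullet> v i else 0)"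
      unfolding p_def inner_sum_right using v that unfolding orthonormal_frame_def
      by (intro sum.cong) auto
    then show ?thesis using that by (simp add: w_def inner_diff_right inner_commute)
  qed
  have "hvol (v i) v = 0" if "i < n" for i
    by (rule k_covector_alternating[OF vol_covector, of 0 "Suc i"]) (use that in auto)
  then have "hvol p v = 0"
    unfolding p_def by (simp add: linear_sum[OF hvol_linear] linear_scale[OF hvol_linear])
  then have eq: "hvol u v = hvol w v"
    using linear_diff[OF hvol_linear, of u p v] by (simp add: w_def)
  have "w \<bullet> p = 0"
    unfolding p_def inner_sum_right using wv by (intro sum.neutral) (auto simp: inner_commute)
  then have "norm u ^ 2 = norm w ^ 2 + norm p ^ 2"
    unfolding w_def power2_norm_eq_inner
    by (simp add: inner_diff_left inner_diff_right inner_commute)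
  then have le: "norm w \<le> norm u"
    by (metis le_add_same_cancel1 norm_ge_zero power2_le_imp_le zero_le_power2)
  show ?thesis
  proof (cases "w = 0")
    case True
    then show ?thesis using eq linear_0[OF hvol_linear, of v] by simp
  next
    case False
    define N where "N = w /\<^sub>R norm w"
    have "\<bar>hvol N v\<bar> = 1"
      using wv False by (intro vol_orthonormal orthonormal_frame_case_nat[OF v]) (auto simp: N_def)
    moreover have "hvol w v = norm w * hvol N v"
      using linear_scale[OF hvol_linear, of "norm w" N v] False by (simp add: N_def)
    ultimately show ?thesis using eq le by (simp add: abs_mult)
  qed
qed

lemma positive_frame_exists:
  assumes N: "norm N = 1" and n: "n \<ge> 1"
  shows "\<exists>v. orthonormal_frame n v \<and> (\<forall>i<n. v i \<bullet> N = 0) \<and> hvol N v = 1"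
proof -
  obtain S where S: "N \<in> S" "pairwise orthogonal S" "\<And>x. x \<in> S \<Longrightarrow> norm x = 1"
    "independent S" "card S = DIM(real ^ 'n)"
    using vector_in_orthonormal_basis[OF N] by metis
  have "finite S"
    using S(4) by (rule independent_imp_finite)
  then have "card {..<n} = card (S - {N})"
    using S(1,5) card_coordinates by simp
  then obtain v where v: "bij_betw v {..<n} (S - {N})"
    using \<open>finite S\<close> by (metis bij_betw_iff_card finite_Diff finite_lessThan)
  have vS: "v i \<in> S" "v i \<noteq> N" if "i < n" for i
    using v that unfolding bij_betw_def by auto
  have vv: "v i \<noteq> v j" if "i < n" "j < n" "i \<noteq> j" for i j
    using v that unfolding bij_betw_def inj_on_def by auto
  have fr: "orthonormal_frame n v"
    unfolding orthonormal_frame_def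
    using S(2,3) vS vv unfolding pairwise_def orthogonal_def by (auto simp: norm_eq_1)
  have ort: "v i \<bullet> N = 0" if "i < n" for i
    using S(1,2) vS[OF that] unfolding pairwise_def orthogonal_def by auto
  have "\<bar>hvol N v\<bar> = 1"
    by (rule vol_orthonormal[OF orthonormal_frame_case_nat[OF fr N ort]])
  then consider "hvol N v = 1" | "hvol N v = -1" by linarith
  then show ?thesis
  proof cases
    case 1
    then show ?thesis using fr ort by blast
  next
    case 2
    \<comment> \<open>Reversing one vector of the frame reverses the orientation;
      \<open>n \<ge> 1\<close> provides such a vector.\<close>
    define w where "w = v(0 := - v 0)"
    have "hvol N w = 1"
      using linear_neg[OF k_covector_linear[OF hvol_covector, of 0 N v], of "v 0"] n 2
      by (simp add: w_def)
    moreover have "orthonormal_frame n w"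
      using fr unfolding orthonormal_frame_def w_def by auto
    moreover have "w i \<bullet> N = 0" if "i < n" for i
      using ort[OF that] by (auto simp: w_def)
    ultimately show ?thesis by blast
  qed
qed

lemma frames_nonempty:
  assumes "n \<ge> 1"
  shows "\<exists>v :: nat \<Rightarrow> real ^ 'n. orthonormal_frame n v"
    "\<exists>v :: nat \<Rightarrow> real ^ 'n. orthonormal_frame (Suc n) v"
proof -
  have N: "norm (axis undefined 1 :: real ^ 'n) = 1" by simp
  then show "\<exists>v :: nat \<Rightarrow> real ^ 'n. orthonormal_frame n v"
    using positive_frame_exists[OF _ assms] by blast
  show "\<exists>v :: nat \<Rightarrow> real ^ 'n. orthonormal_frame (Suc n) v"
    using positive_frame_exists[OF N assms] orthonormal_frame_case_nat[OF _ N] by blast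
qed

text \<open>The \<open>(n + 1)\<close>-covector \<open>N\<^sup>\<flat> \<and> \<alpha>\<close> is a multiple of the volume form, and the frame \<open>N, v\<close> has
  volume \<open>1\<close>; so the value on \<open>v\<close> depends on \<open>N\<close> only.\<close>

lemma covector_on_frame:
  assumes \<alpha>: "k_covector n \<alpha>" and N: "norm N = 1" "\<And>i. i < n \<Longrightarrow> v i \<bullet> N = 0" "hvol N v = 1"
  shows "\<alpha> v = (\<Sum>i\<le>n. (-1) ^ i * ((ax i \<bullet> N) * \<alpha> (omit i ax)))"
proof -
  define \<beta> where "\<beta> w = (\<Sum>i\<le>n. (-1) ^ i * ((w i \<bullet> N) * \<alpha> (omit i w)))" for w
  have cov: "k_covector (Suc n) \<beta>"
    unfolding \<beta>_def
  proof (rule k_covector_antisymmetrize[where B = "\<lambda>u v. (u \<bullet> N) * \<alpha> v"])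
    show "linear (\<lambda>u. (u \<bullet> N) * \<alpha> v)" for v
      by (rule linearI) (auto simp: inner_add_left algebra_simps)
    show "k_covector n (\<lambda>v. (u \<bullet> N) * \<alpha> v)" for u
      by (rule k_covector_scale[OF \<alpha>])
  qed
  have "\<beta> (case_nat N v) = (\<Sum>i\<le>n. if i = 0 then \<alpha> v else 0)"
    unfolding \<beta>_def
  proof (rule sum.cong[OF refl])
    fix i assume i: "i \<in> {..n}"
    show "(-1) ^ i * ((case_nat N v i \<bullet> N) * \<alpha> (omit i (case_nat N v))) = (if i = 0 then \<alpha> v else 0)"
    proof (cases i)
      case 0
      then show ?thesis using N(1) by (simp add: omit_def norm_eq_1)
    next
      case (Suc j)
      then show ?thesis using N(2)[of j] i by simp
    qed
  qed
  also have "\<dots> = \<alpha> v" by simp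
  finally have "\<alpha> v = \<beta> ax * hvol N v"
    using top_covector_eq[OF cov, of "case_nat N v"] by simp
  then show ?thesis using N(3) by (simp add: \<beta>_def)
qed

text \<open>The bound is uniform in \<open>v\<close>, so the real supremum in \<open>comass\<close>
  is taken over a bounded set and does bound each value.\<close>

lemma covector_bounded_on_frames:
  fixes \<alpha> :: "(real ^ 'n) covec"
  assumes \<alpha>: "k_covector n \<alpha>" and v: "orthonormal_frame n v"
  shows "\<bar>\<alpha> v\<bar> \<le> (\<Sum>i\<le>n. \<bar>\<alpha> (omit i ax)\<bar>)"
proof -
  obtain N where N: "norm N = 1" "\<And>i. i < n \<Longrightarrow> v i \<bullet> N = 0" "hvol N v = 1"
    using unit_normal_exists[OF v] by blast
  have "\<bar>\<alpha> v\<bar> \<le> (\<Sum>i\<le>n. \<bar>(-1) ^ i * ((ax i \<bullet> N) * \<alpha> (omit i ax))\<bar>)"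
    by (subst covector_on_frame[OF \<alpha> N]) (auto intro: sum_abs)
  also have "\<dots> \<le> (\<Sum>i\<le>n. \<bar>\<alpha> (omit i ax)\<bar>)"
  proof (rule sum_mono)
    fix i
    have "norm (ax i) = 1" by (simp add: ax_def)
    then have "\<bar>ax i \<bullet> N\<bar> \<le> 1"
      using Cauchy_Schwarz_ineq2[of "ax i" N] N(1) by simp
    then show "\<bar>(-1) ^ i * ((ax i \<bullet> N) * \<alpha> (omit i ax))\<bar> \<le> \<bar>\<alpha> (omit i ax)\<bar>"
      by (simp add: abs_mult power_abs mult_left_le_one_le)
  qed
  finally show ?thesis .
qed

lemma abs_le_comass:
  fixes \<alpha> :: "(real ^ 'n) covec"
  assumes \<alpha>: "k_covector n \<alpha>" and v: "orthonormal_frame n v"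
  shows "\<bar>\<alpha> v\<bar> \<le> comass n \<alpha>"
  unfolding comass_def
  by (rule cSUP_upper) (use v covector_bounded_on_frames[OF \<alpha>] in \<open>auto intro!: bdd_aboveI2\<close>)

lemma comass_le:
  assumes "n \<ge> 1" "\<And>v. orthonormal_frame n v \<Longrightarrow> \<bar>\<alpha> v\<bar> \<le> C"
  shows "comass n (\<alpha> :: (real ^ 'n) covec) \<le> C"
  unfolding comass_def
  by (rule cSUP_least) (use frames_nonempty[OF assms(1)] assms(2) in auto)

lemma comass_zero:
  assumes "n \<ge> 1"
  shows "comass n (\<lambda>_ :: nat \<Rightarrow> real ^ 'n. 0) = 0" "comass (Suc n) (\<lambda>_ :: nat \<Rightarrow> real ^ 'n. 0) = 0"
  using frames_nonempty[OF assms] by (auto simp: comass_def)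

lemma comass_hvol:
  assumes "n \<ge> 1" "norm N = 1"
  shows "comass n (hvol N) = 1"
proof (rule antisym)
  show "comass n (hvol N) \<le> 1"
    using hvol_le_norm[of _ N] assms by (intro comass_le) auto
  show "1 \<le> comass n (hvol N)"
    using positive_frame_exists[OF assms(2,1)] abs_le_comass[OF hvol_covector, of _ N]
    by (metis abs_one)
qed

text \<open>The left side is an (n + 1)-covector in \<open>v\<close>, hence its value on the
  standard frame \<open>ax\<close> times the volume. On that frame the i-th term picks out the
  component of the derivative along \<open>ax i\<close>, and these add up to the divergence.\<close>

lemma ext_deriv_hvol:
  assumes X: "X differentiable (at x)"
  shows "ext_deriv n (\<lambda>y. hvol (X y)) x v = divergence X x * vol v"
proof -
  let ?D = "frechet_derivative X (at x)"
  have lD: "linear ?D"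
    by (rule linear_frechet_derivative[OF X])
  have D: "frechet_derivative (\<lambda>y. hvol (X y) w) (at x) = (\<lambda>u. hvol (?D u) w)" for w
  proof -
    have "bounded_linear (\<lambda>N. hvol N w)"
      using hvol_linear by (rule linear_conv_bounded_linear[THEN iffD1])
    from frechet_derivative_at[OF bounded_linear.has_derivative[OF this frechet_derivative_works[THEN iffD1, OF X]]]
    show ?thesis by simp
  qed
  have ed: "ext_deriv n (\<lambda>y. hvol (X y)) x v = (\<Sum>i\<le>n. (-1) ^ i * hvol (?D (v i)) (omit i v))" for v
    unfolding ext_deriv_def by (simp add: D omit_def)
  have "k_covector (Suc n) (\<lambda>v. \<Sum>i\<le>n. (-1) ^ i * hvol (?D (v i)) (omit i v))"
  proof (rule k_covector_antisymmetrize[where B = "\<lambda>u v. hvol (?D u) v"])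
    show "linear (\<lambda>u. hvol (?D u) w)" for w
      using linear_compose[OF lD hvol_linear, of w] by (simp add: o_def)
  qed (rule hvol_covector)
  from top_covector_eq[OF this, of v]
  have "ext_deriv n (\<lambda>y. hvol (X y)) x v = (\<Sum>i\<le>n. (-1) ^ i * hvol (?D (ax i)) (omit i ax)) * vol v"
    by (simp add: ed)
  also have "(\<Sum>i\<le>n. (-1) ^ i * hvol (?D (ax i)) (omit i ax)) = (\<Sum>i\<le>n. ?D (ax i) \<bullet> ax i)"
  proof (rule sum.cong[OF refl])
    fix i assume i: "i \<in> {..n}"
    have ort: "ax i \<in> Basis"
      using bij_betw_ax i unfolding bij_betw_def by auto
    \<comment> \<open>Only the component of \<open>u\<close> along \<open>ax i\<close> survives:
      every other basis vector occurs twice. Returning \<open>ax i\<close> from the front to its own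
      slot costs the sign.\<close>
    have u: "hvol u (omit i ax) = (u \<bullet> ax i) * (-1) ^ i" for u
    proof -
      have "hvol u (omit i ax) = hvol (\<Sum>b\<in>Basis. (u \<bullet> b) *\<^sub>R b) (omit i ax)"
        by (simp add: euclidean_representation)
      also have "\<dots> = (\<Sum>b\<in>Basis. (u \<bullet> b) * hvol b (omit i ax))"
        by (simp add: linear_sum[OF hvol_linear] linear_scale[OF hvol_linear])
      also have "\<dots> = (\<Sum>b\<in>Basis. if b = ax i then (u \<bullet> ax i) * (-1) ^ i else 0)"
      proof (rule sum.cong[OF refl])
        fix b :: "real ^ 'n" assume "b \<in> Basis"
        then obtain j where j: "j \<le> n" "b = ax j"
          using bij_betw_ax unfolding bij_betw_def by (auto simp: lessThan_Suc_atMost)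
        show "(u \<bullet> b) * hvol b (omit i ax) = (if b = ax i then (u \<bullet> ax i) * (-1) ^ i else 0)"
        proof (cases "j = i")
          case True
          then show ?thesis
            using k_covector_move_to_front[OF vol_covector, of i ax] i j vol_ax by simp
        next
          case False
          then have "b \<noteq> ax i"
            using bij_betw_ax i j unfolding bij_betw_def inj_on_def by auto
          moreover have "hvol b (omit i ax) = 0"
          \<comment> \<open>In \<open>case_nat b (omit i ax)\<close> the second copy of
            \<open>ax j\<close> stands at position \<open>Suc j\<close> if it precedes the gap, and
            at position \<open>j\<close> if it follows it.\<close>
          proof (cases "j < i")
            case True
            then show ?thesis
              using i j by (intro k_covector_alternating[OF vol_covector, of 0 "Suc j"]) (auto simp: omit_def)
          next
            case False
            with \<open>j \<noteq> i\<close> obtain k where "j = Suc k" "i \<le> k" by (cases j) auto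
            then show ?thesis
              using i j by (intro k_covector_alternating[OF vol_covector, of 0 j]) (auto simp: omit_def)
          qed
          ultimately show ?thesis by simp
        qed
      qed
      also have "\<dots> = (u \<bullet> ax i) * (-1) ^ i"
        using ort by simp
      finally show ?thesis .
    qed
    show "(-1) ^ i * hvol (?D (ax i)) (omit i ax) = ?D (ax i) \<bullet> ax i"
      by (simp add: u)
  qed
  also have "\<dots> = divergence X x"
    unfolding divergence_def using sum.reindex_bij_betw[OF bij_betw_ax, of "\<lambda>b. ?D b \<bullet> b"]
    by (simp add: lessThan_Suc_atMost)
  finally show ?thesis .
qed

end

subsection \<open>Smooth forms and the Poincare lemma\<close>

lemma k_covector_sum:
  assumes "\<And>i. i \<in> I \<Longrightarrow> k_covector k (\<alpha> i)"
  shows "k_covector k (\<lambda>v. \<Sum>i\<in>I. \<alpha> i v)"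
  using assms
proof (induction I rule: infinite_finite_induct)
  case (insert i I)
  then show ?case
    using k_covector_lincomb[of k "\<alpha> i" "\<lambda>v. \<Sum>i\<in>I. \<alpha> i v" 1 1] by simp
qed (simp_all add: k_covector_def linear_zero)

lemma k_covector_integral:
  fixes \<alpha> :: "'b::euclidean_space \<Rightarrow> 'a::euclidean_space covec"
  assumes cov: "\<And>t. k_covector k (\<alpha> t)" and int: "\<And>v. (\<lambda>t. \<alpha> t v) integrable_on S"
  shows "k_covector k (\<lambda>v. integral S (\<lambda>t. \<alpha> t v))"
  unfolding k_covector_def
proof (intro conjI allI impI)
  show "integral S (\<lambda>t. \<alpha> t v) = integral S (\<lambda>t. \<alpha> t w)" if "\<forall>i<k. v i = w i" for v w
    using k_covector_cong[OF cov, of v w] that by simp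
  show "linear (\<lambda>x. integral S (\<lambda>t. \<alpha> t (v(i := x))))" if "i < k" for v i
    by (rule linearI)
       (simp_all add: linear_add[OF k_covector_linear[OF cov that]]
         linear_scale[OF k_covector_linear[OF cov that]] integral_add int)
  show "integral S (\<lambda>t. \<alpha> t v) = 0" if "i < k" "j < k" "i \<noteq> j \<and> v i = v j" for v i j
    using k_covector_alternating[OF cov, of i j v] that by simp
qed

definition smooth_form :: "nat \<Rightarrow> 'a::euclidean_space form \<Rightarrow> bool" where
  "smooth_form k \<omega> \<longleftrightarrow> (\<forall>x. k_covector k (\<omega> x)) \<and> (\<forall>v. smooth (\<lambda>x. \<omega> x v))"

lemma smooth_form_iff: "(\<forall>m. C_form m k \<omega>) \<longleftrightarrow> smooth_form k \<omega>"
  unfolding smooth_form_def C_form_def smooth_def by blast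

lemma smooth_mult: "smooth f \<Longrightarrow> smooth g \<Longrightarrow> smooth (\<lambda>x. f x * g x)"
  unfolding smooth_def by (blast intro: C_diff_mult)

lemma smooth_sum: "(\<And>i. i \<in> I \<Longrightarrow> smooth (f i)) \<Longrightarrow> smooth (\<lambda>x. \<Sum>i\<in>I. f i x)"
  unfolding smooth_def by (blast intro: C_diff_sum)

lemma smooth_const: "smooth (\<lambda>x. c)"
  unfolding smooth_def by (blast intro: C_diff_const)

lemma smooth_inner: "smooth (\<lambda>x. x \<bullet> b)"
  unfolding smooth_def by (blast intro: C_diff_inner)

lemma smooth_form_scale:
  assumes "smooth h" "smooth_form k \<omega>"
  shows "smooth_form k (\<lambda>x v. h x * \<omega> x v)"
  using assms unfolding smooth_form_def by (auto intro: k_covector_scale smooth_mult)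

lemma smooth_form_lincomb:
  assumes "smooth_form k \<phi>" "smooth_form k \<psi>"
  shows "smooth_form k (\<lambda>x v. a * \<phi> x v + b * \<psi> x v)"
  using assms unfolding smooth_form_def smooth_def
  by (auto intro!: k_covector_lincomb C_diff_add C_diff_mult C_diff_const)

lemma derivative_covector:
  fixes \<omega> :: "'a::euclidean_space form"
  assumes cov: "\<And>y. k_covector k (\<omega> y)" and diff: "\<And>v. (\<lambda>y. \<omega> y v) differentiable (at x)"
  shows "k_covector k (\<lambda>v. D (\<lambda>y. \<omega> y v) x u)"
  unfolding k_covector_def
proof (intro conjI allI impI)
  have d: "((\<lambda>y. \<omega> y v) has_derivative D (\<lambda>y. \<omega> y v) x) (at x)" for v
    using diff by (simp add: frechet_derivative_works)
  show "D (\<lambda>y. \<omega> y v) x u = D (\<lambda>y. \<omega> y w) x u" if "\<forall>i<k. v i = w i" for v w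
    using k_covector_cong[OF cov, of v w] that by simp
  show "linear (\<lambda>z. D (\<lambda>y. \<omega> y (v(i := z))) x u)" if "i < k" for v i
  proof (rule linearI)
    note l = k_covector_linear[OF cov that]
    show "D (\<lambda>y. \<omega> y (v(i := a + b))) x u = D (\<lambda>y. \<omega> y (v(i := a))) x u + D (\<lambda>y. \<omega> y (v(i := b))) x u" for a b
      unfolding linear_add[OF l] by (rule D_eqI[OF has_derivative_add[OF d d]])
    show "D (\<lambda>y. \<omega> y (v(i := r *\<^sub>R a))) x u = r *\<^sub>R D (\<lambda>y. \<omega> y (v(i := a))) x u" for r a
      unfolding linear_scale[OF l] by (rule D_eqI[OF has_derivative_scaleR_right[OF d]])
  qed
  show "D (\<lambda>y. \<omega> y v) x u = 0" if "i < k" "j < k" "i \<noteq> j \<and> v i = v j" for v i j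
    using k_covector_alternating[OF cov, of i j v] that by simp
qed

lemma ext_deriv_omit:
  "ext_deriv k \<omega> x v = (\<Sum>i\<le>k. (-1) ^ i * D (\<lambda>y. \<omega> y (omit i v)) x (v i))"
  unfolding ext_deriv_def omit_def ..

lemma smooth_form_differentiable:
  "smooth_form k \<omega> \<Longrightarrow> (\<lambda>y. \<omega> y v) differentiable (at x)"
  unfolding smooth_form_def using smooth_has_derivative differentiableI by blast

lemma smooth_form_ext_deriv:
  assumes "smooth_form k \<omega>"
  shows "smooth_form (Suc k) (ext_deriv k \<omega>)"
  unfolding smooth_form_def ext_deriv_omit[abs_def]
proof (intro conjI allI)
  fix x
  show "k_covector (Suc k) (\<lambda>v. \<Sum>i\<le>k. (-1) ^ i * D (\<lambda>y. \<omega> y (omit i v)) x (v i))"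
  proof (rule k_covector_antisymmetrize[where B = "\<lambda>u v. D (\<lambda>y. \<omega> y v) x u"])
    show "linear (\<lambda>u. D (\<lambda>y. \<omega> y v) x u)" for v
      using linear_frechet_derivative[OF smooth_form_differentiable[OF assms]] .
    show "k_covector k (\<lambda>v. D (\<lambda>y. \<omega> y v) x u)" for u
      using assms smooth_form_differentiable[OF assms] unfolding smooth_form_def
      by (intro derivative_covector) auto
  qed
next
  fix v
  show "smooth (\<lambda>x. \<Sum>i\<le>k. (-1) ^ i * D (\<lambda>y. \<omega> y (omit i v)) x (v i))"
    using assms unfolding smooth_form_def
    by (intro smooth_sum smooth_mult smooth_const smooth_derivative) auto
qed

section \<open>Radial integrals and the cone construction\<close>

definition radial_integral :: "nat \<Rightarrow> ('a::euclidean_space \<Rightarrow> real) \<Rightarrow> 'a \<Rightarrow> real" where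
  "radial_integral k h x = integral (cbox 0 1) (\<lambda>t. t ^ k * h (t *\<^sub>R x))"

lemma radial_integrable:
  fixes h :: "'a::euclidean_space \<Rightarrow> real"
  assumes "continuous_on UNIV h"
  shows "(\<lambda>t::real. t ^ k * h (t *\<^sub>R x)) integrable_on cbox 0 1"
  by (intro integrable_continuous continuous_intros continuous_on_compose2[OF assms])
     auto

text \<open>The chain rule for x |-> t x contributes one more factor t, which raises the
  exponent.\<close>

lemma radial_integral_has_derivative:
  fixes h :: "'a::euclidean_space \<Rightarrow> real"
  assumes h: "smooth h"
  shows "(radial_integral k h has_derivative (\<lambda>v. radial_integral (Suc k) (\<lambda>z. D h z v) x)) (at x)"
proof -
  have h': "C_diff (Suc 0) UNIV h" by (rule smooth_C_diff[OF h])
  have "((\<lambda>x. integral (cbox 0 1) (\<lambda>t. t ^ k * h (t *\<^sub>R x))) has_derivative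
      (\<lambda>v. integral (cbox 0 1) (\<lambda>t::real. (t ^ Suc k *\<^sub>R gradient h (t *\<^sub>R x)) \<bullet> v))) (at x)"
  proof (rule leibniz_gradient)
    fix x :: 'a and t :: real
    have "((\<lambda>x. t *\<^sub>R x) has_derivative (\<lambda>v. t *\<^sub>R v)) (at x)"
      by (auto intro!: derivative_eq_intros)
    from has_derivative_mult_right[OF has_derivative_compose[OF this C_diff_gradient(1)[OF h']], of "t ^ k"]
    show "((\<lambda>x. t ^ k * h (t *\<^sub>R x)) has_derivative (\<lambda>v. (t ^ Suc k *\<^sub>R gradient h (t *\<^sub>R x)) \<bullet> v)) (at x)"
      by (simp add: mult_ac)
  next
    show "continuous_on UNIV (\<lambda>(x, t::real). t ^ Suc k *\<^sub>R gradient h (t *\<^sub>R x))"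
      unfolding case_prod_beta
      by (intro continuous_intros continuous_on_compose2[OF C_diff_gradient(2)[OF h']]) auto
  qed (rule radial_integrable[OF smooth_continuous[OF h]])
  moreover have "(\<lambda>t. (t ^ Suc k *\<^sub>R gradient h (t *\<^sub>R x)) \<bullet> v) = (\<lambda>t. t ^ Suc k * D h (t *\<^sub>R x) v)" for v
    by (simp add: C_diff_gradient(3)[OF h'])
  ultimately show ?thesis
    unfolding radial_integral_def[abs_def] by (simp only:)
qed

lemma smooth_radial_integral:
  assumes "smooth h"
  shows "smooth (radial_integral k h)"
proof -
  have "C_diff m UNIV (radial_integral k h)" for m
    using assms
  proof (induction m arbitrary: k h)
    case 0
    show ?case
      using has_derivative_continuous[OF radial_integral_has_derivative[OF 0]]
      by (auto simp: continuous_on_eq_continuous_at)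
  next
    case (Suc m)
    show ?case
      by (rule C_diff_SucI[OF radial_integral_has_derivative[OF Suc.prems] Suc.IH[OF smooth_derivative[OF Suc.prems]]])
  qed
  then show ?thesis by (simp add: smooth_def)
qed

text \<open>The homotopy operator of the cone over the origin: \<open>\<eta>\<^sub>x(v) = \<integral>\<^sub>0\<^sup>1 t\<^sup>k \<omega>\<^sub>t\<^sub>x(x, v) dt\<close>.\<close>

definition cone_form :: "nat \<Rightarrow> 'a::euclidean_space form \<Rightarrow> 'a form" where
  "cone_form k \<omega> x v = (\<Sum>b\<in>Basis. (x \<bullet> b) * radial_integral k (\<lambda>z. \<omega> z (case_nat b v)) x)"

lemma smooth_cone_form:
  assumes "smooth_form (Suc k) \<omega>"
  shows "smooth_form k (cone_form k \<omega>)"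
  unfolding smooth_form_def cone_form_def[abs_def]
proof (intro conjI allI)
  have cov: "k_covector (Suc k) (\<omega> x)" and sm: "smooth (\<lambda>x. \<omega> x v)" for x v
    using assms unfolding smooth_form_def by auto
  show "k_covector k (\<lambda>v. \<Sum>b\<in>Basis. (x \<bullet> b) * radial_integral k (\<lambda>z. \<omega> z (case_nat b v)) x)" for x
    unfolding radial_integral_def
    by (intro k_covector_sum k_covector_scale k_covector_integral radial_integrable
        smooth_continuous[OF sm] k_covector_interior[OF cov])
  show "smooth (\<lambda>x. \<Sum>b\<in>Basis. (x \<bullet> b) * radial_integral k (\<lambda>z. \<omega> z (case_nat b v)) x)" for v
    by (intro smooth_sum smooth_mult smooth_inner smooth_radial_integral sm)
qed

lemma sum_Basis_linear:
  assumes "linear L"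
  shows "(\<Sum>b\<in>Basis. (x \<bullet> b) * L b) = (L x :: real)"
proof -
  have "(\<Sum>b\<in>Basis. (x \<bullet> b) * L b) = (\<Sum>b\<in>Basis. L ((x \<bullet> b) *\<^sub>R b))"
    by (simp add: linear_scale[OF assms])
  also have "\<dots> = L x"
    by (simp add: linear_sum[OF assms, symmetric] euclidean_representation)
  finally show ?thesis .
qed

text \<open>Cartan's homotopy formula along the rays from the origin. Differentiating the factor x
  of the cone form gives k + 1 equal terms with t^k \<omega>(v) at t x; differentiating \<omega>
  gives an alternating sum that closedness turns into t^(k+1) times the derivative of \<omega>(v)
  along x. Together they are the t-derivative of t^(k+1) \<omega>(v) at t x.\<close>

lemma ext_deriv_cone_form:
  fixes \<omega> :: "'a::euclidean_space form"
  assumes \<omega>: "smooth_form (Suc k) \<omega>" and closed: "\<And>x v. ext_deriv (Suc k) \<omega> x v = 0"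
  shows "ext_deriv k (cone_form k \<omega>) x v = \<omega> x v"
proof -
  have cov: "k_covector (Suc k) (\<omega> x)" and sm: "smooth (\<lambda>x. \<omega> x v)" for x v
    using \<omega> unfolding smooth_form_def by auto
  have dcov: "k_covector (Suc k) (\<lambda>v. D (\<lambda>y. \<omega> y v) z u)" for z u
    by (intro derivative_covector cov smooth_form_differentiable[OF \<omega>])
  \<comment> \<open>\<open>P u w\<close> is the integrand of the derivative of the cone form on
    \<open>w\<close> in direction \<open>u\<close>: the first summand differentiates \<omega>, the
    second the linear factor in front of it.\<close>
  define P where "P u w t = (\<Sum>b\<in>Basis. (x \<bullet> b) * (t ^ Suc k * D (\<lambda>z. \<omega> z (case_nat b w)) (t *\<^sub>R x) u)
      + (u \<bullet> b) * (t ^ k * \<omega> (t *\<^sub>R x) (case_nat b w)))" for u w and t :: real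
  have P: "P u w t = t ^ Suc k * D (\<lambda>z. \<omega> z (case_nat x w)) (t *\<^sub>R x) u + t ^ k * \<omega> (t *\<^sub>R x) (case_nat u w)" for u w t
  proof -
    have "P u w t = t ^ Suc k * (\<Sum>b\<in>Basis. (x \<bullet> b) * D (\<lambda>z. \<omega> z (case_nat b w)) (t *\<^sub>R x) u)
        + t ^ k * (\<Sum>b\<in>Basis. (u \<bullet> b) * \<omega> (t *\<^sub>R x) (case_nat b w))"
      unfolding P_def by (simp add: sum.distrib sum_distrib_left mult_ac)
    then show ?thesis
      by (simp add: sum_Basis_linear[OF k_covector_linear_first[OF dcov]]
          sum_Basis_linear[OF k_covector_linear_first[OF cov]])
  qed
  have i1: "(\<lambda>t. (x \<bullet> b) * (t ^ Suc k * D (\<lambda>z. \<omega> z (case_nat b w)) (t *\<^sub>R x) u)) integrable_on cbox 0 1"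
    and i2: "(\<lambda>t. (u \<bullet> b) * (t ^ k * \<omega> (t *\<^sub>R x) (case_nat b w))) integrable_on cbox 0 1" for u w b
    by (intro integrable_on_cmult_left[where 'b = real, simplified] radial_integrable smooth_continuous smooth_derivative sm)+
  have int: "P u w integrable_on cbox 0 1" for u w
    unfolding P_def[abs_def] by (intro integrable_sum integrable_add i1 i2 finite_Basis)
  have "D (\<lambda>y. cone_form k \<omega> y w) x u = integral (cbox 0 1) (P u w)" for u w
  proof -
    have "((\<lambda>y. cone_form k \<omega> y w) has_derivative (\<lambda>u. \<Sum>b\<in>Basis.
        (x \<bullet> b) * radial_integral (Suc k) (\<lambda>z. D (\<lambda>z. \<omega> z (case_nat b w)) z u) x
        + (u \<bullet> b) * radial_integral k (\<lambda>z. \<omega> z (case_nat b w)) x)) (at x)"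
      unfolding cone_form_def
      by (intro has_derivative_sum has_derivative_mult radial_integral_has_derivative sm
          bounded_linear_imp_has_derivative bounded_linear_inner_left)
    moreover have "integral (cbox 0 1) (P u w) = (\<Sum>b\<in>Basis.
        (x \<bullet> b) * radial_integral (Suc k) (\<lambda>z. D (\<lambda>z. \<omega> z (case_nat b w)) z u) x
        + (u \<bullet> b) * radial_integral k (\<lambda>z. \<omega> z (case_nat b w)) x)"
      unfolding P_def[abs_def] radial_integral_def
      by (subst integral_sum)
         (auto intro!: sum.cong integrable_add i1[simplified] i2[simplified]
           simp: integral_add[OF i1[simplified] i2[simplified]])
    ultimately show ?thesis
      using D_eqI by fastforce
  qed
  then have "ext_deriv k (cone_form k \<omega>) x v =
      (\<Sum>i\<le>k. (-1) ^ i * integral (cbox 0 1) (P (v i) (omit i v)))"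
    by (simp add: ext_deriv_omit)
  also have "\<dots> = integral (cbox 0 1) (\<lambda>t. \<Sum>i\<le>k. (-1) ^ i * P (v i) (omit i v) t)"
    by (subst integral_sum) (auto intro!: integrable_on_cmult_left[where 'b = real, simplified] int[simplified])
  also have "\<dots> = integral (cbox 0 1) (\<lambda>t. t ^ Suc k * D (\<lambda>z. \<omega> z v) (t *\<^sub>R x) x
      + (1 + real k) * t ^ k * \<omega> (t *\<^sub>R x) v)"
  proof (rule integral_cong)
    fix t :: real
    let ?y = "t *\<^sub>R x"
    have "omit (Suc i) (case_nat x v) = case_nat x (omit i v)" for i
      by (auto simp: omit_def fun_eq_iff split: nat.split)
    moreover have "omit 0 (case_nat x v) = v"
      by (simp add: omit_def)
    \<comment> \<open>Closedness on the k + 2 vectors x, v 0, ..., v k: the first term is the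
      derivative along x, and the shift of the index by one flips the signs of the others.\<close>
    ultimately have "0 = D (\<lambda>z. \<omega> z v) ?y x
        + (\<Sum>i\<le>k. - ((-1) ^ i * D (\<lambda>z. \<omega> z (case_nat x (omit i v))) ?y (v i)))"
      using closed[of ?y "case_nat x v"] unfolding ext_deriv_omit sum.atMost_Suc_shift by simp
    then have 1: "(\<Sum>i\<le>k. (-1) ^ i * D (\<lambda>z. \<omega> z (case_nat x (omit i v))) ?y (v i)) = D (\<lambda>z. \<omega> z v) ?y x"
      by (simp add: sum_negf)
    have "(\<Sum>i\<le>k. (-1) ^ i * \<omega> ?y (case_nat (v i) (omit i v))) = (\<Sum>i\<le>k. \<omega> ?y v)"
      by (intro sum.cong refl)
         (simp add: k_covector_move_to_front[OF cov] mult.assoc[symmetric] power_mult_distrib[symmetric])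
    then have 2: "(\<Sum>i\<le>k. (-1) ^ i * \<omega> ?y (case_nat (v i) (omit i v))) = (1 + real k) * \<omega> ?y v"
      by simp
    have "(\<Sum>i\<le>k. (-1) ^ i * P (v i) (omit i v) t) =
        t ^ Suc k * (\<Sum>i\<le>k. (-1) ^ i * D (\<lambda>z. \<omega> z (case_nat x (omit i v))) ?y (v i))
        + t ^ k * (\<Sum>i\<le>k. (-1) ^ i * \<omega> ?y (case_nat (v i) (omit i v)))"
      unfolding P by (simp only: distrib_left sum.distrib sum_distrib_left mult_ac)
    then show "(\<Sum>i\<le>k. (-1) ^ i * P (v i) (omit i v) t) =
        t ^ Suc k * D (\<lambda>z. \<omega> z v) ?y x + (1 + real k) * t ^ k * \<omega> ?y v"
      unfolding 1 2 by simp
  qed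
  also have "\<dots> = \<omega> x v"
  proof -
    have "((\<lambda>t. t ^ Suc k * \<omega> (t *\<^sub>R x) v) has_vector_derivative
        (t ^ Suc k * D (\<lambda>z. \<omega> z v) (t *\<^sub>R x) x + (1 + real k) * t ^ k * \<omega> (t *\<^sub>R x) v)) (at t within {0..1})" for t :: real
    proof -
      have "((\<lambda>t. t *\<^sub>R x) has_derivative (\<lambda>s. s *\<^sub>R x)) (at t)"
        by (auto intro!: derivative_eq_intros)
      from has_derivative_compose[OF this smooth_has_derivative[OF sm]]
      have "((\<lambda>t. \<omega> (t *\<^sub>R x) v) has_derivative (\<lambda>s. D (\<lambda>z. \<omega> z v) (t *\<^sub>R x) (s *\<^sub>R x))) (at t)" .
      moreover have "D (\<lambda>z. \<omega> z v) (t *\<^sub>R x) (s *\<^sub>R x) = s * D (\<lambda>z. \<omega> z v) (t *\<^sub>R x) x" for s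
        using linear_scale[OF has_derivative_linear[OF smooth_has_derivative[OF sm]]] by simp
      ultimately have "((\<lambda>t. \<omega> (t *\<^sub>R x) v) has_real_derivative D (\<lambda>z. \<omega> z v) (t *\<^sub>R x) x) (at t)"
        by (simp add: has_field_derivative_def mult_commute_abs)
      from DERIV_mult[OF DERIV_power[OF DERIV_ident, of "Suc k"] this]
      have "((\<lambda>t. t ^ Suc k * \<omega> (t *\<^sub>R x) v) has_real_derivative
          t ^ Suc k * D (\<lambda>z. \<omega> z v) (t *\<^sub>R x) x + (1 + real k) * t ^ k * \<omega> (t *\<^sub>R x) v) (at t)"
        by (simp add: algebra_simps)
      then show ?thesis
        using has_field_derivative_at_within has_real_derivative_iff_has_vector_derivative by blast
    qed
    \<comment> \<open>At t = 0 the factor t^(k+1) vanishes, so only the value at t = 1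
      remains.\<close>
    from fundamental_theorem_of_calculus[OF _ this]
    show ?thesis by (simp add: integral_unique)
  qed
  finally show ?thesis .
qed

text \<open>An average of translates of the form: the vectors \<open>v\<close> stay constant while
  the base point varies. Hence derivatives in the base point pass to \<omega>, and bounds for fixed
  \<open>v\<close> persist.\<close>

definition mollified :: "('a::euclidean_space \<Rightarrow> real) \<Rightarrow> 'a form \<Rightarrow> 'a form" where
  "mollified \<rho> \<omega> x v = convolve \<rho> (\<lambda>y. \<omega> y v) x"

lemma smooth_mollified:
  assumes \<rho>: "mollifier e \<rho>" and \<omega>: "C_form 0 k \<omega>"
  shows "smooth_form k (mollified \<rho> \<omega>)"
  unfolding smooth_form_def mollified_def[abs_def]
proof (intro conjI allI)
  have c: "continuous_on UNIV (\<lambda>y. \<omega> y v)" for v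
    using \<omega> by (simp add: C_form_def)
  show "k_covector k (\<lambda>v. convolve \<rho> (\<lambda>y. \<omega> y v) x)" for x
    unfolding convolve_def using \<omega>
    by (intro k_covector_integral k_covector_scale convolve_integrable[OF \<rho> c]) (simp add: C_form_def)
  show "smooth (\<lambda>x. convolve \<rho> (\<lambda>y. \<omega> y v) x)" for v
    by (rule smooth_convolve[OF mollifierD(1,3)[OF \<rho>] c])
qed

lemma ext_deriv_mollified:
  assumes \<rho>: "mollifier e \<rho>" and \<omega>: "C_form 1 k \<omega>"
  shows "ext_deriv k (mollified \<rho> \<omega>) x v = convolve \<rho> (\<lambda>y. ext_deriv k \<omega> y v) x"
proof -
  have c: "C_diff (Suc 0) UNIV (\<lambda>y. \<omega> y w)" for w
    using \<omega> by (simp add: C_form_def)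
  have i: "(\<lambda>y. \<rho> (x - y) * D (\<lambda>z. \<omega> z w) y u) integrable_on UNIV" for w u
    by (rule convolve_integrable[OF \<rho> C_diff_continuous[OF C_diff_Suc_derivative[OF c]]])
  have "ext_deriv k (mollified \<rho> \<omega>) x v =
      (\<Sum>i\<le>k. (-1) ^ i * convolve \<rho> (\<lambda>y. D (\<lambda>z. \<omega> z (omit i v)) y (v i)) x)"
    unfolding ext_deriv_omit mollified_def
    using D_convolve[OF mollifierD(1,3)[OF \<rho>]] c by simp
  also have "\<dots> = integral UNIV (\<lambda>y. \<Sum>i\<le>k. (-1) ^ i * (\<rho> (x - y) * D (\<lambda>z. \<omega> z (omit i v)) y (v i)))"
    unfolding convolve_def
    by (subst integral_sum) (auto intro!: integrable_on_cmult_left[where 'b = real, simplified] i)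
  also have "\<dots> = convolve \<rho> (\<lambda>y. ext_deriv k \<omega> y v) x"
    unfolding convolve_def ext_deriv_omit by (simp add: sum_distrib_left mult_ac)
  finally show ?thesis .
qed

subsection \<open>Flat cycles and closed forms\<close>

lemma test_form_iff:
  "test_form k \<phi> \<longleftrightarrow> smooth_form k \<phi> \<and> (\<exists>r. \<forall>x. norm x > r \<longrightarrow> \<phi> x = (\<lambda>_. 0))"
proof -
  have "(\<exists>K. compact K \<and> (\<forall>x. x \<notin> K \<longrightarrow> \<phi> x = (\<lambda>_. 0))) \<longleftrightarrow> (\<exists>r. \<forall>x. norm x > r \<longrightarrow> \<phi> x = (\<lambda>_. 0))"
  proof
    assume "\<exists>K. compact K \<and> (\<forall>x. x \<notin> K \<longrightarrow> \<phi> x = (\<lambda>_. 0))"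
    then obtain K where K: "compact K" "\<And>x. x \<notin> K \<Longrightarrow> \<phi> x = (\<lambda>_. 0)" by blast
    obtain r where "\<forall>x\<in>K. norm x \<le> r"
      using compact_imp_bounded[OF K(1)] unfolding bounded_iff by blast
    then show "\<exists>r. \<forall>x. norm x > r \<longrightarrow> \<phi> x = (\<lambda>_. 0)"
      using K(2) by (intro exI[of _ r]) force
  next
    assume "\<exists>r. \<forall>x. norm x > r \<longrightarrow> \<phi> x = (\<lambda>_. 0)"
    then obtain r where "\<forall>x. norm x > r \<longrightarrow> \<phi> x = (\<lambda>_. 0)" by blast
    then show "\<exists>K. compact K \<and> (\<forall>x. x \<notin> K \<longrightarrow> \<phi> x = (\<lambda>_. 0))"
      by (intro exI[of _ "cball 0 r"]) auto
  qed
  then show ?thesis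
    unfolding test_form_def smooth_form_iff[symmetric] by simp
qed

lemma test_form_lincomb:
  assumes "test_form k \<phi>" "test_form k \<psi>"
  shows "test_form k (\<lambda>x v. a * \<phi> x v + b * \<psi> x v)"
proof -
  obtain r s where "\<forall>x. norm x > r \<longrightarrow> \<phi> x = (\<lambda>_. 0)" "\<forall>x. norm x > s \<longrightarrow> \<psi> x = (\<lambda>_. 0)"
    using assms unfolding test_form_iff by blast
  then have "\<forall>x. norm x > max r s \<longrightarrow> (\<lambda>v. a * \<phi> x v + b * \<psi> x v) = (\<lambda>_. 0)"
    by simp
  then show ?thesis
    using assms smooth_form_lincomb unfolding test_form_iff by blast
qed

lemma ext_deriv_cong_open:
  assumes "open U" "x \<in> U" "\<And>y v. y \<in> U \<Longrightarrow> \<psi> y v = \<omega> y v" and \<psi>: "smooth_form k \<psi>"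
  shows "ext_deriv k \<psi> x v = ext_deriv k \<omega> x v"
proof -
  have "frechet_derivative (\<lambda>y. \<psi> y w) (at x) = frechet_derivative (\<lambda>y. \<omega> y w) (at x)" for w
    by (rule frechet_derivative_transform_within_open[OF smooth_form_differentiable[OF \<psi>] assms(1-3)])
  then show ?thesis unfolding ext_deriv_omit by simp
qed

lemma ext_deriv_zero: "ext_deriv k (\<lambda>_ _. 0) x v = 0"
  by (simp add: ext_deriv_omit)

context coordinate_order
begin

text \<open>One approximation \<open>R\<close> within flat distance 1 is enough. If \<phi> vanishes
  near \<open>K\<close>, then \<open>R\<close> kills it, and every multiple t \<phi> has flat
  seminorm 0 on \<open>K\<close>; so t S(\<phi>) = (S - R)(t \<phi>) < 1 for all real t.\<close>

lemma flat_chain_local: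
  fixes S :: "(real ^ 'n) functional"
  assumes n: "n \<ge> 1" and S: "real_flat_chain n S"
  shows "\<exists>K. compact K \<and>
    (\<forall>\<phi> U. test_form n \<phi> \<longrightarrow> open U \<longrightarrow> K \<subseteq> U \<longrightarrow> (\<forall>x\<in>U. \<forall>v. \<phi> x v = 0) \<longrightarrow> S \<phi> = 0)"
proof -
  have lS: "linear_functional n S"
    using S by (simp add: real_flat_chain_def)
  obtain K where K: "compact K" "\<forall>\<epsilon>>0. \<exists>R. normal_current n R \<and> supported_in n K R \<and>
      flat_norm n K (\<lambda>\<phi>. S \<phi> - R \<phi>) < ereal \<epsilon>"
    using S unfolding real_flat_chain_def by blast
  have "\<exists>R. normal_current n R \<and> supported_in n K R \<and> flat_norm n K (\<lambda>\<phi>. S \<phi> - R \<phi>) < ereal 1"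
    using K(2) zero_less_one by blast
  then obtain R where R: "linear_functional n R" "supported_in n K R"
      "flat_norm n K (\<lambda>\<phi>. S \<phi> - R \<phi>) < ereal 1"
    unfolding normal_current_def by blast
  show ?thesis
  proof (intro exI[of _ K] conjI allI impI K(1))
    fix \<phi> :: "(real ^ 'n) form" and U
    assume \<phi>: "test_form n \<phi>" and U: "open U" "K \<subseteq> U" and "\<forall>x\<in>U. \<forall>v. \<phi> x v = 0"
    then have van\<phi>: "\<phi> x v = 0" if "x \<in> U" for x v using that by blast
    \<comment> \<open>The multiple is written as a combination with a zero term, the shape in which
      \<open>linear_functional\<close> and \<open>test_form_lincomb\<close> treat it.\<close>
    define \<psi> where "\<psi> t = (\<lambda>x v. t * \<phi> x v + 0 * \<phi> x v)" for t
    have \<psi>: "test_form n (\<psi> t)" for t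
      unfolding \<psi>_def by (rule test_form_lincomb[OF \<phi> \<phi>])
    have "{x. \<phi> x \<noteq> (\<lambda>_. 0)} \<subseteq> - U"
      using van\<phi> by auto
    then have "closure {x. \<phi> x \<noteq> (\<lambda>_. 0)} \<subseteq> - U"
      using U(1) by (intro closure_minimal) auto
    then have R0: "R \<phi> = 0"
      using R(2) \<phi> U(2) unfolding supported_in_def by blast
    have lt: "t * S \<phi> < 1" for t
    proof -
      have van: "\<psi> t y v = 0" if "y \<in> U" for y v
        using van\<phi>[OF that] by (simp add: \<psi>_def)
      have "comass n (\<psi> t x) \<le> 1 \<and> comass (Suc n) (ext_deriv n (\<psi> t) x) \<le> 1" if "x \<in> K" for x
      proof -
        have "\<psi> t x = (\<lambda>_. 0)"
          using van that U(2) by auto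
        moreover have "ext_deriv n (\<psi> t) x v = 0" for v
          using ext_deriv_cong_open[OF U(1), of x "\<psi> t" "\<lambda>_ _. 0" n v] van \<psi> that U(2)
          by (auto simp: test_form_iff ext_deriv_zero)
        ultimately show ?thesis
          using comass_zero[OF n] by (simp add: ext[of "ext_deriv n (\<psi> t) x" "\<lambda>_. 0"])
      qed
      then have "ereal (S (\<psi> t) - R (\<psi> t)) \<le> flat_norm n K (\<lambda>\<phi>. S \<phi> - R \<phi>)"
        unfolding flat_norm_def using \<psi> by (intro SUP_upper) auto
      then have "S (\<psi> t) - R (\<psi> t) < 1"
        using R(3) by (metis ereal_less_eq(3) less_ereal.simps(1) order_le_less_trans)
      moreover have "S (\<psi> t) = t * S \<phi>" "R (\<psi> t) = t * R \<phi>"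
      proof -
        have "S (\<psi> t) = t * S \<phi> + 0 * S \<phi>" "R (\<psi> t) = t * R \<phi> + 0 * R \<phi>"
          using lS R(1) \<phi> unfolding linear_functional_def \<psi>_def by blast+
        then show "S (\<psi> t) = t * S \<phi>" "R (\<psi> t) = t * R \<phi>" by simp_all
      qed
      ultimately show ?thesis using R0 by simp
    qed
    \<comment> \<open>Otherwise t = 1 / S(\<phi>) would give 1 < 1.\<close>
    show "S \<phi> = 0"
      using lt[of "1 / S \<phi>"] by (cases "S \<phi> = 0") auto
  qed
qed

text \<open>The radius \<open>r0\<close> depends on \<open>S\<close> alone. So it can be enlarged to
  cover further sets before a cutoff is chosen, and it serves all closed forms at once.\<close>

lemma flat_cycle_closed_form:
  fixes S :: "(real ^ 'n) functional"
  assumes n: "n \<ge> 1" and S: "real_flat_chain n S" "is_cycle n S"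
  shows "\<exists>r0. \<forall>\<omega> \<kappa> r. smooth_form n \<omega> \<longrightarrow> (\<forall>x v. ext_deriv n \<omega> x v = 0) \<longrightarrow> r \<ge> r0 \<longrightarrow> smooth \<kappa> \<longrightarrow>
    (\<forall>x. norm x \<le> r \<longrightarrow> \<kappa> x = 1) \<longrightarrow> (\<forall>x. norm x \<ge> r + 3 \<longrightarrow> \<kappa> x = 0) \<longrightarrow>
    S (\<lambda>x v. \<kappa> x * \<omega> x v) = 0"
proof -
  obtain k where k: "n = Suc k"
    using n by (cases n) auto
  obtain K where K: "compact K"
    "\<forall>\<phi> U. test_form n \<phi> \<longrightarrow> open U \<longrightarrow> K \<subseteq> U \<longrightarrow> (\<forall>x\<in>U. \<forall>v. \<phi> x v = 0) \<longrightarrow> S \<phi> = 0"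
    using flat_chain_local[OF n S(1)] by blast
  obtain r0 where r0: "K \<subseteq> ball 0 r0"
    using compact_imp_bounded[OF K(1)] bounded_subset_ballD by blast
  show ?thesis
  proof (intro exI[of _ r0] allI impI)
    fix \<omega> :: "(real ^ 'n) form" and \<kappa> :: "real ^ 'n \<Rightarrow> real" and r
    assume \<omega>: "smooth_form n \<omega>" "\<forall>x v. ext_deriv n \<omega> x v = 0" and r: "r \<ge> r0" and \<kappa>: "smooth \<kappa>"
      and "\<forall>x. norm x \<le> r \<longrightarrow> \<kappa> x = 1" "\<forall>x. norm x \<ge> r + 3 \<longrightarrow> \<kappa> x = 0"
    then have \<kappa>1: "\<And>x. norm x \<le> r \<Longrightarrow> \<kappa> x = 1" and \<kappa>0: "\<And>x. norm x \<ge> r + 3 \<Longrightarrow> \<kappa> x = 0"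
      by blast+
    let ?\<eta> = "\<lambda>x v. \<kappa> x * cone_form k \<omega> x v"
    let ?\<phi> = "\<lambda>x v. \<kappa> x * \<omega> x v"
    have sc: "smooth_form k (cone_form k \<omega>)"
      using smooth_cone_form \<omega>(1) unfolding k by blast
    have s\<eta>: "smooth_form k ?\<eta>"
      by (rule smooth_form_scale[OF \<kappa> sc])
    have t\<eta>: "test_form k ?\<eta>"
      unfolding test_form_iff using s\<eta> \<kappa>0 by (intro conjI exI[of _ "r + 3"]) auto
    have t\<phi>: "test_form n ?\<phi>"
      unfolding test_form_iff using smooth_form_scale[OF \<kappa> \<omega>(1)] \<kappa>0
      by (intro conjI exI[of _ "r + 3"]) auto
    have td: "test_form n (ext_deriv k ?\<eta>)"
      unfolding test_form_iff
    proof (intro conjI exI[of _ "r + 3"] allI impI ext)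
      show "smooth_form n (ext_deriv k ?\<eta>)"
        using smooth_form_ext_deriv[OF s\<eta>] by (simp add: k)
      show "ext_deriv k ?\<eta> x v = 0" if "r + 3 < norm x" for x v
        using ext_deriv_cong_open[of "- cball 0 (r + 3)" x ?\<eta> "\<lambda>_ _. 0" k v] s\<eta> \<kappa>0 that
        by (auto simp: ext_deriv_zero)
    qed
    have "S (\<lambda>x v. 1 * ?\<phi> x v + (- 1) * ext_deriv k ?\<eta> x v) = 0"
    proof (rule K(2)[rule_format, of _ "ball 0 r"])
      show "test_form n (\<lambda>x v. 1 * ?\<phi> x v + (- 1) * ext_deriv k ?\<eta> x v)"
        by (rule test_form_lincomb[OF t\<phi> td])
      show "K \<subseteq> ball 0 r" using r0 r by auto
      fix x :: "real ^ 'n" and v assume x: "x \<in> ball 0 r"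
      have "ext_deriv k ?\<eta> x v = ext_deriv k (cone_form k \<omega>) x v"
        by (rule ext_deriv_cong_open[OF open_ball x _ s\<eta>]) (simp add: \<kappa>1)
      also have "\<dots> = \<omega> x v"
        by (rule ext_deriv_cone_form) (use \<omega> k in auto)
      finally show "1 * ?\<phi> x v + (- 1) * ext_deriv k ?\<eta> x v = 0"
        using x \<kappa>1[of x] by simp
    qed simp
    also have "S (\<lambda>x v. 1 * ?\<phi> x v + (- 1) * ext_deriv k ?\<eta> x v) = 1 * S ?\<phi> + (- 1) * S (ext_deriv k ?\<eta>)"
      using S(1) t\<phi> td unfolding real_flat_chain_def linear_functional_def by blast
    also have "S (ext_deriv k ?\<eta>) = 0"
      using S(2) t\<eta> unfolding is_cycle_def boundary_def k by simp
    finally show "S ?\<phi> = 0" by simp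
  qed
qed

text \<open>\<omega> need not have compact support, whereas \<open>mass\<close> tests with compactly
  supported forms. As only values over \<open>K\<close> count for \<open>T\<close>, it does not
  distinguish \<omega> from its cutoff, a test form of comass at most 1 on which \<open>S\<close>
  vanishes.\<close>

lemma mass_sum_ge:
  fixes S T :: "(real ^ 'n) functional" and \<omega> :: "(real ^ 'n) form"
  assumes n: "n \<ge> 1" and S: "real_flat_chain n S" "is_cycle n S"
    and \<omega>: "smooth_form n \<omega>" "\<And>x v. ext_deriv n \<omega> x v = 0" "\<And>x v. orthonormal_frame n v \<Longrightarrow> \<bar>\<omega> x v\<bar> \<le> 1"
    and K: "compact K" and T: "\<And>\<phi> \<psi>. (\<And>x v. x \<in> K \<Longrightarrow> \<phi> x v = \<psi> x v) \<Longrightarrow> T \<phi> = T \<psi>"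
  shows "ereal (T \<omega>) \<le> mass n (\<lambda>\<phi>. T \<phi> + S \<phi>)"
proof -
  obtain r0 where r0: "\<forall>\<omega> \<kappa> r. smooth_form n \<omega> \<longrightarrow> (\<forall>x v. ext_deriv n \<omega> x v = 0) \<longrightarrow> r \<ge> r0 \<longrightarrow> smooth \<kappa> \<longrightarrow>
    (\<forall>x. norm x \<le> r \<longrightarrow> \<kappa> x = 1) \<longrightarrow> (\<forall>x. norm x \<ge> r + 3 \<longrightarrow> \<kappa> x = 0) \<longrightarrow>
    S (\<lambda>x v. \<kappa> x * \<omega> x v) = 0"
    using flat_cycle_closed_form[OF n S] by blast
  obtain r1 where r1: "K \<subseteq> ball 0 r1"
    using compact_imp_bounded[OF K] bounded_subset_ballD by blast
  define r where "r = max r0 r1"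
  obtain \<kappa> :: "real ^ 'n \<Rightarrow> real" where \<kappa>: "smooth \<kappa>" "\<And>x. 0 \<le> \<kappa> x \<and> \<kappa> x \<le> 1"
    "\<And>x. norm x \<le> r \<Longrightarrow> \<kappa> x = 1" "\<And>x. norm x \<ge> r + 3 \<Longrightarrow> \<kappa> x = 0"
    using cutoff_exists[of r] by metis
  let ?\<phi> = "\<lambda>x v. \<kappa> x * \<omega> x v"
  have "S ?\<phi> = 0"
    by (rule r0[rule_format, of \<omega> r]) (use \<omega> \<kappa> in \<open>auto simp: r_def\<close>)
  moreover have "T ?\<phi> = T \<omega>"
    using r1 \<kappa>(3) by (intro T) (force simp: r_def subset_iff)
  moreover have "ereal (T ?\<phi> + S ?\<phi>) \<le> mass n (\<lambda>\<phi>. T \<phi> + S \<phi>)"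
    unfolding mass_def
  proof (rule SUP_upper, safe)
    show "test_form n ?\<phi>"
      unfolding test_form_iff using smooth_form_scale[OF \<kappa>(1) \<omega>(1)] \<kappa>(4)
      by (intro conjI exI[of _ "r + 3"]) auto
    show "comass n (?\<phi> x) \<le> 1" for x
      using \<kappa>(2)[of x] \<omega>(3)
      by (intro comass_le[OF n]) (simp add: abs_mult mult_le_one)
  qed
  ultimately show ?thesis by simp
qed

end

subsection \<open>Hausdorff measure of level sets\<close>

text \<open>Countable additivity need not be checked here: if it failed, \<^const>\<open>measure_of\<close> would return the
  zero measure.\<close>

lemma emeasure_hausdorff_le: "emeasure (hausdorff_measure k) A \<le> hausdorff_outer k A"
  unfolding hausdorff_measure_def emeasure_measure_of_conv by simp

lemma sets_hausdorff_measure [simp, measurable_cong]: "sets (hausdorff_measure k) = sets borel"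
  unfolding hausdorff_measure_def
  by (metis sets.sigma_sets_eq sets_measure_of space_borel top_greatest sets.space_closed)

lemma hausdorff_content_le_card:
  fixes A :: "'a::euclidean_space set"
  assumes I: "finite I" and cover: "A \<subseteq> (\<Union>i\<in>I. C i)"
    and diam: "\<And>i x y. i \<in> I \<Longrightarrow> x \<in> C i \<Longrightarrow> y \<in> C i \<Longrightarrow> dist x y \<le> d"
    and d: "0 \<le> d" "d \<le> \<delta>"
  shows "hausdorff_content k \<delta> A \<le> ennreal (real (card I) * (unit_ball_vol (real k) * (d / 2) ^ k))"
proof -
  obtain e where e: "bij_betw e {..<card I} I"
    using I by (metis bij_betw_from_nat_into_finite)
  \<comment> \<open>The finite cover is padded to a sequence by empty sets, to which
    \<open>hausdorff_weight\<close> assigns 0 also for \<open>k = 0\<close>.\<close>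
  define B where "B j = (if j < card I then C (e j) else {})" for j
  have eI: "e j \<in> I" if "j < card I" for j
    using e that unfolding bij_betw_def by auto
  have dist: "dist x y \<le> d" if "x \<in> B j" "y \<in> B j" for x y j
    using that diam eI unfolding B_def by (auto split: if_splits)
  have diamB: "diameter (B j) \<le> d" for j
    by (rule diameter_le) (use dist d in \<open>auto simp: dist_norm[symmetric]\<close>)
  have bddB: "bounded (B j)" for j
    unfolding bounded_def using dist by blast
  have "A \<subseteq> (\<Union>j. B j)"
  proof
    fix x assume "x \<in> A"
    then obtain i where "i \<in> I" "x \<in> C i" using cover by blast
    moreover from this obtain j where "j < card I" "i = e j"
      using e unfolding bij_betw_def by auto
    ultimately have "x \<in> B j" by (simp add: B_def)
    then show "x \<in> (\<Union>j. B j)" by blast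
  qed
  then have "hausdorff_content k \<delta> A \<le> (\<Sum>j. hausdorff_weight k (B j))"
    unfolding hausdorff_content_def using bddB diamB d(2)
    by (intro INF_lower) (auto intro: order_trans)
  also have "\<dots> = (\<Sum>j<card I. hausdorff_weight k (B j))"
    by (rule suminf_finite) (auto simp: B_def hausdorff_weight_def)
  also have "\<dots> \<le> (\<Sum>j<card I. ennreal (unit_ball_vol (real k) * (d / 2) ^ k))"
  proof (rule sum_mono)
    fix j
    have "unit_ball_vol (real k) * (diameter (B j) / 2) ^ k \<le> unit_ball_vol (real k) * (d / 2) ^ k"
      using diameter_ge_0[OF bddB] diamB[of j]
      by (intro mult_left_mono power_mono) (auto simp: less_imp_le)
    then show "hausdorff_weight k (B j) \<le> ennreal (unit_ball_vol (real k) * (d / 2) ^ k)"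
      unfolding hausdorff_weight_def by (auto intro: ennreal_leI)
  qed
  also have "\<dots> = ennreal (real (card I) * (unit_ball_vol (real k) * (d / 2) ^ k))"
    using d(1) by (simp add: ennreal_mult' ennreal_of_nat_eq_real_of_nat)
  finally show ?thesis .
qed

text \<open>Points of \<open>A\<close> are sorted by their coordinates in \<open>J\<close> into cubes of a grid, of which there are
  of the order of \<open>P\<^sup>k\<close>; the cubes cut \<open>A\<close> into pieces of diameter of the order of \<open>1/P\<close>.\<close>

lemma hausdorff_outer_lipschitz_graph_finite:
  fixes A :: "'a::euclidean_space set"
  assumes J: "J \<subseteq> Basis" "card J = k" and r: "r > 0" "A \<subseteq> cball x0 r" and L: "L \<ge> 0"
    and graph: "\<And>y z. y \<in> A \<Longrightarrow> z \<in> A \<Longrightarrow> dist y z \<le> L * (\<Sum>j\<in>J. \<bar>(y - z) \<bullet> j\<bar>)"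
  shows "hausdorff_outer k A < \<infinity>"
proof -
  have fJ: "finite J" using J(1) finite_Basis finite_subset by blast
  \<comment> \<open>There are (P + 1)^k cubes and each piece weighs at most
    \<open>unit_ball_vol (real k) * (d / 2) ^ k\<close>. Since P + 1 is at most 2 P and P d = 2 L k
    r, the product is bounded independently of P.\<close>
  define M where "M = unit_ball_vol (real k) * (2 * L * real k * r) ^ k"
  have "hausdorff_content k \<delta> A \<le> ennreal M" if "\<delta> > 0" for \<delta>
  proof -
    \<comment> \<open>Fine enough that the bound \<open>d\<close> for the diameter of a piece does
      not exceed \<delta>.\<close>
    obtain P0 :: nat where P0: "real P0 > L * real k * (2 * r) / \<delta>"
      using reals_Archimedean2 by blast
    define P where "P = Suc P0"
    define d where "d = L * (real k * (2 * r / real P))"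
    have P: "real P > 0" "real P > L * real k * (2 * r) / \<delta>"
      using P0 by (auto simp: P_def)
    have d: "0 \<le> d" "d \<le> \<delta>"
      using L r P that by (auto simp: d_def field_simps)
    \<comment> \<open>The cube of \<open>y\<close>: each coordinate in \<open>J\<close> is rescaled
      from [-r, r] to [0, P] and rounded down. The value P occurs only on the far face, whence P + 1
      values per coordinate.\<close>
    define h where "h y = (\<lambda>j\<in>J. nat \<lfloor>((y - x0) \<bullet> j + r) * real P / (2 * r)\<rfloor>)" for y
    define I where "I = (\<Pi>\<^sub>E j\<in>J. {..P})"
    define C where "C i = {y \<in> A. h y = i}" for i
    have bd: "0 \<le> ((y - x0) \<bullet> j + r) * real P / (2 * r) \<and> ((y - x0) \<bullet> j + r) * real P / (2 * r) \<le> real P"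
      if "y \<in> A" "j \<in> J" for y j
    proof -
      have "\<bar>(y - x0) \<bullet> j\<bar> \<le> norm (y - x0)"
        using J(1) that(2) by (intro Basis_le_norm) auto
      also have "\<dots> \<le> r"
        using r(2) that(1) by (auto simp: dist_norm norm_minus_commute)
      finally have "0 \<le> (y - x0) \<bullet> j + r" "(y - x0) \<bullet> j + r \<le> 2 * r" by auto
      moreover from this have "((y - x0) \<bullet> j + r) * real P \<le> 2 * r * real P"
        by (intro mult_right_mono) auto
      ultimately show ?thesis
        using r(1) by (simp add: pos_divide_le_eq mult.commute)
    qed
    have "h y \<in> I" if "y \<in> A" for y
      unfolding h_def I_def using bd[OF that] by (auto simp: nat_le_iff floor_le_iff) (smt (verit))
    then have cover: "A \<subseteq> (\<Union>i\<in>I. C i)"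
      by (auto simp: C_def)
    have fin: "finite I" unfolding I_def using fJ by (intro finite_PiE) auto
    have cardI: "card I = (P + 1) ^ k"
      unfolding I_def using fJ J(2) by (simp add: card_PiE)
    have "dist y z \<le> d" if "y \<in> C i" "z \<in> C i" for y z i
    proof -
      have yz: "y \<in> A" "z \<in> A" "h y = h z" using that by (auto simp: C_def)
      have "\<bar>(y - z) \<bullet> j\<bar> \<le> 2 * r / real P" if j: "j \<in> J" for j
      proof -
        let ?u = "((y - x0) \<bullet> j + r) * real P / (2 * r)" and ?w = "((z - x0) \<bullet> j + r) * real P / (2 * r)"
        have "nat \<lfloor>?u\<rfloor> = nat \<lfloor>?w\<rfloor>"
          using fun_cong[OF yz(3), of j] j by (simp add: h_def)
        then have "\<lfloor>?u\<rfloor> = \<lfloor>?w\<rfloor>"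
          using bd[OF yz(1) j] bd[OF yz(2) j] by (simp add: eq_nat_nat_iff)
        then have "\<bar>?u - ?w\<bar> \<le> 1" by linarith
        moreover have "?u - ?w = ((y - z) \<bullet> j) * (real P / (2 * r))"
          by (simp add: inner_diff_left diff_divide_distrib[symmetric] algebra_simps)
        ultimately have "\<bar>(y - z) \<bullet> j\<bar> * (real P / (2 * r)) \<le> 1"
          using P(1) r(1) by (simp add: abs_mult)
        then show ?thesis using P(1) r(1) by (simp add: field_simps)
      qed
      then have "(\<Sum>j\<in>J. \<bar>(y - z) \<bullet> j\<bar>) \<le> real k * (2 * r / real P)"
        using sum_bounded_above[of J "\<lambda>j. \<bar>(y - z) \<bullet> j\<bar>" "2 * r / real P"] J(2) by simp
      then show ?thesis
        using graph[OF yz(1,2)] mult_left_mono[OF _ L] unfolding d_def by (blast intro: order_trans)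
    qed
    then have "hausdorff_content k \<delta> A \<le> ennreal (real (card I) * (unit_ball_vol (real k) * (d / 2) ^ k))"
      by (rule hausdorff_content_le_card[OF fin cover _ d])
    also have "\<dots> \<le> ennreal M"
    proof (rule ennreal_leI)
      have "real (card I) * (d / 2) ^ k = ((real P + 1) * (d / 2)) ^ k"
        unfolding power_mult_distrib by (simp add: cardI add.commute)
      also have "\<dots> \<le> (2 * L * real k * r) ^ k"
      proof (rule power_mono)
        have "(real P + 1) * (d / 2) \<le> (2 * real P) * (d / 2)"
          using d(1) by (intro mult_right_mono) (auto simp: P_def)
        also have "\<dots> = 2 * L * real k * r"
          using P(1) by (simp add: d_def field_simps)
        finally show "(real P + 1) * (d / 2) \<le> 2 * L * real k * r" .
      qed (use d(1) in simp)
      finally show "real (card I) * (unit_ball_vol (real k) * (d / 2) ^ k) \<le> M"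
        unfolding M_def using mult_left_mono[of _ _ "unit_ball_vol (real k)"]
        by (simp add: mult.left_commute)
    qed
    finally show ?thesis .
  qed
  then have "hausdorff_outer k A \<le> ennreal M"
    unfolding hausdorff_outer_def by (intro SUP_least) auto
  also have "\<dots> < \<infinity>" by simp
  finally show ?thesis .
qed

text \<open>A quantitative implicit function theorem: near \<open>x0\<close> the derivative along
  some basis vector \<open>b\<close> stays away from 0. The mean value theorem on the segment
  between two points of the level set, which stays in the convex ball, then bounds their difference
  along \<open>b\<close> by the differences in the other k coordinates.\<close>

lemma hausdorff_outer_level_set_locally_finite:
  fixes f :: "'a::euclidean_space \<Rightarrow> real"
  assumes f: "C_diff 1 UNIV f" and crit: "gradient f x0 \<noteq> 0" and dim: "DIM('a) = Suc k"
  shows "\<exists>r>0. hausdorff_outer k ({x. f x = l} \<inter> cball x0 r) < \<infinity>"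
proof -
  have f': "C_diff (Suc 0) UNIV f" using f by simp
  obtain b where b: "b \<in> Basis" "gradient f x0 \<bullet> b \<noteq> 0"
    using crit by (auto simp: euclidean_eq_iff[of "gradient f x0" 0])
  \<comment> \<open>If the gradient varies by less than \<open>m\<close>, half of its component
    along \<open>b\<close>, then this component stays at least \<open>m\<close> in absolute value,
    and the norm stays at most \<open>M\<close>.\<close>
  define m where "m = \<bar>gradient f x0 \<bullet> b\<bar> / 2"
  define M where "M = norm (gradient f x0) + m"
  have m: "m > 0" using b by (simp add: m_def)
  have M: "M \<ge> 0" using m by (simp add: M_def)
  have "isCont (gradient f) x0"
    using C_diff_gradient(2)[OF f'] by (simp add: continuous_on_eq_continuous_at)
  then obtain r' where r': "r' > 0" "\<And>x. dist x x0 < r' \<Longrightarrow> dist (gradient f x) (gradient f x0) < m"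
    using m unfolding continuous_at_eps_delta by blast
  define r where "r = r' / 2"
  have r: "r > 0" using r' by (simp add: r_def)
  define J where "J = Basis - {b}"
  have J: "J \<subseteq> Basis" "card J = k"
    using b dim by (auto simp: J_def)
  have fJ: "finite J" by (simp add: J_def)
  \<comment> \<open>\<open>M / m\<close> bounds the coordinate along \<open>b\<close> by the other
    ones, and 1 accounts for these themselves in the l1 bound of the norm.\<close>
  define L where "L = M / m + 1"
  have L: "L \<ge> 0" using m M by (simp add: L_def)
  have grad: "m \<le> \<bar>gradient f x \<bullet> b\<bar> \<and> norm (gradient f x) \<le> M" if "x \<in> cball x0 r" for x
  proof -
    have n: "norm (gradient f x - gradient f x0) < m"
      using that r r'(2)[of x] by (simp add: r_def dist_commute dist_norm norm_minus_commute)
    have "\<bar>(gradient f x - gradient f x0) \<bullet> b\<bar> \<le> norm (gradient f x - gradient f x0)"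
      using b(1) by (rule Basis_le_norm)
    then have "m \<le> \<bar>gradient f x \<bullet> b\<bar>"
      using n by (simp add: m_def inner_diff_left abs_if split: if_splits)
    moreover have "norm (gradient f x) \<le> M"
      using n norm_triangle_sub[of "gradient f x" "gradient f x0"] by (simp add: M_def)
    ultimately show ?thesis by blast
  qed
  have "hausdorff_outer k ({x. f x = l} \<inter> cball x0 r) < \<infinity>"
  proof (rule hausdorff_outer_lipschitz_graph_finite[OF J r _ L])
    fix y z assume "y \<in> {x. f x = l} \<inter> cball x0 r" "z \<in> {x. f x = l} \<inter> cball x0 r"
    then have yz: "f y = f z" "y \<in> cball x0 r" "z \<in> cball x0 r" by auto
    define w where "w = y - z"
    have der: "((\<lambda>t. f (z + t *\<^sub>R w)) has_derivative (\<lambda>s. gradient f (z + t *\<^sub>R w) \<bullet> (s *\<^sub>R w))) (at t within {0..1})" for t :: real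
    proof -
      have "((\<lambda>t. z + t *\<^sub>R w) has_derivative (\<lambda>s. s *\<^sub>R w)) (at t within {0..1})"
        by (auto intro!: derivative_eq_intros)
      from has_derivative_compose[OF this C_diff_gradient(1)[OF f']] show ?thesis .
    qed
    obtain t where t: "t \<in> {0<..<1}"
      "f (z + 1 *\<^sub>R w) - f (z + 0 *\<^sub>R w) = gradient f (z + t *\<^sub>R w) \<bullet> ((1 - 0) *\<^sub>R w)"
      using mvt_simple[of 0 1, OF _ der] by auto
    define g where "g = gradient f (z + t *\<^sub>R w)"
    have "z + t *\<^sub>R w = (1 - t) *\<^sub>R z + t *\<^sub>R y"
      by (simp add: w_def algebra_simps)
    then have "z + t *\<^sub>R w \<in> cball x0 r"
      using convexD_alt[OF convex_cball yz(3,2), of t] t(1) by simp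
    from grad[OF this] have g: "m \<le> \<bar>g \<bullet> b\<bar>" "norm g \<le> M" by (auto simp: g_def)
    have "0 = g \<bullet> w"
      using t(2) yz(1) by (simp add: g_def w_def)
    also have "\<dots> = (g \<bullet> b) * (w \<bullet> b) + (\<Sum>j\<in>J. (g \<bullet> j) * (w \<bullet> j))"
      unfolding J_def using b(1) by (subst euclidean_inner) (simp add: sum.remove[of _ b])
    finally have "\<bar>g \<bullet> b\<bar> * \<bar>w \<bullet> b\<bar> = \<bar>\<Sum>j\<in>J. (g \<bullet> j) * (w \<bullet> j)\<bar>"
      by (simp add: abs_mult[symmetric] eq_neg_iff_add_eq_0[symmetric])
    also have "\<dots> \<le> (\<Sum>j\<in>J. \<bar>(g \<bullet> j) * (w \<bullet> j)\<bar>)" by (rule sum_abs)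
    also have "\<dots> \<le> (\<Sum>j\<in>J. M * \<bar>w \<bullet> j\<bar>)"
    proof (rule sum_mono)
      fix j assume "j \<in> J"
      then have "\<bar>g \<bullet> j\<bar> \<le> M"
        using Basis_le_norm[of j g] J(1) g(2) by force
      then show "\<bar>(g \<bullet> j) * (w \<bullet> j)\<bar> \<le> M * \<bar>w \<bullet> j\<bar>"
        by (simp add: abs_mult mult_right_mono)
    qed
    finally have "\<bar>g \<bullet> b\<bar> * \<bar>w \<bullet> b\<bar> \<le> M * (\<Sum>j\<in>J. \<bar>w \<bullet> j\<bar>)"
      by (simp add: sum_distrib_left)
    then have "m * \<bar>w \<bullet> b\<bar> \<le> M * (\<Sum>j\<in>J. \<bar>w \<bullet> j\<bar>)"
      using mult_right_mono[OF g(1), of "\<bar>w \<bullet> b\<bar>"] by simp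
    then have "\<bar>w \<bullet> b\<bar> \<le> M / m * (\<Sum>j\<in>J. \<bar>w \<bullet> j\<bar>)"
      using m by (simp add: field_simps)
    moreover have "norm w \<le> \<bar>w \<bullet> b\<bar> + (\<Sum>j\<in>J. \<bar>w \<bullet> j\<bar>)"
      using norm_le_l1[of w] b(1) unfolding J_def by (simp add: sum.remove[of _ b])
    ultimately show "dist y z \<le> L * (\<Sum>j\<in>J. \<bar>(y - z) \<bullet> j\<bar>)"
      by (simp add: dist_norm w_def L_def distrib_right)
  qed auto
  then show ?thesis using r by blast
qed

lemma hausdorff_measure_level_set_finite:
  fixes f :: "'a::euclidean_space \<Rightarrow> real"
  assumes f: "C_diff 1 UNIV f" and crit: "\<And>x. gradient f x \<noteq> 0" and dim: "DIM('a) = Suc k" and K: "compact K"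
  shows "emeasure (hausdorff_measure k) ({x. f x = l} \<inter> K) < \<infinity>"
proof -
  let ?W = "{x. f x = l}"
  have W: "closed ?W"
    using continuous_closed_preimage_constant[of UNIV f l] C_diff_continuous[OF f] by simp
  obtain r where r: "\<And>x. r x > 0" "\<And>x. hausdorff_outer k (?W \<inter> cball x (r x)) < \<infinity>"
    using hausdorff_outer_level_set_locally_finite[OF f crit dim] by metis
  have cov: "K \<subseteq> (\<Union>x\<in>K. ball x (r x))"
    using r(1) centre_in_ball by blast
  obtain T where T: "T \<subseteq> K" "finite T" "K \<subseteq> (\<Union>x\<in>T. ball x (r x))"
    by (rule compactE_image[OF K _ cov]) auto
  have "emeasure (hausdorff_measure k) (?W \<inter> K) \<le> emeasure (hausdorff_measure k) (\<Union>x\<in>T. ?W \<inter> cball x (r x))"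
  proof (rule emeasure_mono)
    show "?W \<inter> K \<subseteq> (\<Union>x\<in>T. ?W \<inter> cball x (r x))"
      using T(3) ball_subset_cball by blast
    show "(\<Union>x\<in>T. ?W \<inter> cball x (r x)) \<in> sets (hausdorff_measure k)"
      using W T(2) by (auto intro!: borel_closed closed_UN closed_Int)
  qed
  also have "\<dots> \<le> (\<Sum>x\<in>T. emeasure (hausdorff_measure k) (?W \<inter> cball x (r x)))"
    using W T(2) by (intro emeasure_subadditive_finite) (auto intro!: borel_closed closed_Int)
  also have "\<dots> < \<infinity>"
    using r(2) T(2) by (simp add: order.strict_trans1[OF emeasure_hausdorff_le])
  finally show ?thesis .
qed

subsection \<open>Unit gradients of constant divergence\<close>

lemma C_diff_1_inverse_sqrt:
  fixes h :: "'a::euclidean_space \<Rightarrow> real"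
  assumes h: "C_diff 1 UNIV h" and pos: "\<And>x. h x > 0"
  shows "C_diff 1 UNIV (\<lambda>x. inverse (sqrt (h x)))"
proof (rule C_diff_1I)
  have h': "C_diff (Suc 0) UNIV h" using h by simp
  show "((\<lambda>x. inverse (sqrt (h x))) has_derivative (\<lambda>v. - (inverse (2 * sqrt (h x) * h x) * D h x v))) (at x)" for x
  proof -
    have "((\<lambda>t. inverse (sqrt t)) has_real_derivative - inverse (2 * sqrt (h x) * h x)) (at (h x))"
      using pos[of x] by (auto intro!: derivative_eq_intros simp: field_simps)
    from has_derivative_compose[OF C_diff_Suc_has_derivative[OF h'] this[unfolded has_field_derivative_def]]
    show ?thesis by simp
  qed
  have "2 * sqrt (h x) * h x \<noteq> 0" for x
    using pos[of x] by simp
  then show "continuous_on UNIV (\<lambda>x. - (inverse (2 * sqrt (h x) * h x) * D h x v))" for v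
    by (intro continuous_intros C_diff_continuous[OF h] C_diff_continuous[OF C_diff_Suc_derivative[OF h']]) auto
qed

text \<open>The closure rules for \<open>C_diff\<close> concern real functions, so the field is
  treated by components: each is a partial derivative times \<open>inverse (sqrt (h x))\<close>,
  where \<open>h\<close>, the squared norm of the gradient, is a positive sum of squares of partial
  derivatives.\<close>

lemma unit_gradient_regular:
  fixes f :: "'a::euclidean_space \<Rightarrow> real"
  assumes f: "C_diff 2 UNIV f" and crit: "\<And>x. gradient f x \<noteq> 0"
  shows "C_diff 1 UNIV (\<lambda>x. unit_gradient f x \<bullet> b)" "norm (unit_gradient f x) = 1"
    "unit_gradient f differentiable (at x)"
proof -
  have f': "C_diff (Suc 1) UNIV f" using f by (simp add: numeral_2_eq_2)
  define h where "h x = (\<Sum>b\<in>Basis. D f x b * D f x b)" for x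
  have h: "h x = (norm (gradient f x))\<^sup>2" for x
    unfolding power2_norm_eq_inner
    by (subst euclidean_inner) (simp add: h_def C_diff_gradient(3)[OF f'])
  have "C_diff 1 UNIV h"
    unfolding h_def by (intro C_diff_sum C_diff_mult C_diff_Suc_derivative[OF f'])
  then have q: "C_diff 1 UNIV (\<lambda>x. inverse (sqrt (h x)))"
    by (rule C_diff_1_inverse_sqrt) (simp add: h crit)
  have eq: "unit_gradient f x \<bullet> b = inverse (sqrt (h x)) * D f x b" for x b
    by (simp add: unit_gradient_def h C_diff_gradient(3)[OF f'])
  show *: "C_diff 1 UNIV (\<lambda>x. unit_gradient f x \<bullet> b)" for b
    unfolding eq by (intro C_diff_mult q C_diff_Suc_derivative[OF f'])
  show "norm (unit_gradient f x) = 1"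
    using crit by (simp add: unit_gradient_def)
  have "((\<lambda>x. unit_gradient f x \<bullet> b) has_derivative D (\<lambda>x. unit_gradient f x \<bullet> b) x) (at x)" for b
    by (rule C_diff_Suc_has_derivative[of 0]) (use * in simp)
  then have "((\<lambda>x. \<Sum>b\<in>Basis. (unit_gradient f x \<bullet> b) *\<^sub>R b) has_derivative
      (\<lambda>v. \<Sum>b\<in>Basis. D (\<lambda>x. unit_gradient f x \<bullet> b) x v *\<^sub>R b)) (at x)"
    by (intro has_derivative_sum has_derivative_scaleR_left)
  then show "unit_gradient f differentiable (at x)"
    unfolding euclidean_representation by (rule differentiableI)
qed

text \<open>Testing \<open>div X = c\<close> with the dilations of a bump function: the divergence of \<open>z \<mapsto> X (R z)\<close> is
  \<open>R c\<close>, while its integral against the bump is bounded independently of \<open>R\<close>.\<close>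

lemma constant_divergence_eq_0:
  fixes X :: "'a::euclidean_space \<Rightarrow> 'a"
  assumes X: "\<And>b. C_diff 1 UNIV (\<lambda>x. X x \<bullet> b)" "\<And>x. X differentiable (at x)" "\<And>x. norm (X x) \<le> 1"
    and div: "\<And>x. divergence X x = c" and c: "c \<ge> 0"
  shows "c = 0"
proof -
  obtain \<rho> :: "'a \<Rightarrow> real" where \<rho>: "smooth \<rho>" "\<And>x. \<rho> x \<ge> 0" "\<And>x. norm x \<ge> 1 \<Longrightarrow> \<rho> x = 0" "\<rho> 0 > 0"
    using smooth_bump_exists[of 1] by (metis zero_less_one)
  have c\<rho>: "continuous_on UNIV \<rho>" and cD\<rho>: "\<And>v. continuous_on UNIV (\<lambda>z. D \<rho> z v)"
    using \<rho>(1) by (auto intro: smooth_continuous smooth_derivative)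
  have s\<rho>: "\<rho> z = 0" "D \<rho> z v = 0" if "norm z > 1" for z v
    using that \<rho>(3) by (auto intro: D_eq_0_outside[of 1])
  define I where "I = integral UNIV \<rho>"
  have I: "I > 0"
    unfolding I_def by (rule integral_bump_pos[OF c\<rho> \<rho>(2) s\<rho>(1) \<rho>(4)]) auto
  define M where "M = integral UNIV (\<lambda>z. \<Sum>b\<in>Basis. \<bar>D \<rho> z b\<bar>)"
  have X': "C_diff (Suc 0) UNIV (\<lambda>x. X x \<bullet> b)" for b using X(1) by simp
  have bound: "R * c * I \<le> M" for R
  proof -
    \<comment> \<open>The pairing of the gradient of \<rho> with X(R z). As |X| is at most 1, it is
      bounded by the integrand of \<open>M\<close> for every \<open>R\<close>.\<close>
    define E where "E z = (\<Sum>b\<in>Basis. D \<rho> z b * (X (R *\<^sub>R z) \<bullet> b))" for z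
    have sub: "((\<lambda>z. X (R *\<^sub>R z) \<bullet> b) has_derivative (\<lambda>v. D (\<lambda>x. X x \<bullet> b) (R *\<^sub>R z) (R *\<^sub>R v))) (at z)" for z b
    proof -
      have "((\<lambda>z. R *\<^sub>R z) has_derivative (\<lambda>v. R *\<^sub>R v)) (at z)"
        by (auto intro!: derivative_eq_intros)
      from has_derivative_compose[OF this C_diff_Suc_has_derivative[OF X']] show ?thesis .
    qed
    have cX: "continuous_on UNIV (\<lambda>z. X (R *\<^sub>R z) \<bullet> b)" for b
      by (rule continuous_on_compose2[OF C_diff_continuous[OF X(1)]]) (auto intro: continuous_intros)
    have "C_diff 1 UNIV (\<lambda>z. X (R *\<^sub>R z) \<bullet> b)" for b
      by (rule C_diff_1I[OF sub], rule continuous_on_compose2[OF C_diff_continuous[OF C_diff_Suc_derivative[OF X']]])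
         (auto intro: continuous_intros)
    then have u: "C_diff 1 UNIV (\<lambda>z. \<rho> z * (X (R *\<^sub>R z) \<bullet> b))" for b
      by (intro C_diff_mult smooth_C_diff[OF \<rho>(1)])
    have Du: "D (\<lambda>z. \<rho> z * (X (R *\<^sub>R z) \<bullet> b)) z b =
        \<rho> z * (R * D (\<lambda>x. X x \<bullet> b) (R *\<^sub>R z) b) + D \<rho> z b * (X (R *\<^sub>R z) \<bullet> b)" for z b
      using D_eqI[OF has_derivative_mult[OF smooth_has_derivative[OF \<rho>(1)] sub[of b z]], of b]
        linear_scale[OF has_derivative_linear[OF C_diff_Suc_has_derivative[OF X']], of b "R *\<^sub>R z" R b]
      by simp
    have divX: "(\<Sum>b\<in>Basis. D (\<lambda>x. X x \<bullet> b) x b) = c" for x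
    proof -
      have "D (\<lambda>x. X x \<bullet> b) x b = frechet_derivative X (at x) b \<bullet> b" for b
        using D_eqI[OF has_derivative_inner_left[OF frechet_derivative_works[THEN iffD1, OF X(2)]]] by simp
      then show ?thesis using div[of x] by (simp add: divergence_def)
    qed
    \<comment> \<open>The divergence of the compactly supported field \<rho>(z) X(R z) has integral
      0; by the product rule it equals R c \<rho>(z) + E(z).\<close>
    have "0 = (\<Sum>b\<in>Basis. integral UNIV (\<lambda>z. D (\<lambda>z. \<rho> z * (X (R *\<^sub>R z) \<bullet> b)) z b))"
      by (rule sum.neutral[symmetric], safe, rule integral_derivative_compact_support[OF u, of 1]) (simp add: s\<rho>)
    also have "\<dots> = integral UNIV (\<lambda>z. \<Sum>b\<in>Basis. D (\<lambda>z. \<rho> z * (X (R *\<^sub>R z) \<bullet> b)) z b)"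
    proof (rule integral_sum[symmetric])
      fix b :: 'a
      have "C_diff (Suc 0) UNIV (\<lambda>z. \<rho> z * (X (R *\<^sub>R z) \<bullet> b))" using u by simp
      then show "(\<lambda>z. D (\<lambda>z. \<rho> z * (X (R *\<^sub>R z) \<bullet> b)) z b) integrable_on UNIV"
        by (intro integral_ball_support(1)[of _ 1] C_diff_continuous[OF C_diff_Suc_derivative] D_eq_0_outside[of 1])
           (auto simp: s\<rho>)
    qed simp
    also have "\<dots> = integral UNIV (\<lambda>z. R * c * \<rho> z + E z)"
    proof (rule integral_cong)
      fix z
      have "(\<Sum>b\<in>Basis. D (\<lambda>z. \<rho> z * (X (R *\<^sub>R z) \<bullet> b)) z b) =
          R * \<rho> z * (\<Sum>b\<in>Basis. D (\<lambda>x. X x \<bullet> b) (R *\<^sub>R z) b) + E z"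
        unfolding Du E_def by (simp add: sum.distrib sum_distrib_left mult_ac)
      then show "(\<Sum>b\<in>Basis. D (\<lambda>z. \<rho> z * (X (R *\<^sub>R z) \<bullet> b)) z b) = R * c * \<rho> z + E z"
        by (simp add: divX)
    qed
    also have "\<dots> = R * c * I + integral UNIV E"
    proof -
      have iE: "E integrable_on UNIV"
        unfolding E_def[abs_def]
        by (rule integral_ball_support(1)[of _ 1]) (auto intro!: continuous_intros cD\<rho> cX simp: s\<rho>)
      have "(\<lambda>z. R * c * \<rho> z) integrable_on UNIV"
        by (rule integral_ball_support(1)[of _ 1]) (auto intro!: continuous_intros c\<rho> simp: s\<rho>)
      from integral_add[OF this iE] show ?thesis by (simp add: I_def)
    qed
    finally have "R * c * I = integral UNIV (\<lambda>z. - E z)" by simp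
    also have "\<dots> \<le> M"
      unfolding M_def
    proof (rule integral_le)
      show "(\<lambda>z. - E z) integrable_on UNIV"
        unfolding E_def[abs_def]
        by (rule integral_ball_support(1)[of _ 1]) (auto intro!: continuous_intros cD\<rho> cX simp: s\<rho>)
      show "(\<lambda>z. \<Sum>b\<in>Basis. \<bar>D \<rho> z b\<bar>) integrable_on UNIV"
        by (rule integral_ball_support(1)[of _ 1]) (auto intro!: continuous_intros cD\<rho> simp: s\<rho>)
      fix z
      show "- E z \<le> (\<Sum>b\<in>Basis. \<bar>D \<rho> z b\<bar>)"
        unfolding E_def sum_negf[symmetric]
      proof (rule sum_mono)
        fix b :: 'a assume "b \<in> Basis"
        then have "\<bar>X (R *\<^sub>R z) \<bullet> b\<bar> \<le> 1"
          using Basis_le_norm[of b "X (R *\<^sub>R z)"] X(3)[of "R *\<^sub>R z"] by simp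
        then have "\<bar>D \<rho> z b * (X (R *\<^sub>R z) \<bullet> b)\<bar> \<le> \<bar>D \<rho> z b\<bar>"
          by (simp add: abs_mult mult_left_le)
        then show "- (D \<rho> z b * (X (R *\<^sub>R z) \<bullet> b)) \<le> \<bar>D \<rho> z b\<bar>" by linarith
      qed
    qed
    finally show ?thesis .
  qed
  show ?thesis
  proof (rule ccontr)
    assume "c \<noteq> 0"
    then have "c > 0" using c by simp
    \<comment> \<open>For this \<open>R\<close> the bound would read M + 1 \<le> M.\<close>
    then show False
      using bound[of "(M + 1) / (c * I)"] I by simp
  qed
qed

text \<open>\<open>submanifold\<close> asks for defining functions with values in a subspace of the
  ambient space. The real function f - l is therefore multiplied by a basis vector \<open>e\<close>,
  and V is the line through \<open>e\<close>.\<close>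

lemma submanifold_level_set:
  fixes f :: "'a::euclidean_space \<Rightarrow> real"
  assumes f: "C_diff 1 UNIV f" and crit: "\<And>x. gradient f x \<noteq> 0" and dim: "DIM('a) = Suc k"
  shows "submanifold k {x. f x = l} (\<lambda>x. {v. gradient f x \<bullet> v = 0})"
proof -
  have f': "C_diff (Suc 0) UNIV f" using f by simp
  obtain e :: 'a where e: "e \<in> Basis" using nonempty_Basis by blast
  then have e0: "e \<noteq> 0" by auto
  define g where "g x = (f x - l) *\<^sub>R e" for x
  have "(g has_derivative (\<lambda>v. (gradient f x \<bullet> v) *\<^sub>R e)) (at x)" for x
    unfolding g_def by (auto intro!: derivative_eq_intros C_diff_gradient(1)[OF f'])
  then have dg: "frechet_derivative g (at x) = (\<lambda>v. (gradient f x \<bullet> v) *\<^sub>R e)" "g differentiable (at x)" for x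
    using frechet_derivative_at differentiableI by metis+
  have Cg: "C_diff 1 UNIV g"
    using dg(2) C_diff_gradient(2)[OF f'] by (auto simp: C_diff.simps dg(1) intro!: continuous_intros)
  have range: "range (\<lambda>v. (gradient f x \<bullet> v) *\<^sub>R e) = span {e}" for x
  proof -
    \<comment> \<open>A multiple of the gradient itself attains any prescribed value, as the
      gradient is nonzero.\<close>
    have "\<exists>v. r = gradient f x \<bullet> v" for r
      using crit[of x] by (intro exI[of _ "(r / (gradient f x \<bullet> gradient f x)) *\<^sub>R gradient f x"]) simp
    then show ?thesis by (auto simp: span_singleton image_iff)
  qed
  have "dim (span {e}) = 1"
    using e0 by (simp add: dim_insert)
  then show ?thesis
    unfolding submanifold_def using Cg e0 dim
    by (intro ballI exI[of _ UNIV] exI[of _ "span {e}"] exI[of _ g])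
       (auto simp: dg(1) range g_def span_base span_mul)
qed

subsection \<open>Calibration and minimality of level sets\<close>

lemma convolve_tendsto:
  fixes g :: "'a::euclidean_space \<Rightarrow> real"
  assumes \<rho>: "\<And>j. mollifier (1 / real (Suc j)) (\<rho> j)" and g: "continuous_on UNIV g"
  shows "(\<lambda>j. convolve (\<rho> j) g x) \<longlonglongrightarrow> g x"
proof (rule LIMSEQ_I)
  fix \<epsilon> :: real assume \<epsilon>: "\<epsilon> > 0"
  have "isCont g x" using g by (simp add: continuous_on_eq_continuous_at)
  then obtain d where d: "d > 0" "\<And>y. dist y x < d \<Longrightarrow> dist (g y) (g x) < \<epsilon> / 2"
    unfolding continuous_at_eps_delta using \<epsilon> half_gt_zero by blast
  obtain J where J: "1 / real (Suc J) < d"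
    using d(1) nat_approx_posE by blast
  have "norm (convolve (\<rho> j) g x - g x) < \<epsilon>" if "j \<ge> J" for j
  proof -
    have "1 / real (Suc j) \<le> 1 / real (Suc J)"
      using that by (simp add: frac_le)
    then have close: "dist (g y) (g x) < \<epsilon> / 2" if "norm (x - y) \<le> 1 / real (Suc j)" for y
      using d(2)[of y] that J by (auto simp: dist_norm norm_minus_commute)
    have "g x - \<epsilon> / 2 \<le> g y \<and> g y \<le> g x + \<epsilon> / 2" if "norm (x - y) \<le> 1 / real (Suc j)" for y
      using close[OF that] unfolding dist_real_def by linarith
    then have "g x - \<epsilon> / 2 \<le> convolve (\<rho> j) g x" "convolve (\<rho> j) g x \<le> g x + \<epsilon> / 2"
      using convolve_bounds[OF \<rho>[of j] g, of x "g x - \<epsilon> / 2" "g x + \<epsilon> / 2"] by blast+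
    then show ?thesis
      using \<epsilon> by auto
  qed
  then show "\<exists>J. \<forall>j\<ge>J. norm (convolve (\<rho> j) g x - g x) < \<epsilon>" by blast
qed

context coordinate_order
begin

lemma hypersurface_volume_form_eq: "hypersurface_volume_form ix N x = hvol (N x)"
  by (simp add: hypersurface_volume_form_def fun_eq_iff)

text \<open>The choice in \<open>positive_frame\<close> demands only positive volume; together with
  the unit normal the frame is orthonormal, so the volume is 1 or -1 and positivity leaves
  1.\<close>

lemma positive_frame_properties:
  assumes "n \<ge> 1" "norm (N x) = 1"
  shows "orthonormal_frame n (positive_frame ix n N x)" "\<And>i. i < n \<Longrightarrow> positive_frame ix n N x i \<bullet> N x = 0"
    "hvol (N x) (positive_frame ix n N x) = 1"
proof -
  have "\<exists>v. orthonormal_frame n v \<and> (\<forall>i<n. v i \<bullet> N x = 0) \<and> hypersurface_volume_form ix N x v > 0"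
    using positive_frame_exists[OF assms(2,1)] unfolding hypersurface_volume_form_eq by force
  from someI_ex[OF this, folded positive_frame_def]
  show 1: "orthonormal_frame n (positive_frame ix n N x)" "\<And>i. i < n \<Longrightarrow> positive_frame ix n N x i \<bullet> N x = 0"
    and "hvol (N x) (positive_frame ix n N x) = 1"
    using vol_orthonormal[OF orthonormal_frame_case_nat[OF _ assms(2)]]
    unfolding hypersurface_volume_form_eq by force+
qed

lemma hvol_C_diff:
  assumes "\<And>b. C_diff k UNIV (\<lambda>x. N x \<bullet> b)"
  shows "C_diff k UNIV (\<lambda>x. hvol (N x) v)"
proof -
  have "hvol (N x) v = (\<Sum>b\<in>Basis. (N x \<bullet> b) * hvol b v)" for x
    by (rule sum_Basis_linear[OF hvol_linear, symmetric])
  then show ?thesis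
    using assms by (simp add: C_diff_sum C_diff_mult C_diff_const)
qed

lemma calibration_hvol:
  assumes n: "n \<ge> 1" and N: "\<And>b. C_diff 1 UNIV (\<lambda>x. N x \<bullet> b)" "\<And>x. norm (N x) = 1"
    "\<And>x. N differentiable (at x)" and div: "\<And>x. divergence N x = 0"
  shows "calibration n (\<lambda>x. hvol (N x))"
  unfolding calibration_def C_form_def
  using hvol_covector hvol_C_diff[OF N(1)] ext_deriv_hvol[OF N(3)] div comass_hvol[OF n N(2)] by simp

text \<open>Being chosen separately at each point, the frame may jump. The value of the form on it
  cannot, as \<open>covector_on_frame\<close> expresses it by the continuous normal and the values
  of the form on fixed vectors.\<close>

lemma continuous_on_positive_frame:
  assumes n: "n \<ge> 1" and N: "\<And>x. norm (N x) = 1" "continuous_on UNIV N"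
    and \<phi>: "\<And>x. k_covector n (\<phi> x)" "\<And>v. continuous_on UNIV (\<lambda>x. \<phi> x v)"
  shows "continuous_on UNIV (\<lambda>x. \<phi> x (positive_frame ix n N x))"
proof -
  have "\<phi> x (positive_frame ix n N x) = (\<Sum>i\<le>n. (-1) ^ i * ((ax i \<bullet> N x) * \<phi> x (omit i ax)))" for x
    by (rule covector_on_frame[OF \<phi>(1) N(1) positive_frame_properties(2,3)[of N x, OF n N(1)]])
  then show ?thesis
    using N(2) \<phi>(2) by (auto intro!: continuous_intros)
qed

lemma locally_rectifiable_level_set:
  fixes f :: "real ^ 'n \<Rightarrow> real"
  assumes n: "n \<ge> 1" and f: "C_diff 2 UNIV f" and crit: "\<And>x. gradient f x \<noteq> 0"
  shows "locally_rectifiable n (level_hypersurface f l) (\<lambda>_. 1) (positive_frame ix n (level_normal f))"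
proof -
  let ?W = "{x. f x = l}" and ?N = "level_normal f"
  let ?\<tau> = "positive_frame ix n ?N"
  have f1: "C_diff 1 UNIV f" using C_diff_le[OF f] by simp
  have dim: "DIM(real ^ 'n) = Suc n" by (simp add: card_coordinates)
  have N: "norm (?N x) = 1" for x
    using unit_gradient_regular(2)[OF f crit] by (simp add: level_normal_def)
  have cN: "continuous_on UNIV ?N"
    unfolding level_normal_def[abs_def]
    using differentiable_imp_continuous_within[OF unit_gradient_regular(3)[OF f crit]]
    by (intro continuous_intros) (simp add: continuous_on_eq_continuous_at)
  have W: "closed ?W"
    using continuous_closed_preimage_constant[of UNIV f l] C_diff_continuous[OF f] by simp
  have span: "span (?\<tau> x ` {..<n}) = {v. gradient f x \<bullet> v = 0}" for x
  proof (rule subspace_dim_equal)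
    have perp: "?\<tau> x i \<bullet> ?N x = 0" if "i < n" for i
      by (rule positive_frame_properties(2)[where N = ?N, OF n N that])
    have "gradient f x \<bullet> ?\<tau> x i = 0" if "i < n" for i
      using perp[OF that] crit[of x] by (simp add: level_normal_def unit_gradient_def inner_commute)
    then show "span (?\<tau> x ` {..<n}) \<subseteq> {v. gradient f x \<bullet> v = 0}"
      by (intro span_minimal) (auto simp: subspace_hyperplane)
    have "dim (span (?\<tau> x ` {..<n})) = n"
      using orthonormal_frame_span_finite(1,4)[OF positive_frame_properties(1)[where N = ?N, OF n N]]
      by (simp add: dim_eq_card_independent card_image)
    then show "dim {v. gradient f x \<bullet> v = 0} \<le> dim (span (?\<tau> x ` {..<n}))"
      using dim_hyperplane[OF crit[of x]] dim by simp
  qed (auto simp: subspace_hyperplane)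
  show ?thesis
    unfolding locally_rectifiable_def level_hypersurface_def
  proof (intro conjI allI impI ballI)
    show "?W \<in> sets borel" using W by (rule borel_closed)
    show "orthonormal_frame n (?\<tau> x)" for x
      by (rule positive_frame_properties(1)[where N = ?N, OF n N])
    show "(\<lambda>x. indicator ?W x * \<alpha> (?\<tau> x)) \<in> borel_measurable borel" if "k_covector n \<alpha>" for \<alpha>
      using continuous_on_positive_frame[OF n N cN, of "\<lambda>_. \<alpha>"] that W
      by (intro borel_measurable_times borel_measurable_indicator borel_closed
          borel_measurable_continuous_onI) auto
    show "(\<integral>\<^sup>+x. of_nat 1 * indicator (?W \<inter> K) x \<partial>hausdorff_measure n) < \<infinity>" if "compact K" for K
      using hausdorff_measure_level_set_finite[OF f1 crit dim that, of l] W compact_imp_closed[OF that]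
      by (simp add: closed_Int borel_closed)
    \<comment> \<open>The constant sequence with the level set itself: the tangency condition then
      holds at every point, since the frame spans the hyperplane orthogonal to the gradient.\<close>
    show "\<exists>M TM. (\<forall>j. submanifold n (M j) (TM j)) \<and> (AE x in hausdorff_measure n. x \<in> ?W \<longrightarrow>
        (\<exists>j. x \<in> M j) \<and> (\<forall>j. x \<in> M j \<longrightarrow> span (?\<tau> x ` {..<n}) = TM j x))"
      using submanifold_level_set[OF f1 crit dim, of l] span
      by (intro exI[of _ "\<lambda>_. ?W"] exI[of _ "\<lambda>_ x. {v. gradient f x \<bullet> v = 0}"]) auto
  qed auto
qed

lemma level_set_mass_le:
  fixes f :: "real ^ 'n \<Rightarrow> real" and l :: real
  assumes n: "n \<ge> 1" and f: "C_diff 2 UNIV f" and crit: "\<And>x. gradient f x \<noteq> 0"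
    and cal: "calibration n (\<lambda>x. hvol (level_normal f x))"
    and K: "compact K" and S: "real_flat_chain n S" "is_cycle n S"
  defines "T \<equiv> integration_current n (level_hypersurface f l \<inter> K) (\<lambda>_. 1) (positive_frame ix n (level_normal f))"
  shows "mass n T \<le> mass n (\<lambda>\<phi>. T \<phi> + S \<phi>)"
proof -
  define A where "A = {x. f x = l} \<inter> K"
  define H where "H = (hausdorff_measure n :: (real ^ 'n) measure)"
  let ?N = "level_normal f"
  let ?\<tau> = "positive_frame ix n ?N"
  let ?\<omega> = "\<lambda>x. hvol (?N x)"
  have f1: "C_diff 1 UNIV f" using C_diff_le[OF f] by simp
  have dim: "DIM(real ^ 'n) = Suc n" by (simp add: card_coordinates)
  have N: "norm (?N x) = 1" for x
    using unit_gradient_regular(2)[OF f crit] by (simp add: level_normal_def)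
  have cN: "continuous_on UNIV ?N"
    unfolding level_normal_def[abs_def]
    using differentiable_imp_continuous_within[OF unit_gradient_regular(3)[OF f crit]]
    by (intro continuous_intros) (simp add: continuous_on_eq_continuous_at)
  have "closed {x. f x = l}"
    using continuous_closed_preimage_constant[of UNIV f l] C_diff_continuous[OF f] by simp
  then have A: "A \<in> sets H"
    unfolding A_def H_def using compact_imp_closed[OF K] by (simp add: closed_Int borel_closed)
  have fin: "emeasure H A < \<infinity>"
    unfolding A_def H_def by (rule hausdorff_measure_level_set_finite[OF f1 crit dim K])
  have T: "T \<phi> = (\<integral>x. indicator A x * \<phi> x (?\<tau> x) \<partial>H)" for \<phi>
    by (simp add: T_def integration_current_def set_lebesgue_integral_def level_hypersurface_def A_def H_def)
  have intA: "integrable H (indicator A :: _ \<Rightarrow> real)"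
    using A fin by (rule integrable_real_indicator)
  have C\<omega>: "C_form 1 n ?\<omega>"
    using cal by (simp add: calibration_def)
  have C\<omega>0: "C_form 0 n ?\<omega>"
    using C\<omega> C_diff_le[of 1 _ 0] unfolding C_form_def by blast
  have c\<omega>: "continuous_on UNIV (\<lambda>x. ?\<omega> x v)" for v
    using C\<omega>0 by (simp add: C_form_def)
  \<comment> \<open>On an orthonormal frame a form of comass at most 1 takes values at most 1, so
    the finite measure of \<open>A\<close> dominates every value of \<open>T\<close>.\<close>
  have upper: "mass n T \<le> ereal (measure H A)"
    unfolding mass_def
  proof (rule SUP_least, safe)
    fix \<phi> :: "(real ^ 'n) form" assume \<phi>: "test_form n \<phi>" "\<forall>x. comass n (\<phi> x) \<le> 1"
    have "T \<phi> \<le> (\<integral>x. indicator A x \<partial>H)"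
      unfolding T
    proof (rule integral_mono'[OF intA])
      fix x
      have "\<phi> x (?\<tau> x) \<le> \<bar>\<phi> x (?\<tau> x)\<bar>" by simp
      also have "\<dots> \<le> comass n (\<phi> x)"
        using \<phi>(1) positive_frame_properties(1)[where N = ?N, OF n N]
        by (intro abs_le_comass) (auto simp: test_form_iff smooth_form_def)
      also have "\<dots> \<le> 1" using \<phi>(2) by simp
      finally show "indicator A x * \<phi> x (?\<tau> x) \<le> indicator A x"
        by (simp add: indicator_def)
    qed simp
    then show "ereal (T \<phi>) \<le> ereal (measure H A)"
      using A by simp
  qed
  have "\<exists>\<rho> :: real ^ 'n \<Rightarrow> real. mollifier (1 / real (Suc j)) \<rho>" for j
    using mollifier_exists[of "1 / real (Suc j)"] by (metis of_nat_0_less_iff zero_less_Suc zero_less_divide_1_iff)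
  then obtain \<rho> :: "nat \<Rightarrow> real ^ 'n \<Rightarrow> real" where \<rho>: "\<And>j. mollifier (1 / real (Suc j)) (\<rho> j)"
    by metis
  let ?\<omega>' = "\<lambda>j. mollified (\<rho> j) ?\<omega>"
  have s\<omega>': "smooth_form n (?\<omega>' j)" for j
    by (rule smooth_mollified[OF \<rho> C\<omega>0])
  have b\<omega>': "\<bar>?\<omega>' j x v\<bar> \<le> 1" if "orthonormal_frame n v" for j x v
  proof -
    have "-1 \<le> ?\<omega> y v \<and> ?\<omega> y v \<le> 1" for y
      using hvol_le_norm[OF that, of "?N y"] N[of y] by auto
    then show ?thesis
      using convolve_bounds[OF \<rho> c\<omega>, of x j "-1" v 1] unfolding mollified_def by auto
  qed
  have lower: "ereal (T (?\<omega>' j)) \<le> mass n (\<lambda>\<phi>. T \<phi> + S \<phi>)" for j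
  proof (rule mass_sum_ge[OF n S s\<omega>' _ b\<omega>' K])
    have "(\<lambda>y. ext_deriv n ?\<omega> y v) = (\<lambda>_. 0)" for v
      using cal unfolding calibration_def by blast
    then show "ext_deriv n (?\<omega>' j) x v = 0" for x v
      unfolding ext_deriv_mollified[OF \<rho> C\<omega>] by (simp add: convolve_const[OF \<rho>])
    show "T \<phi> = T \<psi>" if "\<And>x v. x \<in> K \<Longrightarrow> \<phi> x v = \<psi> x v" for \<phi> \<psi>
      unfolding T using that by (intro Bochner_Integration.integral_cong) (auto simp: A_def indicator_def)
  qed
  \<comment> \<open>The integrands are dominated by the indicator of \<open>A\<close>, which is
    integrable because \<open>A\<close> has finite measure. Pointwise they tend to the calibration
    on the positive frame, that is, to 1 on \<open>A\<close>.\<close>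
  have "(\<lambda>j. T (?\<omega>' j)) \<longlonglongrightarrow> (\<integral>x. indicator A x \<partial>H)"
    unfolding T
  proof (rule integral_dominated_convergence[where w = "indicator A"])
    show "(\<lambda>x. indicator A x * ?\<omega>' j x (?\<tau> x)) \<in> borel_measurable H" for j
    proof -
      have "continuous_on UNIV (\<lambda>x. ?\<omega>' j x (?\<tau> x))"
      proof (rule continuous_on_positive_frame[where N = ?N, OF n N cN])
        show "k_covector n (?\<omega>' j x)" for x
          using s\<omega>'[of j] unfolding smooth_form_def by blast
        show "continuous_on UNIV (\<lambda>x. ?\<omega>' j x v)" for v
          by (rule smooth_continuous) (use s\<omega>'[of j] in \<open>simp add: smooth_form_def\<close>)
      qed
      then have "(\<lambda>x. ?\<omega>' j x (?\<tau> x)) \<in> borel_measurable borel"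
        by (rule borel_measurable_continuous_onI)
      moreover have "borel_measurable H = borel_measurable (borel :: (real ^ 'n) measure)"
        by (rule measurable_cong_sets) (simp_all add: H_def)
      ultimately show ?thesis
        using A by (intro borel_measurable_times borel_measurable_indicator) auto
    qed
    show "AE x in H. (\<lambda>j. indicator A x * ?\<omega>' j x (?\<tau> x)) \<longlonglongrightarrow> indicator A x"
    proof (rule AE_I2)
      fix x
      have "(\<lambda>j. indicator A x * ?\<omega>' j x (?\<tau> x)) \<longlonglongrightarrow> indicator A x * ?\<omega> x (?\<tau> x)"
        unfolding mollified_def by (intro tendsto_intros convolve_tendsto[OF \<rho> c\<omega>])
      then show "(\<lambda>j. indicator A x * ?\<omega>' j x (?\<tau> x)) \<longlonglongrightarrow> indicator A x"
        by (simp add: positive_frame_properties(3)[where N = ?N, OF n N])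
    qed
    show "AE x in H. norm (indicator A x * ?\<omega>' j x (?\<tau> x)) \<le> indicator A x" for j
      using b\<omega>'[OF positive_frame_properties(1)[where N = ?N, OF n N]] by (intro AE_I2) (simp add: indicator_def)
  qed (use A intA in auto)
  then have "(\<lambda>j. ereal (T (?\<omega>' j))) \<longlonglongrightarrow> ereal (measure H A)"
    using A by simp
  then have "ereal (measure H A) \<le> mass n (\<lambda>\<phi>. T \<phi> + S \<phi>)"
    by (rule LIMSEQ_le_const2) (use lower in blast)
  with upper show ?thesis by (rule order_trans)
qed

end

theorem corollary3:
  fixes f :: "real ^ 'n \<Rightarrow> real" and n :: nat and ix :: "'n \<Rightarrow> nat" and c :: real
  assumes dim: "CARD('n) = n + 1" "n \<ge> 1"
    and coordinates: "bij_betw ix UNIV {..n}"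
    and C2: "C_diff 2 UNIV f"
    and no_critical_points: "\<And>x. gradient f x \<noteq> 0"
    and c: "c \<ge> 0"
    and constant_tension: "\<And>x. one_tension f x = c"
  shows "\<forall>l. calibrated ix n (level_hypersurface f l) (level_normal f) \<and>
             area_minimizing_over_R n (level_hypersurface f l) (\<lambda>_. 1)
               (positive_frame ix n (level_normal f))"
proof
  fix l
  interpret coordinate_order ix n
    by standard (rule coordinates)
  note X = unit_gradient_regular[OF C2 no_critical_points]
  have "c = 0"
    by (rule constant_divergence_eq_0[of "unit_gradient f"])
       (use X c constant_tension in \<open>auto simp: one_tension_def\<close>)
  have N: "C_diff 1 UNIV (\<lambda>x. level_normal f x \<bullet> b)" "norm (level_normal f x) = 1"
    "level_normal f differentiable (at x)" "divergence (level_normal f) x = 0" for x b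
  proof -
    show "C_diff 1 UNIV (\<lambda>x. level_normal f x \<bullet> b)"
      using C_diff_mult[OF C_diff_const[of 1 "-1"] X(1)[of b]] by (simp add: level_normal_def)
    show "norm (level_normal f x) = 1"
      using X(2) by (simp add: level_normal_def)
    have d: "(level_normal f has_derivative (\<lambda>v. - frechet_derivative (unit_gradient f) (at x) v)) (at x)"
      unfolding level_normal_def[abs_def]
      by (intro has_derivative_minus frechet_derivative_works[THEN iffD1] X(3))
    then show "level_normal f differentiable (at x)"
      by (rule differentiableI)
    have "divergence (level_normal f) x = - divergence (unit_gradient f) x"
      unfolding divergence_def frechet_derivative_at[OF d, symmetric] by (simp add: sum_negf)
    then show "divergence (level_normal f) x = 0"
      using constant_tension[of x] \<open>c = 0\<close> by (simp add: one_tension_def)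
  qed
  have cal: "calibration n (\<lambda>x. hvol (level_normal f x))"
    by (rule calibration_hvol[OF dim(2) N])
  then have "calibrated ix n (level_hypersurface f l) (level_normal f)"
    unfolding calibrated_def hypersurface_volume_form_eq by blast
  moreover have "area_minimizing_over_R n (level_hypersurface f l) (\<lambda>_. 1) (positive_frame ix n (level_normal f))"
    unfolding area_minimizing_over_R_def
    using locally_rectifiable_level_set[OF dim(2) C2 no_critical_points]
      level_set_mass_le[OF dim(2) C2 no_critical_points cal] by blast
  ultimately show "calibrated ix n (level_hypersurface f l) (level_normal f) \<and>
      area_minimizing_over_R n (level_hypersurface f l) (\<lambda>_. 1) (positive_frame ix n (level_normal f))" ..
qed

end
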